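(* Let $f:\mathbb R\to\mathbb R$ be a smooth function such that $f$ and $f_u$ are linearly independent over $\mathbb R$, and let $0\ne P\in V_d$. If $d>0$, then $P_z=0$, i.e. $P$ is a polynomial in the $u_j$ of the form $P=b\,u_{d-1}+\cdots$ with $b\neq0$. If $d<0$, then $P_{\bar z}=0$, i.e. $P$ is a polynomial in the $\bar u_j$ of the form $P=c\,\bar u_{-d-1}+\cdots$ with $c\ne0$. Here $b,c\in\mathbb C$ are constants and the dots denote a polynomial in the variables $u_j$ (respectively $\bar u_j$) of lower index, i.e. $j<|d|-1$.
   Context: Subscripts such as $f_u$, $P_{u_i}$, $P_z$ denote partial derivatives; bars denote complex conjugation. The functions live on the infinite jet space $M^{(\infty)}$ with complex coordinates $z,u_0,u_1,u_2,\dots$ and real coordinate $u$ (each smooth function depends on finitely many coordinates). Put $T^0=f(u)$, $T^{i+1}=\sum_{j=0}^{i}\binom ij u_{i-j}\,T^j_u$, and $e_{-1}=\partial_z+u_0\partial_u+\sum_{i\ge0}u_{i+1}\partial_{u_i}-\sum_{i\ge0}\overline{T^i}\,\partial_{\bar u_i}$, $e_{\overline{-1}}=\overline{e_{-1}}$. A complex function $P$ has weighted degree $d\in\mathbb Z$ if $P(u,\lambda^{-1}z,(\lambda^{j+1}u_j)_j)=\lambda^dP(u,z,(u_j)_j)$ for all $\lambda\in\mathbb C$ with $|\lambda|=1$. $V_d$ is the complex vector space of complex-valued functions $P$ on $M^{(\infty)}$ of weighted degree $d$ satisfying $e_{\overline{-1}}e_{-1}P+f_uP=0$, $P_u=0$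 and $P_{u_i\bar u_j}=0$ for all $i,j\ge0$.
   Formalization: The formal theorem additionally assumes that f is not affine: for f(u)=au+b with a≠0, f and f_u are independent, but V_d contains nonzero Bessel-type functions of z and its conjugate alone with P_z≠0 and P_{\bar z}≠0, so the claim fails for every d≠0. *)

theory Defs
  imports "HOL-Analysis.Analysis" "HOL-Library.Poly_Mapping"
begin

text \<open>
  A point of the infinite jet space is a triple \<open>(u, z, w)\<close>, where \<open>w i\<close> is the complex coordinate
  \<open>u\<^sub>i\<close>. A function of the complex coordinates is an arbitrary function on this space; it need not be
  holomorphic, so \<open>z\<close> and \<open>cnj z\<close> (and likewise \<open>w i\<close> and \<open>cnj (w i)\<close>) are treated as independent
  variables through the Wirtinger derivatives below.
\<close>

type_synonym jet = "real \<times> complex \<times> (nat \<Rightarrow> complex)"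

datatype coord = U | Re_z | Im_z | Re_u nat | Im_u nat

fun shift :: "coord \<Rightarrow> real \<Rightarrow> jet \<Rightarrow> jet" where
  "shift U t (u, z, w) = (u + t, z, w)"
| "shift Re_z t (u, z, w) = (u, z + of_real t, w)"
| "shift Im_z t (u, z, w) = (u, z + \<i> * of_real t, w)"
| "shift (Re_u i) t (u, z, w) = (u, z, w(i := w i + of_real t))"
| "shift (Im_u i) t (u, z, w) = (u, z, w(i := w i + \<i> * of_real t))"

definition pd :: "coord \<Rightarrow> (jet \<Rightarrow> complex) \<Rightarrow> jet \<Rightarrow> complex" where
  "pd c P x = vector_derivative (\<lambda>t. P (shift c t x)) (at 0)"

definition depends_below :: "nat \<Rightarrow> (jet \<Rightarrow> complex) \<Rightarrow> bool" where
  "depends_below n P \<longleftrightarrow> (\<forall>u z w w'. (\<forall>i<n. w i = w' i) \<longrightarrow> P (u, z, w) = P (u, z, w'))"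

text \<open>
  Smoothness: dependence on finitely many coordinates, and all iterated real partial derivatives exist
  and are continuous. Continuity refers to the product topology on the sequences \<open>w\<close>; for a function
  of finitely many coordinates this is ordinary continuity in those coordinates.
\<close>

definition smooth :: "(jet \<Rightarrow> complex) \<Rightarrow> bool" where
  "smooth P \<longleftrightarrow> (\<exists>n. depends_below n P) \<and>
     (\<forall>cs. continuous_on UNIV (foldr pd cs P) \<and>
           (\<forall>c x. (\<lambda>t. foldr pd cs P (shift c t x)) differentiable (at 0)))"

definition smooth_real :: "(real \<Rightarrow> real) \<Rightarrow> bool" where
  "smooth_real f \<longleftrightarrow> (\<forall>k x. (deriv ^^ k) f differentiable (at x))"

definition d_z :: "(jet \<Rightarrow> complex) \<Rightarrow> jet \<Rightarrow> complex" where
  "d_z P x = (pd Re_z P x - \<i> * pd Im_z P x) / 2"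

definition d_zbar :: "(jet \<Rightarrow> complex) \<Rightarrow> jet \<Rightarrow> complex" where
  "d_zbar P x = (pd Re_z P x + \<i> * pd Im_z P x) / 2"

definition d_u :: "nat \<Rightarrow> (jet \<Rightarrow> complex) \<Rightarrow> jet \<Rightarrow> complex" where
  "d_u i P x = (pd (Re_u i) P x - \<i> * pd (Im_u i) P x) / 2"

definition d_ubar :: "nat \<Rightarrow> (jet \<Rightarrow> complex) \<Rightarrow> jet \<Rightarrow> complex" where
  "d_ubar i P x = (pd (Re_u i) P x + \<i> * pd (Im_u i) P x) / 2"

fun T :: "(real \<Rightarrow> real) \<Rightarrow> nat \<Rightarrow> jet \<Rightarrow> complex" where
  "T f 0 = (\<lambda>(u, z, w). of_real (f u))"
| "T f (Suc i) = (\<lambda>(u, z, w). \<Sum>j\<le>i. of_nat (i choose j) * w (i - j) * pd U (T f j) (u, z, w))"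

text \<open>
  The two series have only finitely many nonzero terms when \<open>P\<close> depends on finitely many coordinates.
\<close>

fun e_m1 :: "(real \<Rightarrow> real) \<Rightarrow> (jet \<Rightarrow> complex) \<Rightarrow> jet \<Rightarrow> complex" where
  "e_m1 f P (u, z, w) =
     d_z P (u, z, w) + w 0 * pd U P (u, z, w)
     + suminf (\<lambda>i. w (Suc i) * d_u i P (u, z, w))
     - suminf (\<lambda>i. cnj (T f i (u, z, w)) * d_ubar i P (u, z, w))"

definition e_m1_bar :: "(real \<Rightarrow> real) \<Rightarrow> (jet \<Rightarrow> complex) \<Rightarrow> jet \<Rightarrow> complex" where
  "e_m1_bar f P x = cnj (e_m1 f (\<lambda>y. cnj (P y)) x)"

definition weighted_degree :: "int \<Rightarrow> (jet \<Rightarrow> complex) \<Rightarrow> bool" where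
  "weighted_degree d P \<longleftrightarrow>
     (\<forall>l u z w. cmod l = 1 \<longrightarrow>
        P (u, inverse l * z, \<lambda>j. l ^ (j + 1) * w j) = l powi d * P (u, z, w))"

definition V :: "(real \<Rightarrow> real) \<Rightarrow> int \<Rightarrow> (jet \<Rightarrow> complex) set" where
  "V f d = {P. smooth P \<and> weighted_degree d P \<and>
     (\<forall>x. e_m1_bar f (e_m1 f P) x + of_real (deriv f (fst x)) * P x = 0) \<and>
     (\<forall>x. pd U P x = 0) \<and>
     (\<forall>i j x. d_ubar j (d_u i P) x = 0)}"

text \<open>
  Complex polynomials in variables indexed by \<open>nat\<close>, represented as finitely supported maps from
  exponent vectors to coefficients.
\<close>

type_synonym cpoly = "(nat \<Rightarrow>\<^sub>0 nat) \<Rightarrow>\<^sub>0 complex"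

definition poly_vars :: "cpoly \<Rightarrow> nat set" where
  "poly_vars q = (\<Union>\<alpha> \<in> Poly_Mapping.keys q. Poly_Mapping.keys \<alpha>)"

definition poly_eval :: "cpoly \<Rightarrow> (nat \<Rightarrow> complex) \<Rightarrow> complex" where
  "poly_eval q v =
     (\<Sum>\<alpha> \<in> Poly_Mapping.keys q. Poly_Mapping.lookup q \<alpha> *
        (\<Prod>j \<in> Poly_Mapping.keys \<alpha>. v j ^ Poly_Mapping.lookup \<alpha> j))"

text \<open>
  Affine potentials must be excluded separately: linear independence of \<open>f\<close> and \<open>f\<^sub>u\<close> does not exclude
  them, and the result fails for them. If \<open>f u = a * u + b\<close> with \<open>a \<noteq> 0\<close>, every solution \<open>\<phi>\<close> of the linear equation
  \<open>d_zbar (d_z \<phi>) = - a * \<phi>\<close> depending on \<open>z\<close> and \<open>cnj z\<close> only satisfies the equations defining \<open>V f d\<close>.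
  For \<open>a = 1\<close> and \<open>d > 0\<close> the function \<open>\<phi> = (\<Sum>k. (-1)^k * z^k * (cnj z)^(k+d) / (fact k * fact (k+d)))\<close>,
  that is \<open>J\<^sub>d (2 * r) * exp (- \<i> * d * \<theta>)\<close> in polar coordinates, is a nonzero element of \<open>V f d\<close>
  with \<open>d_z \<phi> \<noteq> 0\<close>.
\<close>

definition affine_fun :: "(real \<Rightarrow> real) \<Rightarrow> bool" where
  "affine_fun f \<longleftrightarrow> (\<exists>a b. \<forall>u. f u = a * u + b)"

end

theory Submission
  imports Defs "HOL-Complex_Analysis.Cauchy_Integral_Formula"
begin

text \<open>The leverage is that \<open>P\<close> does not depend on \<open>u\<close> while the
  coefficients \<open>f u\<close> and \<open>deriv f u\<close> do: every equation is a one-parameter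
  family of equations for the same functions. Absence of mixed derivatives makes each u_k-derivative
  of \<open>P\<close> holomorphic in the fibre, so the conjugate half of the equation drops out on
  differentiation. G_k is the convenient unknown: if n is the highest order, G_{n+1} is the
  u_n-derivative of \<open>P\<close>, and both G_{n+1} and G_n are killed by the barred derivation,
  the latter because f' G_{n+1} cancels the term coming from f' P. As the leading coefficient then
  involves z only, its values at u_j = 0 decide whether it vanishes, and by descending induction a
  solution is determined by its linear part. The obstacle is f' = \<kappa> f - c, an exponential
  plus a constant: there 1, f, f' give only two relations instead of three, and the G_k have to be
  used jointly away from u_j = 0. Independence of f and f' gives c \<noteq> 0, and the exclusion of
  affine f gives \<kappa> \<noteq> 0.\<close>

text \<open>
  Differentiating the equation by \<open>u\<^sub>k\<close> gives, with \<open>G\<^sub>k\<close> the \<open>u\<^sub>k\<close>-derivative of \<open>e\<^sub>-\<^sub>1 P\<close>, an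
  equation for the barred derivation applied to \<open>G\<^sub>k\<close>, valid for every value of \<open>u\<close> in the
  coefficients. A \<open>u\<close>-independent holomorphic function killed by the barred derivation for all \<open>u\<close>
  does not depend on the \<open>u\<^sub>j\<close> at all, because commutators of the derivations at different \<open>u\<close>
  produce vector fields with leading term the derivative by any given \<open>u\<^sub>k\<close>. Hence the
  leading coefficient of \<open>P\<close> is a holomorphic function of \<open>z\<close> only.

  At \<open>u\<^sub>j = 0\<close> the equations reduce to linear relations between \<open>1\<close>, \<open>f\<close> and \<open>f'\<close>. If these are
  linearly independent, the coefficients of \<open>u\<^sub>k\<close> with \<open>k \<ge> 1\<close> in \<open>P\<close> are constant; otherwise
  \<open>f' = \<kappa> f - c\<close> with \<open>\<kappa>, c \<noteq> 0\<close>, and \<open>P\<close> has order at most \<open>0\<close>. In both cases the part of \<open>P\<close>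
  of degree \<open>0\<close> in the fibre vanishes. For \<open>d > 0\<close> the weights leave only the coefficient of
  \<open>u\<^sub>d\<^sub>-\<^sub>1\<close> in the linear part. As \<open>P\<^sub>z\<close> and its conjugate counterpart solve the same equation and have
  no linear part, they vanish, and homogeneity makes \<open>P\<close> a polynomial. The case \<open>d < 0\<close> follows by
  conjugation.
\<close>

section \<open>Partial derivatives of smooth functions\<close>

fun dir_u :: "coord \<Rightarrow> real" where
  "dir_u U = 1" | "dir_u _ = 0"

fun dir_z :: "coord \<Rightarrow> complex" where
  "dir_z Re_z = 1" | "dir_z Im_z = \<i>" | "dir_z _ = 0"

fun dir_w :: "coord \<Rightarrow> nat \<Rightarrow> complex" where
  "dir_w (Re_u i) = (\<lambda>j. if j = i then 1 else 0)"
| "dir_w (Im_u i) = (\<lambda>j. if j = i then \<i> else 0)"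
| "dir_w _ = (\<lambda>_. 0)"

lemma shift_eq_translation:
  "shift c t x = (fst x + t * dir_u c, fst (snd x) + of_real t * dir_z c,
     \<lambda>i. snd (snd x) i + of_real t * dir_w c i)"
  by (cases x; cases c) (auto simp: fun_eq_iff)

lemma shift_add: "shift c s (shift c t x) = shift c (s + t) x"
  by (simp add: shift_eq_translation algebra_simps)

lemma shift_commute: "shift c s (shift c' t x) = shift c' t (shift c s x)"
  by (simp add: shift_eq_translation algebra_simps)

lemma shift_0 [simp]: "shift c 0 x = x"
  by (simp add: shift_eq_translation)

lemma continuous_on_shift2: "continuous_on UNIV (\<lambda>(s, t). shift c s (shift c' t x))"
  unfolding shift_eq_translation case_prod_beta
  by (auto intro!: continuous_intros continuous_on_coordinatewise_then_product)

text \<open>Only one mixed derivative is assumed to exist. Writing \<open>F\<close> as an integral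
  of \<open>Fs\<close> and differentiating under the integral sign exhibits \<open>Ft\<close> as an
  integral of \<open>Fst\<close>, and the fundamental theorem then differentiates it in s.\<close>

lemma mixed_partials_commute:
  fixes F :: "real \<Rightarrow> real \<Rightarrow> complex"
  assumes Fs: "\<And>s t. ((\<lambda>s. F s t) has_vector_derivative Fs s t) (at s)"
    and Ft: "\<And>s t. ((\<lambda>t. F s t) has_vector_derivative Ft s t) (at t)"
    and Fst: "\<And>s t. ((\<lambda>t. Fs s t) has_vector_derivative Fst s t) (at t)"
    and Fs_cont: "continuous_on UNIV (\<lambda>(s, t). Fs s t)"
    and Fst_cont: "continuous_on UNIV (\<lambda>(s, t). Fst s t)"
  shows "((\<lambda>s. Ft s t) has_vector_derivative Fst s t) (at s)"
proof -
  \<comment> \<open>A window with s in its interior: the integrals start left of s, and the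
    derivative within the window is the two-sided one.\<close>
  define a b where "a = s - 1" and "b = s + 1"
  have Fs_cont1: "continuous_on A (\<lambda>r. Fs r t)" for A t
    using continuous_on_compose2[OF Fs_cont continuous_on_Pair[OF continuous_on_id continuous_on_const]]
    by simp
  have Fst_cont1: "continuous_on A (\<lambda>r. Fst r t)" for A t
    using continuous_on_compose2[OF Fst_cont continuous_on_Pair[OF continuous_on_id continuous_on_const]]
    by simp
  have F_eq: "F r t = F a t + integral {a..r} (\<lambda>q. Fs q t)" if "r \<ge> a" for r t
  proof -
    have "((\<lambda>q. Fs q t) has_integral (F r t - F a t)) {a..r}"
      by (rule fundamental_theorem_of_calculus[OF that])
         (use Fs has_vector_derivative_at_within in blast)
    then show ?thesis by (simp add: integral_unique)
  qed
  have Ft_eq: "Ft r t = Ft a t + integral {a..r} (\<lambda>q. Fst q t)" if r: "r \<ge> a" for r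
  proof -
    have 1: "((\<lambda>t. integral (cbox a r) (\<lambda>q. Fs q t)) has_vector_derivative
        integral (cbox a r) (\<lambda>q. Fst q t)) (at t within UNIV)"
    proof (rule leibniz_rule_vector_derivative)
      show "((\<lambda>t. Fs q t) has_vector_derivative Fst q t') (at t' within UNIV)" for t' q
        using Fst by simp
      show "(\<lambda>q. Fs q t') integrable_on cbox a r" for t'
        by (intro integrable_continuous Fs_cont1)
      show "continuous_on (UNIV \<times> cbox a r) (\<lambda>(x, q). Fst q x)"
        using continuous_on_compose2[OF Fst_cont continuous_on_swap]
        by (simp add: case_prod_beta)
    qed auto
    have "((\<lambda>t. F a t + integral {a..r} (\<lambda>q. Fs q t)) has_vector_derivative
        Ft a t + integral {a..r} (\<lambda>q. Fst q t)) (at t)"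
      using has_vector_derivative_add[OF Ft[of a t]] 1 by simp
    then have "((\<lambda>t. F r t) has_vector_derivative Ft a t + integral {a..r} (\<lambda>q. Fst q t)) (at t)"
      using F_eq[OF r] by simp
    with Ft show ?thesis using vector_derivative_unique_at by blast
  qed
  have "((\<lambda>r. integral {a..r} (\<lambda>q. Fst q t)) has_vector_derivative Fst s t) (at s within {a..b})"
    by (rule integral_has_vector_derivative) (auto simp: a_def b_def Fst_cont1)
  then have "((\<lambda>r. Ft a t + integral {a..r} (\<lambda>q. Fst q t)) has_vector_derivative Fst s t)
      (at s within {a..b})"
    by (rule has_vector_derivative_add[OF has_vector_derivative_const, simplified])
  then have "((\<lambda>r. Ft r t) has_vector_derivative Fst s t) (at s within {a..b})"
  proof (rule has_vector_derivative_transform[rotated 2])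
    show "Ft r t = Ft a t + integral {a..r} (\<lambda>q. Fst q t)" if "r \<in> {a..b}" for r
      by (rule Ft_eq) (use that in simp)
  qed (simp add: a_def b_def)
  moreover have "at s within {a..b} = at s"
    by (rule at_within_interior) (auto simp: a_def b_def)
  ultimately show ?thesis by simp
qed

text \<open>\<open>shift c\<close> is a flow by \<open>shift_add\<close>, so a derivative at time 0
  at every point gives one at every time.\<close>

lemma has_vector_derivative_shift:
  assumes "\<And>x. ((\<lambda>t. P (shift c t x)) has_vector_derivative P' x) (at 0)"
  shows "((\<lambda>t. P (shift c t x)) has_vector_derivative P' (shift c t x)) (at t)"
proof -
  have "((\<lambda>r. P (shift c r (shift c t x))) has_vector_derivative P' (shift c t x)) (at (t - t))"
    using assms by simp
  moreover have "((\<lambda>r::real. r - t) has_vector_derivative 1) (at t)"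
    by (auto intro!: derivative_eq_intros simp: has_vector_derivative_def)
  ultimately have "(((\<lambda>r. P (shift c r (shift c t x))) \<circ> (\<lambda>r. r - t)) has_vector_derivative
      1 *\<^sub>R P' (shift c t x)) (at t)"
    using vector_diff_chain_at by fast
  then show ?thesis by (simp add: shift_add o_def)
qed

lemma pd_eqI:
  assumes "((\<lambda>t. P (shift c t x)) has_vector_derivative p) (at 0)"
  shows "pd c P x = p"
  unfolding pd_def by (rule vector_derivative_at[OF assms])

lemma smooth_pd_deriv:
  assumes "smooth P"
  shows "((\<lambda>t. P (shift c t x)) has_vector_derivative pd c P (shift c t x)) (at t)"
proof (rule has_vector_derivative_shift)
  fix x
  have "(\<lambda>t. foldr pd [] P (shift c t x)) differentiable (at 0)"
    using assms unfolding smooth_def by blast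
  then show "((\<lambda>t. P (shift c t x)) has_vector_derivative pd c P x) (at 0)"
    unfolding pd_def by (simp add: vector_derivative_works)
qed

lemma smooth_pd_deriv0:
  assumes "smooth P"
  shows "((\<lambda>t. P (shift c t x)) has_vector_derivative pd c P x) (at 0)"
  using smooth_pd_deriv[OF assms, of c x 0] by simp

lemma smooth_continuous: "smooth P \<Longrightarrow> continuous_on A P"
  unfolding smooth_def by (metis continuous_on_subset foldr.simps(1) id_apply subset_UNIV)

lemma depends_below_mono: "depends_below m P \<Longrightarrow> m \<le> n \<Longrightarrow> depends_below n P"
  unfolding depends_below_def by auto

lemma depends_below_compose2:
  assumes "depends_below m P" "depends_below n Q"
  shows "depends_below (max m n) (\<lambda>x. h (P x) (Q x))"
  using depends_below_mono[OF assms(1), of "max m n"] depends_below_mono[OF assms(2), of "max m n"]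
  unfolding depends_below_def by (intro allI impI arg_cong2[where f = h]) auto

lemma depends_below_pd:
  assumes "depends_below n P" shows "depends_below n (pd c P)"
  unfolding depends_below_def
proof safe
  fix u :: real and z :: complex and w w' :: "nat \<Rightarrow> complex"
  assume "\<forall>i<n. w i = w' i"
  then have "P (shift c t (u, z, w)) = P (shift c t (u, z, w'))" for t
    using assms unfolding depends_below_def shift_eq_translation by simp
  then show "pd c P (u, z, w) = pd c P (u, z, w')" unfolding pd_def by simp
qed

lemma smooth_pd: 
  assumes "smooth P" shows "smooth (pd c P)"
proof -
  have "foldr pd cs (pd c P) = foldr pd (cs @ [c]) P" for cs by simp
  then show ?thesis using assms depends_below_pd unfolding smooth_def by metis
qed

lemma pd_commute:
  assumes P: "smooth P"
  shows "pd c (pd c' P) x = pd c' (pd c P) x"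
proof -
  have cont: "continuous_on UNIV (\<lambda>(s, t). Q (shift c' s (shift c t x)))" if "smooth Q" for Q
    using continuous_on_compose2[OF smooth_continuous[OF that] continuous_on_shift2[of c' c x], of UNIV]
    by (simp add: case_prod_beta)
  have swap: "shift c' s (shift c t x) = shift c t (shift c' s x)" for s t
    by (rule shift_commute)
  have "((\<lambda>s. pd c P (shift c' s (shift c t x))) has_vector_derivative
       pd c (pd c' P) (shift c' s (shift c t x))) (at s)" for s t
  proof (rule mixed_partials_commute)
    show "((\<lambda>s. P (shift c' s (shift c t x))) has_vector_derivative
        pd c' P (shift c' s (shift c t x))) (at s)" for s t
      by (rule smooth_pd_deriv[OF P])
    show "((\<lambda>t. P (shift c' s (shift c t x))) has_vector_derivative
        pd c P (shift c' s (shift c t x))) (at t)" for s t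
      unfolding swap by (rule smooth_pd_deriv[OF P])
    show "((\<lambda>t. pd c' P (shift c' s (shift c t x))) has_vector_derivative
        pd c (pd c' P) (shift c' s (shift c t x))) (at t)" for s t
      unfolding swap by (rule smooth_pd_deriv[OF smooth_pd[OF P]])
    show "continuous_on UNIV (\<lambda>(s, t). pd c' P (shift c' s (shift c t x)))"
      by (rule cont[OF smooth_pd[OF P]])
    show "continuous_on UNIV (\<lambda>(s, t). pd c (pd c' P) (shift c' s (shift c t x)))"
      by (rule cont[OF smooth_pd[OF smooth_pd[OF P]]])
  qed
  from this[of 0 0] have "((\<lambda>s. pd c P (shift c' s x)) has_vector_derivative pd c (pd c' P) x) (at 0)"
    by simp
  from pd_eqI[OF this] show ?thesis ..
qed

text \<open>A set stable under all partial derivatives contains every iterated derivative of its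
  members. This replaces explicit formulas for higher derivatives in the closure properties
  below.\<close>

lemma smooth_coinduct:
  assumes "P \<in> S"
    and cont: "\<And>Q. Q \<in> S \<Longrightarrow> continuous_on UNIV Q"
    and dep: "\<And>Q. Q \<in> S \<Longrightarrow> \<exists>n. depends_below n Q"
    and pd: "\<And>Q c. Q \<in> S \<Longrightarrow> \<exists>Q'\<in>S. \<forall>x. ((\<lambda>t. Q (shift c t x)) has_vector_derivative Q' x) (at 0)"
  shows "smooth P"
proof -
  have *: "pd c Q \<in> S \<and> (\<lambda>t. Q (shift c t x)) differentiable (at 0)" if Q: "Q \<in> S" for Q c x
  proof -
    obtain Q' where "Q' \<in> S" and Q': "\<forall>x. ((\<lambda>t. Q (shift c t x)) has_vector_derivative Q' x) (at 0)"
      using pd[OF Q] by blast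
    moreover have "pd c Q = Q'" using pd_eqI Q' by blast
    ultimately show ?thesis using differentiableI_vector by blast
  qed
  have "foldr pd cs P \<in> S" for cs
    by (induction cs) (use \<open>P \<in> S\<close> * in auto)
  then show ?thesis unfolding smooth_def using * cont dep \<open>P \<in> S\<close> by blast
qed

text \<open>Sums and products are generated together because the derivative of a product is a sum of
  two products.\<close>

inductive_set smooth_algebra :: "(jet \<Rightarrow> complex) set" where
  base: "smooth P \<Longrightarrow> P \<in> smooth_algebra"
| add: "P \<in> smooth_algebra \<Longrightarrow> Q \<in> smooth_algebra \<Longrightarrow> (\<lambda>x. P x + Q x) \<in> smooth_algebra"
| mult: "P \<in> smooth_algebra \<Longrightarrow> Q \<in> smooth_algebra \<Longrightarrow> (\<lambda>x. P x * Q x) \<in> smooth_algebra"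

lemma smooth_algebra_smooth:
  assumes "P \<in> smooth_algebra" shows "smooth P"
proof (rule smooth_coinduct[OF assms])
  show "continuous_on UNIV Q" if "Q \<in> smooth_algebra" for Q
    using that by induction (auto intro: smooth_continuous continuous_intros)
  show "\<exists>n. depends_below n Q" if "Q \<in> smooth_algebra" for Q
    using that
  proof induction
    case (base P) then show ?case unfolding smooth_def by blast
  next
    case (add P Q)
    then show ?case using depends_below_compose2[where h = "(+)"] by blast
  next
    case (mult P Q)
    then show ?case using depends_below_compose2[where h = "(*)"] by blast
  qed
  show "\<exists>Q'\<in>smooth_algebra. \<forall>x. ((\<lambda>t. Q (shift c t x)) has_vector_derivative Q' x) (at 0)"
    if "Q \<in> smooth_algebra" for Q c
    using that
  proof induction
    case (base P)
    then show ?case using smooth_pd smooth_pd_deriv0 smooth_algebra.base by meson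
  next
    case (add P Q)
    then obtain P' Q' where *: "P' \<in> smooth_algebra" "Q' \<in> smooth_algebra"
      "\<And>x. ((\<lambda>t. P (shift c t x)) has_vector_derivative P' x) (at 0)"
      "\<And>x. ((\<lambda>t. Q (shift c t x)) has_vector_derivative Q' x) (at 0)" by blast
    show ?case
      by (rule bexI[of _ "\<lambda>x. P' x + Q' x"])
         (use * in \<open>auto intro!: has_vector_derivative_add smooth_algebra.add\<close>)
  next
    case (mult P Q)
    then obtain P' Q' where *: "P' \<in> smooth_algebra" "Q' \<in> smooth_algebra"
      "\<And>x. ((\<lambda>t. P (shift c t x)) has_vector_derivative P' x) (at 0)"
      "\<And>x. ((\<lambda>t. Q (shift c t x)) has_vector_derivative Q' x) (at 0)" by blast
    have "((\<lambda>t. P (shift c t x) * Q (shift c t x)) has_vector_derivative P x * Q' x + P' x * Q x) (at 0)" for x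
      using has_vector_derivative_mult[OF *(3)[of x] *(4)[of x]] by simp
    then show ?case
      by (intro bexI[of _ "\<lambda>x. P x * Q' x + P' x * Q x"])
         (use * mult in \<open>auto intro!: smooth_algebra.add smooth_algebra.mult\<close>)
  qed
qed

lemma smooth_add: "smooth P \<Longrightarrow> smooth Q \<Longrightarrow> smooth (\<lambda>x. P x + Q x)"
  by (rule smooth_algebra_smooth[OF smooth_algebra.add[OF smooth_algebra.base smooth_algebra.base]])

lemma smooth_mult: "smooth P \<Longrightarrow> smooth Q \<Longrightarrow> smooth (\<lambda>x. P x * Q x)"
  by (rule smooth_algebra_smooth[OF smooth_algebra.mult[OF smooth_algebra.base smooth_algebra.base]])

lemma smooth_const: "smooth (\<lambda>x. a)"
proof (rule smooth_coinduct[where S = "{\<lambda>x. a, \<lambda>x. 0}"])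
  show "\<exists>Q'\<in>{\<lambda>x. a, \<lambda>x. 0}. \<forall>x. ((\<lambda>t. Q (shift c t x)) has_vector_derivative Q' x) (at 0)"
    if "Q \<in> {\<lambda>x. a, \<lambda>x. 0}" for Q c
  proof (rule bexI[of _ "\<lambda>x. 0"])
    show "\<forall>x. ((\<lambda>t. Q (shift c t x)) has_vector_derivative 0) (at 0)"
      using that by (elim insertE emptyE) (simp_all only: has_vector_derivative_const simp_thms)
  qed simp
  show "continuous_on UNIV Q" if "Q \<in> {\<lambda>x. a, \<lambda>x. 0}" for Q
    using that by (elim insertE emptyE) (simp_all only: continuous_on_const)
  show "\<exists>n. depends_below n Q" if "Q \<in> {\<lambda>x. a, \<lambda>x. 0}" for Q
    using that by (elim insertE emptyE) (simp_all only: depends_below_def simp_thms)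
qed simp

lemma smooth_coord: "smooth (\<lambda>x. snd (snd x) i)"
proof (rule smooth_coinduct[where S = "insert (\<lambda>x. snd (snd x) i) {P. smooth P}"])
  show "\<exists>Q'\<in>insert (\<lambda>x. snd (snd x) i) {P. smooth P}.
      \<forall>x. ((\<lambda>t. Q (shift c t x)) has_vector_derivative Q' x) (at 0)"
    if "Q \<in> insert (\<lambda>x. snd (snd x) i) {P. smooth P}" for Q c
  proof (cases "smooth Q")
    case True then show ?thesis using smooth_pd smooth_pd_deriv0 by blast
  next
    case False
    then have Q: "Q = (\<lambda>x. snd (snd x) i)" using that by blast
    show ?thesis
      by (rule bexI[of _ "\<lambda>x. dir_w c i"])
         (auto simp: Q shift_eq_translation smooth_const has_vector_derivative_def
            scaleR_conv_of_real intro!: derivative_eq_intros)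
  qed
  show "continuous_on UNIV Q" if "Q \<in> insert (\<lambda>x. snd (snd x) i) {P. smooth P}" for Q
  proof (cases "smooth Q")
    case True then show ?thesis by (rule smooth_continuous)
  next
    case False
    moreover have "continuous_on UNIV (\<lambda>x. snd (snd x) i :: complex)"
      by (rule continuous_on_compose2[OF continuous_on_product_coordinates, where s = UNIV])
         (auto intro!: continuous_on_snd continuous_on_id)
    ultimately show ?thesis using that by auto
  qed
  show "\<exists>n. depends_below n Q" if "Q \<in> insert (\<lambda>x. snd (snd x) i) {P. smooth P}" for Q
  proof (cases "smooth Q")
    case False
    then have "depends_below (Suc i) Q" using that by (auto simp: depends_below_def)
    then show ?thesis ..
  qed (auto simp: smooth_def)
qed simp

lemma smooth_cnj:
  assumes "smooth P" shows "smooth (\<lambda>x. cnj (P x))"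
proof (rule smooth_coinduct[where S = "(\<lambda>P x. cnj (P x)) ` {P. smooth P}"])
  show "\<exists>Q'\<in>(\<lambda>P x. cnj (P x)) ` {P. smooth P}.
      \<forall>x. ((\<lambda>t. Q (shift c t x)) has_vector_derivative Q' x) (at 0)"
    if Q: "Q \<in> (\<lambda>P x. cnj (P x)) ` {P. smooth P}" for Q c
  proof -
    obtain P where "smooth P" "Q = (\<lambda>x. cnj (P x))"
      using Q by (elim imageE CollectE) simp
    then show ?thesis
      by (intro bexI[of _ "\<lambda>x. cnj (pd c P x)"])
         (auto intro: has_vector_derivative_cnj smooth_pd_deriv0 smooth_pd)
  qed
  show "\<exists>n. depends_below n Q" if Q: "Q \<in> (\<lambda>P x. cnj (P x)) ` {P. smooth P}" for Q
  proof -
    obtain P where P: "smooth P" "Q = (\<lambda>x. cnj (P x))"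
      using Q by (elim imageE CollectE) simp
    then obtain n where "depends_below n P" unfolding smooth_def by blast
    then show ?thesis using depends_below_compose2[where h = "\<lambda>a b. cnj a"] P(2) by blast
  qed
  show "continuous_on UNIV Q" if "Q \<in> (\<lambda>P x. cnj (P x)) ` {P. smooth P}" for Q
    using that by (auto intro: continuous_on_cnj smooth_continuous)
qed (use assms in simp)

lemma smooth_sum: "finite A \<Longrightarrow> (\<And>i. i \<in> A \<Longrightarrow> smooth (P i)) \<Longrightarrow> smooth (\<lambda>x. \<Sum>i\<in>A. P i x)"
proof (induction A rule: finite_induct)
  case empty then show ?case by (simp add: smooth_const)
next
  case (insert i A)
  then have "smooth (\<lambda>x. P i x + (\<Sum>i\<in>A. P i x))" by (intro smooth_add) simp_all
  then show ?case using insert.hyps by simp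
qed

lemma smooth_minus: "smooth P \<Longrightarrow> smooth (\<lambda>x. - P x)"
  using smooth_mult[OF smooth_const[of "-1"]] by simp

lemma smooth_diff: "smooth P \<Longrightarrow> smooth Q \<Longrightarrow> smooth (\<lambda>x. P x - Q x)"
  using smooth_add[OF _ smooth_minus] by simp

lemma pd_add: "smooth P \<Longrightarrow> smooth Q \<Longrightarrow> pd c (\<lambda>x. P x + Q x) x = pd c P x + pd c Q x"
  by (intro pd_eqI has_vector_derivative_add smooth_pd_deriv0)

lemma pd_mult:
  assumes "smooth P" "smooth Q"
  shows "pd c (\<lambda>x. P x * Q x) x = pd c P x * Q x + P x * pd c Q x"
  using has_vector_derivative_mult[OF smooth_pd_deriv0[OF assms(1), of c x]
      smooth_pd_deriv0[OF assms(2), of c x]]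
  by (intro pd_eqI) (simp add: add.commute)

lemma pd_const [simp]: "pd c (\<lambda>x. a) x = 0"
  by (intro pd_eqI) simp

lemma pd_cnj: "smooth P \<Longrightarrow> pd c (\<lambda>x. cnj (P x)) x = cnj (pd c P x)"
  by (intro pd_eqI has_vector_derivative_cnj smooth_pd_deriv0)

lemma pd_coord: "pd c (\<lambda>x. snd (snd x) i) x = dir_w c i"
  by (rule pd_eqI) (auto simp: shift_eq_translation has_vector_derivative_def
            scaleR_conv_of_real intro!: derivative_eq_intros)

section \<open>Wirtinger derivatives\<close>

datatype wcoord = DU | DZ | DZb | DW nat | DWb nat

fun del :: "wcoord \<Rightarrow> (jet \<Rightarrow> complex) \<Rightarrow> jet \<Rightarrow> complex" where
  "del DU = pd U"
| "del DZ = d_z"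
| "del DZb = d_zbar"
| "del (DW i) = d_u i"
| "del (DWb i) = d_ubar i"

declare del.simps [simp del]

fun conj_coord :: "wcoord \<Rightarrow> wcoord" where
  "conj_coord DU = DU"
| "conj_coord DZ = DZb"
| "conj_coord DZb = DZ"
| "conj_coord (DW i) = DWb i"
| "conj_coord (DWb i) = DW i"

lemma conj_conj_coord [simp]: "conj_coord (conj_coord c) = c"
  by (cases c) auto

text \<open>A common normal form, through which the rules for all five kinds of derivation are
  proved at once; \<open>DU\<close> fits in as half of twice \<open>pd U\<close>.\<close>

lemma del_eq_pd: "\<exists>c1 c2 a. \<forall>P x. del c P x = (pd c1 P x + a * pd c2 P x) / 2"
proof (cases c)
  case DU then show ?thesis by (intro exI[of _ U] exI[of _ 1]) (simp add: del.simps)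
next
  case DZ then show ?thesis
    by (intro exI[of _ Re_z] exI[of _ Im_z] exI[of _ "-\<i>"]) (simp add: del.simps d_z_def)
next
  case DZb then show ?thesis
    by (intro exI[of _ Re_z] exI[of _ Im_z] exI[of _ "\<i>"]) (simp add: del.simps d_zbar_def)
next
  case (DW i) then show ?thesis
    by (intro exI[of _ "Re_u i"] exI[of _ "Im_u i"] exI[of _ "-\<i>"]) (simp add: del.simps d_u_def)
next
  case (DWb i) then show ?thesis
    by (intro exI[of _ "Re_u i"] exI[of _ "Im_u i"] exI[of _ "\<i>"]) (simp add: del.simps d_ubar_def)
qed

lemma smooth_del:
  assumes "smooth P" shows "smooth (del c P)"
proof -
  obtain c1 c2 a where "\<And>P x. del c P x = (pd c1 P x + a * pd c2 P x) / 2" using del_eq_pd by metis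
  then have "del c P = (\<lambda>x. (pd c1 P x + a * pd c2 P x) * (1/2))" by auto
  moreover have "smooth (\<lambda>x. (pd c1 P x + a * pd c2 P x) * (1/2))"
    by (intro smooth_mult smooth_add smooth_const smooth_pd assms)
  ultimately show ?thesis by simp
qed

lemma del_add: 
  assumes "smooth P" "smooth Q" 
  shows "del c (\<lambda>x. P x + Q x) x = del c P x + del c Q x"
proof -
  obtain c1 c2 a where "\<And>P x. del c P x = (pd c1 P x + a * pd c2 P x) / 2" using del_eq_pd by metis
  then show ?thesis by (simp add: pd_add assms algebra_simps add_divide_distrib)
qed

lemma del_mult: 
  assumes "smooth P" "smooth Q" 
  shows "del c (\<lambda>x. P x * Q x) x = del c P x * Q x + P x * del c Q x"
proof -
  obtain c1 c2 a where "\<And>P x. del c P x = (pd c1 P x + a * pd c2 P x) / 2" using del_eq_pd by metis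
  then show ?thesis by (simp add: pd_mult assms algebra_simps add_divide_distrib)
qed

lemma del_const [simp]: "del c (\<lambda>x. a) x = 0"
proof -
  obtain c1 c2 b where c: "\<And>P x. del c P x = (pd c1 P x + b * pd c2 P x) / 2"
    using del_eq_pd by metis
  show ?thesis unfolding c by simp
qed

lemma del_cmult: "smooth P \<Longrightarrow> del c (\<lambda>x. a * P x) x = a * del c P x"
  by (simp add: del_mult smooth_const)

lemma del_minus: "smooth P \<Longrightarrow> del c (\<lambda>x. - P x) x = - del c P x"
  using del_cmult[of P c "-1"] by simp

lemma del_diff: "smooth P \<Longrightarrow> smooth Q \<Longrightarrow> del c (\<lambda>x. P x - Q x) x = del c P x - del c Q x"
  using del_add[OF _ smooth_minus, of P Q c x] by (simp add: del_minus)

lemma del_sum: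
  assumes "finite A" "\<And>i. i \<in> A \<Longrightarrow> smooth (P i)"
  shows "del c (\<lambda>x. \<Sum>i\<in>A. P i x) x = (\<Sum>i\<in>A. del c (P i) x)"
  using assms
proof (induction A rule: finite_induct)
  case (insert i A)
  then have "del c (\<lambda>x. P i x + (\<Sum>i\<in>A. P i x)) x = del c (P i) x + (\<Sum>i\<in>A. del c (P i) x)"
    by (subst del_add) (auto intro: smooth_sum)
  then show ?case using insert.hyps by simp
qed simp

lemma del_commute:
  assumes P: "smooth P"
  shows "del c (del c' P) x = del c' (del c P) x"
proof -
  obtain c1 c2 a where c: "\<And>P x. del c P x = (pd c1 P x + a * pd c2 P x) / 2"
    using del_eq_pd by metis
  obtain c1' c2' a' where c': "\<And>P x. del c' P x = (pd c1' P x + a' * pd c2' P x) / 2"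
    using del_eq_pd by metis
  have half: "(\<lambda>x. (pd e1 P x + b * pd e2 P x) / 2) = (\<lambda>x. (1/2) * (pd e1 P x + b * pd e2 P x))" for e1 e2 b
    by auto
  have *: "pd e (\<lambda>x. (pd e1 P x + b * pd e2 P x) / 2) x = (pd e (pd e1 P) x + b * pd e (pd e2 P) x) / 2" for e e1 e2 b
    unfolding half
    by (subst pd_mult) (simp_all add: pd_mult pd_add P smooth_pd smooth_add smooth_mult smooth_const)
  have eq: "del c P = (\<lambda>x. (pd c1 P x + a * pd c2 P x) / 2)" "del c' P = (\<lambda>x. (pd c1' P x + a' * pd c2' P x) / 2)"
    using c c' by auto
  show ?thesis
    unfolding c[of "del c' P"] c'[of "del c P"] unfolding eq *
    by (simp add: pd_commute[OF P, of c1'] pd_commute[OF P, of c2'] field_simps)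
qed

lemma del_cnj: "smooth P \<Longrightarrow> del c (\<lambda>x. cnj (P x)) x = cnj (del (conj_coord c) P x)"
  by (cases c) (auto simp: del.simps pd_cnj d_z_def d_zbar_def d_u_def d_ubar_def)

lemma del_coord:
  "del (DW j) (\<lambda>x. snd (snd x) i) x = (if j = i then 1 else 0)"
  "del (DWb j) (\<lambda>x. snd (snd x) i) x = 0"
  "del DU (\<lambda>x. snd (snd x) i) x = 0"
  "del DZ (\<lambda>x. snd (snd x) i) x = 0"
  "del DZb (\<lambda>x. snd (snd x) i) x = 0"
  by (auto simp: del.simps pd_coord d_z_def d_zbar_def d_u_def d_ubar_def)

lemma depends_below_del:
  assumes P: "depends_below n P" shows "depends_below n (del c P)"
proof -
  obtain c1 c2 a where c: "\<And>P x. del c P x = (pd c1 P x + a * pd c2 P x) / 2"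
    using del_eq_pd by metis
  show ?thesis
    using depends_below_pd[OF P, of c1] depends_below_pd[OF P, of c2]
    unfolding depends_below_def c by (intro allI impI arg_cong2[where f = "\<lambda>p q. (p + a * q) / 2"]) auto
qed

lemma del_eq_0_of_depends_below:
  assumes P: "depends_below n P" and i: "n \<le> i"
  shows "del (DW i) P x = 0" "del (DWb i) P x = 0"
proof -
  have "P (shift c t (u, z, w)) = P (u, z, w)" if "c = Re_u i \<or> c = Im_u i" for c t u z w
    using that i P unfolding depends_below_def by (elim disjE) simp_all
  then have "pd c P x = 0" if "c = Re_u i \<or> c = Im_u i" for c
    using that by (cases x, intro pd_eqI) (simp only: has_vector_derivative_const)
  then show "del (DW i) P x = 0" "del (DWb i) P x = 0"
    by (auto simp: del.simps d_u_def d_ubar_def)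
qed

text \<open>Partial derivatives along both axes, one of them continuous, give a total derivative. It
  is only real-linear, since no Cauchy-Riemann equation is assumed.\<close>

lemma has_derivative_complex_partials:
  fixes h :: "complex \<Rightarrow> complex"
  assumes x: "\<And>\<zeta>. ((\<lambda>t. h (\<zeta> + of_real t)) has_vector_derivative hx \<zeta>) (at 0)"
    and y: "\<And>\<zeta>. ((\<lambda>t. h (\<zeta> + \<i> * of_real t)) has_vector_derivative hy \<zeta>) (at 0)"
    and cont: "continuous_on UNIV hy"
  shows "(h has_derivative (\<lambda>v. of_real (Re v) * hx \<zeta> + of_real (Im v) * hy \<zeta>)) (at \<zeta>)"
proof -
  have trans: "((\<lambda>r. g (r - t)) has_vector_derivative D) (at t)"
    if "(g has_vector_derivative D) (at 0)" for g :: "real \<Rightarrow> complex" and D t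
  proof -
    have "((\<lambda>r::real. r - t) has_vector_derivative 1) (at t)"
      by (auto intro!: derivative_eq_intros simp: has_vector_derivative_def)
    from vector_diff_chain_at[OF this, of g D] that show ?thesis by (simp add: o_def)
  qed
  have X: "((\<lambda>a. h (Complex a b)) has_vector_derivative hx (Complex a b)) (at a)" for a b
  proof -
    have "h (Complex r b) = h (Complex a b + of_real (r - a))" for r
      by (rule arg_cong[where f = h]) (simp add: complex_eq_iff)
    then show ?thesis using trans[OF x[of "Complex a b"], of a] by simp
  qed
  have Y: "((\<lambda>b. h (Complex a b)) has_vector_derivative hy (Complex a b)) (at b)" for a b
  proof -
    have "h (Complex a r) = h (Complex a b + \<i> * of_real (r - b))" for r
      by (rule arg_cong[where f = h]) (simp add: complex_eq_iff)
    then show ?thesis using trans[OF y[of "Complex a b"], of b] by simp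
  qed
  have c: "continuous_on UNIV (\<lambda>(a, b). hy (Complex a b))"
  proof -
    have "continuous_on UNIV (\<lambda>p. hy (complex_of_real (fst p) + \<i> * complex_of_real (snd p)))"
      by (rule continuous_on_compose2[OF cont]) (auto intro!: continuous_intros)
    then show ?thesis by (simp add: Complex_eq case_prod_beta)
  qed
  have "((\<lambda>(a, b). h (Complex a b)) has_derivative
      (\<lambda>(s, t). s *\<^sub>R hx \<zeta> + blinfun_apply (blinfun_scaleR_left (hy (Complex (Re \<zeta>) (Im \<zeta>)))) t)) (at (Re \<zeta>, Im \<zeta>) within UNIV \<times> UNIV)"
  proof (rule has_derivative_partialsI[where fy = "\<lambda>a b. blinfun_scaleR_left (hy (Complex a b))"])
    show "((\<lambda>a. h (Complex a (Im \<zeta>))) has_derivative (\<lambda>s. s *\<^sub>R hx \<zeta>)) (at (Re \<zeta>) within UNIV)"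
      using X[of "Im \<zeta>" "Re \<zeta>"] by (simp add: has_vector_derivative_def)
    show "((\<lambda>b. h (Complex a b)) has_derivative blinfun_apply (blinfun_scaleR_left (hy (Complex a b)))) (at b within UNIV)" for a b
      using Y[of a b] by (simp add: has_vector_derivative_def)
    show "continuous (at (Re \<zeta>, Im \<zeta>) within UNIV \<times> UNIV) (\<lambda>(a, b). blinfun_scaleR_left (hy (Complex a b)))"
    proof -
      have "isCont (\<lambda>p. hy (Complex (fst p) (snd p))) (Re \<zeta>, Im \<zeta>)"
        using c by (simp add: case_prod_beta continuous_on_eq_continuous_within)
      from bounded_linear.continuous[OF bounded_linear_blinfun_scaleR_left this]
      show ?thesis by (simp add: case_prod_beta')
    qed
  qed auto
  then have "((\<lambda>(a, b). h (Complex a b)) has_derivative (\<lambda>(s, t). s *\<^sub>R hx \<zeta> + t *\<^sub>R hy \<zeta>)) (at (Re \<zeta>, Im \<zeta>))"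
    by simp
  moreover have "((\<lambda>\<zeta>. (Re \<zeta>, Im \<zeta>)) has_derivative (\<lambda>v. (Re v, Im v))) (at \<zeta>)"
    by (auto intro!: derivative_eq_intros)
  ultimately have "((\<lambda>(a, b). h (Complex a b)) \<circ> (\<lambda>\<zeta>. (Re \<zeta>, Im \<zeta>)) has_derivative
      (\<lambda>(s, t). s *\<^sub>R hx \<zeta> + t *\<^sub>R hy \<zeta>) \<circ> (\<lambda>v. (Re v, Im v))) (at \<zeta>)"
    by (rule diff_chain_at[rotated])
  then show ?thesis by (simp add: o_def scaleR_conv_of_real)
qed

lemma wirtinger_eq: "of_real (Re v) * a + of_real (Im v) * b =
    (a - \<i> * b) / 2 * v + (a + \<i> * b) / 2 * cnj v"
  by (simp add: complex_eq_iff field_simps)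

lemma has_derivative_slice_z:
  assumes P: "smooth P"
  shows "((\<lambda>\<zeta>. P (u, \<zeta>, w)) has_derivative
     (\<lambda>v. del DZ P (u, z, w) * v + del DZb P (u, z, w) * cnj v)) (at z)"
proof -
  have cont: "continuous_on UNIV (\<lambda>\<zeta>. pd Im_z P (u, \<zeta>, w))"
    by (rule continuous_on_compose2[OF smooth_continuous[OF smooth_pd[OF P], of UNIV]])
       (auto intro!: continuous_intros)
  show ?thesis
    using has_derivative_complex_partials[where h = "\<lambda>\<zeta>. P (u, \<zeta>, w)", 
        OF smooth_pd_deriv0[OF P, of Re_z "(u, _, w)", simplified]
           smooth_pd_deriv0[OF P, of Im_z "(u, _, w)", simplified] cont, of z]
    by (simp only: wirtinger_eq del.simps d_z_def d_zbar_def)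
qed

lemma has_derivative_slice_w:
  assumes P: "smooth P"
  shows "((\<lambda>\<zeta>. P (u, z, w(i := \<zeta>))) has_derivative
     (\<lambda>v. del (DW i) P (u, z, w(i := \<zeta>)) * v + del (DWb i) P (u, z, w(i := \<zeta>)) * cnj v)) (at \<zeta>)"
proof -
  have "continuous_on UNIV (\<lambda>\<zeta>. w(i := \<zeta>))"
  proof (rule continuous_on_coordinatewise_then_product)
    show "continuous_on UNIV (\<lambda>\<zeta>. (w(i := \<zeta>)) j)" for j
      by (cases "j = i") (auto intro: continuous_intros)
  qed
  then have cont: "continuous_on UNIV (\<lambda>\<zeta>. pd (Im_u i) P (u, z, w(i := \<zeta>)))"
    by (intro continuous_on_compose2[OF smooth_continuous[OF smooth_pd[OF P], of UNIV]]
         continuous_on_Pair continuous_on_const) auto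
  show ?thesis
    using has_derivative_complex_partials[where h = "\<lambda>\<zeta>. P (u, z, w(i := \<zeta>))", 
        OF smooth_pd_deriv0[OF P, of "Re_u i" "(u, z, w(i := _))", simplified]
           smooth_pd_deriv0[OF P, of "Im_u i" "(u, z, w(i := _))", simplified] cont, of \<zeta>]
    by (simp only: wirtinger_eq del.simps d_u_def d_ubar_def)
qed

lemma const_of_has_derivative_0:
  fixes h :: "complex \<Rightarrow> complex"
  assumes "\<And>\<zeta>. (h has_derivative (\<lambda>v. 0)) (at \<zeta>)"
  shows "h a = h b"
  using has_derivative_zero_unique[of UNIV h a b] assms by (metis UNIV_I convex_UNIV)

lemma indep_z:
  assumes "smooth P" "\<And>x. del DZ P x = 0" "\<And>x. del DZb P x = 0"
  shows "P (u, z, w) = P (u, z', w)"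
  using const_of_has_derivative_0[of "\<lambda>\<zeta>. P (u, \<zeta>, w)" z z']
    has_derivative_slice_z[OF assms(1)] assms(2,3) by simp

lemma indep_w:
  assumes "smooth P" "\<And>x. del (DW i) P x = 0" "\<And>x. del (DWb i) P x = 0"
  shows "P (u, z, w) = P (u, z, w(i := a))"
proof -
  have "((\<lambda>\<zeta>. P (u, z, w(i := \<zeta>))) has_derivative (\<lambda>v. 0)) (at \<zeta>)" for \<zeta>
    using has_derivative_slice_w[OF assms(1), of u z w i \<zeta>] assms(2,3) by simp
  from const_of_has_derivative_0[OF this, of "w i" a] show ?thesis by simp
qed

lemma indep_u:
  assumes "smooth P" "\<And>x. del DU P x = 0"
  shows "P (u, z, w) = P (u', z, w)"
proof -
  have "((\<lambda>t. P (shift U t (0, z, w))) has_vector_derivative 0) (at t within UNIV)" for t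
    using smooth_pd_deriv[OF assms(1), of U "(0, z, w)" t] assms(2) by (simp add: del.simps)
  then have "((\<lambda>t. P (t, z, w)) has_derivative (\<lambda>v. 0)) (at t within UNIV)" for t
    by (simp add: has_vector_derivative_def)
  then show ?thesis
    using has_derivative_zero_unique[of UNIV "\<lambda>t. P (t, z, w)" u u'] by (metis UNIV_I convex_UNIV)
qed

lemma indep_all_w:
  assumes P: "smooth P" and 0: "\<And>i x. del (DW i) P x = 0" "\<And>i x. del (DWb i) P x = 0"
  shows "P (u, z, w) = P (u, z, w')"
proof -
  obtain n where n: "depends_below n P" using P unfolding smooth_def by blast
  have "P (u, z, w) = P (u, z, \<lambda>i. if i < k then w' i else w i)" for k
  proof (induction k)
    case (Suc k)
    have eq: "(\<lambda>i. if i < Suc k then w' i else w i) = (\<lambda>i. if i < k then w' i else w i)(k := w' k)"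
      by auto
    show ?case unfolding eq using Suc indep_w[OF P 0] by metis
  qed simp
  also have "P (u, z, \<lambda>i. if i < n then w' i else w i) = P (u, z, w')"
    using n unfolding depends_below_def by simp
  finally show ?thesis .
qed

section \<open>The functions \<open>T\<^sup>i\<close> and weighted polynomials\<close>

text \<open>
  With \<open>\<phi> l\<close> the \<open>l\<close>-th derivative of \<open>f\<close>, the function \<open>TT \<phi> i l\<close> is the \<open>l\<close>-th \<open>u\<close>-derivative of
  \<open>T\<^sup>i\<close>. The derivative of \<open>f\<close> is taken at the moving point \<open>u\<close> (\<open>Tu\<close> below), or at a point frozen
  independently of the jet (\<open>Tc\<close> below); in the second case \<open>TT\<close> is a polynomial in the fibre
  coordinates.
\<close>

fun TT :: "(nat \<Rightarrow> jet \<Rightarrow> complex) \<Rightarrow> nat \<Rightarrow> nat \<Rightarrow> jet \<Rightarrow> complex" where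
  "TT \<phi> 0 l = \<phi> l"
| "TT \<phi> (Suc i) l = (\<lambda>x. \<Sum>j\<le>i. of_nat (i choose j) * snd (snd x) (i - j) * TT \<phi> j (Suc l) x)"

lemma smooth_TT:
  assumes "\<And>l. smooth (\<phi> l)"
  shows "smooth (TT \<phi> j l)"
proof (induction j arbitrary: l rule: less_induct)
  case (less j)
  show ?case
    by (cases j)
       (auto simp: assms less intro!: smooth_sum smooth_mult smooth_const smooth_coord)
qed

lemma del_TT_Suc:
  assumes "\<And>l. smooth (\<phi> l)"
  shows "del c (TT \<phi> (Suc i) l) x = (\<Sum>j\<le>i. of_nat (i choose j) *
     (del c (\<lambda>x. snd (snd x) (i - j)) x * TT \<phi> j (Suc l) x + snd (snd x) (i - j) * del c (TT \<phi> j (Suc l)) x))"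
proof -
  have "del c (\<lambda>x. of_nat (i choose j) * snd (snd x) (i - j) * TT \<phi> j (Suc l) x) x =
      of_nat (i choose j) * (del c (\<lambda>x. snd (snd x) (i - j)) x * TT \<phi> j (Suc l) x + snd (snd x) (i - j) * del c (TT \<phi> j (Suc l)) x)" for j
    unfolding mult.assoc
    by (simp add: del_mult smooth_mult smooth_const smooth_coord smooth_TT assms)
  then show ?thesis
    by (simp add: del_sum smooth_mult smooth_const smooth_coord smooth_TT assms)
qed

lemma TT_cong:
  assumes "\<And>l. \<phi> l x = \<psi> l y" "snd (snd x) = snd (snd y)"
  shows "TT \<phi> j l x = TT \<psi> j l y"
proof (induction j arbitrary: l rule: less_induct)
  case (less j)
  then show ?case using assms by (cases j) auto
qed

lemma TT_Suc_at_0: "snd (snd x) = (\<lambda>_. 0) \<Longrightarrow> TT \<phi> (Suc i) l x = 0"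
  by simp

text \<open>Together with \<open>del_TT_DW\<close> this reads T^{i+1} = e_{-1} T^i: the factor of
  u_{j+1} is the u_j-derivative of T^i, and the factor of u_0 is its u-derivative.\<close>

lemma TT_Suc_rev:
  "TT \<phi> (Suc i) l x = snd (snd x) 0 * TT \<phi> i (Suc l) x +
     (\<Sum>j<i. of_nat (i choose Suc j) * snd (snd x) (Suc j) * TT \<phi> (i - Suc j) (Suc l) x)"
proof -
  have "TT \<phi> (Suc i) l x =
      (\<Sum>j<Suc i. of_nat (i choose (Suc i - Suc j)) * snd (snd x) (i - (Suc i - Suc j)) * TT \<phi> (Suc i - Suc j) (Suc l) x)"
    unfolding TT.simps lessThan_Suc_atMost[symmetric]
    by (rule sum.nat_diff_reindex[symmetric])
  also have "\<dots> = (\<Sum>j<Suc i. of_nat (i choose j) * snd (snd x) j * TT \<phi> (i - j) (Suc l) x)"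
    by (rule sum.cong) (auto simp: binomial_symmetric[symmetric])
  finally show ?thesis by (simp only: sum.lessThan_Suc_shift) simp
qed

text \<open>For j = k + 1, the explicit coordinates in the recursion contribute (k choose i) and the
  inner functions contribute (k choose i+1), after the product of two binomials is rearranged by
  \<open>choose_mult\<close>; Pascal's rule adds them up.\<close>

lemma del_TT_DW:
  assumes sm: "\<And>l. smooth (\<phi> l)" and 0: "\<And>l i x. del (DW i) (\<phi> l) x = 0"
  shows "del (DW i) (TT \<phi> j l) x =
     (if i < j then of_nat (j choose Suc i) * TT \<phi> (j - Suc i) (Suc l) x else 0)"
proof (induction j arbitrary: l rule: less_induct)
  case (less j)
  show ?case
  proof (cases j)
    case 0 then show ?thesis using assms by simp
  next
    case (Suc k)
    have "del (DW i) (TT \<phi> j l) x =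
        (\<Sum>j\<le>k. of_nat (k choose j) * (if i = k - j then TT \<phi> j (Suc l) x else 0)) +
        (\<Sum>j\<le>k. of_nat (k choose j) * (snd (snd x) (k - j) *
            (if i < j then of_nat (j choose Suc i) * TT \<phi> (j - Suc i) (Suc (Suc l)) x else 0)))"
      unfolding Suc del_TT_Suc[OF sm] del_coord sum.distrib[symmetric]
      by (rule sum.cong) (auto simp: less Suc algebra_simps)
    also have "(\<Sum>j\<le>k. of_nat (k choose j) * (if i = k - j then TT \<phi> j (Suc l) x else 0)) =
        (\<Sum>j\<in>{..k}. if j = k - i \<and> i \<le> k then of_nat (k choose i) * TT \<phi> (k - i) (Suc l) x else 0)"
      by (rule sum.cong) (auto simp: binomial_symmetric[symmetric])
    also have "\<dots> = (if i \<le> k then of_nat (k choose i) * TT \<phi> (k - i) (Suc l) x else 0)"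
      by (cases "i \<le> k") simp_all
    also have "(\<Sum>j\<le>k. of_nat (k choose j) * (snd (snd x) (k - j) *
            (if i < j then of_nat (j choose Suc i) * TT \<phi> (j - Suc i) (Suc (Suc l)) x else 0))) =
        (if i < k then of_nat (k choose Suc i) * TT \<phi> (k - i) (Suc l) x else 0)"
    proof (cases "i < k")
      case False
      then show ?thesis by (auto intro!: sum.neutral)
    next
      case True
      define m where "m = k - Suc i"
      have k: "k = m + Suc i" using True by (simp add: m_def)
      have "(\<Sum>j\<le>k. of_nat (k choose j) * (snd (snd x) (k - j) *
            (if i < j then of_nat (j choose Suc i) * TT \<phi> (j - Suc i) (Suc (Suc l)) x else 0))) =
          (\<Sum>j\<in>{Suc i..k}. of_nat (k choose j) * (snd (snd x) (k - j) *
            (of_nat (j choose Suc i) * TT \<phi> (j - Suc i) (Suc (Suc l)) x)))"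
        by (rule sum.mono_neutral_cong_right) auto
      also have "{Suc i..k} = (\<lambda>j. j + Suc i) ` {..m}"
      proof (intro equalityI subsetI)
        show "j \<in> (\<lambda>j. j + Suc i) ` {..m}" if "j \<in> {Suc i..k}" for j
          using that by (intro image_eqI[of _ _ "j - Suc i"]) (auto simp: k)
      qed (auto simp: k)
      also have "(\<Sum>j\<in>(\<lambda>j. j + Suc i) ` {..m}. of_nat (k choose j) * (snd (snd x) (k - j) *
            (of_nat (j choose Suc i) * TT \<phi> (j - Suc i) (Suc (Suc l)) x))) =
          (\<Sum>j\<le>m. of_nat (k choose (j + Suc i)) * (snd (snd x) (m - j) *
            (of_nat ((j + Suc i) choose Suc i) * TT \<phi> j (Suc (Suc l)) x)))"
        by (subst sum.reindex) (auto simp: k inj_on_def)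
      also have "\<dots> = (\<Sum>j\<le>m. of_nat (k choose Suc i) * (of_nat (m choose j) * snd (snd x) (m - j) * TT \<phi> j (Suc (Suc l)) x))"
      proof (rule sum.cong)
        fix j assume "j \<in> {..m}"
        then have "(k choose (j + Suc i)) * ((j + Suc i) choose Suc i) = (k choose Suc i) * (m choose j)"
          using choose_mult[of "Suc i" "j + Suc i" k] by (simp add: k)
        then have "(of_nat (k choose (j + Suc i)) * of_nat ((j + Suc i) choose Suc i) :: complex) =
            of_nat (k choose Suc i) * of_nat (m choose j)"
          by (metis of_nat_mult)
        then show "of_nat (k choose (j + Suc i)) * (snd (snd x) (m - j) *
            (of_nat ((j + Suc i) choose Suc i) * TT \<phi> j (Suc (Suc l)) x)) =
            of_nat (k choose Suc i) * (of_nat (m choose j) * snd (snd x) (m - j) * TT \<phi> j (Suc (Suc l)) x)"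
          by (simp add: ac_simps)
      qed simp
      also have "\<dots> = of_nat (k choose Suc i) * TT \<phi> (Suc m) (Suc l) x"
        by (simp add: sum_distrib_left)
      finally show ?thesis using True by (simp add: m_def Suc_diff_Suc)
    qed
    also have "(if i \<le> k then of_nat (k choose i) * TT \<phi> (k - i) (Suc l) x else 0) +
        (if i < k then of_nat (k choose Suc i) * TT \<phi> (k - i) (Suc l) x else 0) =
       (if i < j then of_nat (j choose Suc i) * TT \<phi> (j - Suc i) (Suc l) x else 0)"
      unfolding Suc by (auto simp: algebra_simps)
    finally show ?thesis .
  qed
qed

lemma del_TT_eq_0:
  assumes sm: "\<And>l. smooth (\<phi> l)" and 0: "\<And>l x. del c (\<phi> l) x = 0" and c: "\<And>i. c \<noteq> DW i"
  shows "del c (TT \<phi> j l) x = 0"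
proof (induction j arbitrary: l rule: less_induct)
  case (less j)
  have "del c (\<lambda>x. snd (snd x) i) x = 0" for i
    using c by (cases c) (auto simp: del_coord)
  then show ?case
    using less by (cases j) (auto simp: 0 del_TT_Suc[OF sm] simp del: TT.simps(2))
qed

lemma del_TT_DU:
  assumes sm: "\<And>l. smooth (\<phi> l)" and 0: "\<And>l x. del DU (\<phi> l) x = \<phi> (Suc l) x"
  shows "del DU (TT \<phi> j l) x = TT \<phi> j (Suc l) x"
proof (induction j arbitrary: l rule: less_induct)
  case (less j)
  show ?case
  proof (cases j)
    case (Suc k)
    have "del DU (TT \<phi> (Suc k) l) x = TT \<phi> (Suc k) (Suc l) x"
      unfolding del_TT_Suc[OF sm] unfolding TT.simps(2)
      using less by (intro sum.cong) (auto simp: Suc del_coord)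
    then show ?thesis by (simp only: Suc)
  qed (simp add: 0)
qed

definition phi_u :: "(real \<Rightarrow> real) \<Rightarrow> nat \<Rightarrow> jet \<Rightarrow> complex" where
  "phi_u f l x = of_real ((deriv ^^ l) f (fst x))"

definition phi_c :: "(real \<Rightarrow> real) \<Rightarrow> real \<Rightarrow> nat \<Rightarrow> jet \<Rightarrow> complex" where
  "phi_c f u l x = of_real ((deriv ^^ l) f u)"

abbreviation "Tu f \<equiv> TT (phi_u f)"
abbreviation "Tc f u \<equiv> TT (phi_c f u)"

lemma phi_u_deriv:
  assumes "smooth_real f"
  shows "((\<lambda>t. phi_u f l (shift c t x)) has_vector_derivative of_real (dir_u c) * phi_u f (Suc l) x) (at 0)"
proof -
  have 1: "((deriv ^^ l) f has_real_derivative (deriv ^^ Suc l) f y) (at y)" for y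
    using assms unfolding smooth_real_def by (simp add: DERIV_deriv_iff_real_differentiable)
  have "((\<lambda>t. (deriv ^^ l) f (fst x + t * dir_u c)) has_real_derivative
      (deriv ^^ Suc l) f (fst x) * dir_u c) (at 0)"
    by (rule DERIV_chain2[where f = "(deriv ^^ l) f"]) (use 1 in \<open>auto intro!: derivative_eq_intros\<close>)
  then have "((\<lambda>t. complex_of_real ((deriv ^^ l) f (fst x + t * dir_u c))) has_vector_derivative
      of_real ((deriv ^^ Suc l) f (fst x) * dir_u c)) (at 0)"
    by (rule has_vector_derivative_of_real)
  then show ?thesis by (simp add: phi_u_def shift_eq_translation mult.commute)
qed

lemma smooth_phi_u:
  assumes "smooth_real f"
  shows "smooth (phi_u f l)"
\<comment> \<open>The real scalars make the set stable: differentiating along c multiplies by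
  \<open>dir_u c\<close>, which is 0 unless c is \<open>U\<close>.\<close>
proof (rule smooth_coinduct[where S = "(\<lambda>(a, l) x. of_real a * phi_u f l x) ` UNIV"])
  show "phi_u f l \<in> (\<lambda>(a, l) x. of_real a * phi_u f l x) ` UNIV"
    by (rule image_eqI[of _ _ "(1, l)"]) auto
  fix Q assume "Q \<in> (\<lambda>(a, l) x. of_real a * phi_u f l x) ` UNIV"
  then obtain a l where Q: "Q = (\<lambda>x. of_real a * phi_u f l x)" by auto
  have "\<forall>x. ((\<lambda>t. Q (shift c t x)) has_vector_derivative
      of_real (a * dir_u c) * phi_u f (Suc l) x) (at 0)" for c
    using has_vector_derivative_mult_right[OF phi_u_deriv[OF assms]] unfolding Q by (simp add: mult.assoc)
  then show "\<exists>Q'\<in>(\<lambda>(a, l) x. of_real a * phi_u f l x) ` UNIV.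
      \<forall>x. ((\<lambda>t. Q (shift c t x)) has_vector_derivative Q' x) (at 0)" for c
    by (intro bexI[of _ "\<lambda>x. of_real (a * dir_u c) * phi_u f (Suc l) x"] image_eqI[of _ _ "(a * dir_u c, Suc l)"]) auto
  have "continuous_on UNIV ((deriv ^^ l) f)"
    using assms unfolding smooth_real_def
    by (intro continuous_at_imp_continuous_on ballI differentiable_imp_continuous_within) auto
  then show "continuous_on UNIV Q"
    unfolding Q phi_u_def
    by (auto intro!: continuous_intros continuous_on_compose2[of UNIV "(deriv ^^ l) f"])
  have "depends_below 0 Q" unfolding Q by (simp add: depends_below_def phi_u_def)
  then show "\<exists>n. depends_below n Q" ..
qed

lemma del_phi_u:
  assumes "smooth_real f"
  shows "del DU (phi_u f l) x = phi_u f (Suc l) x"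
    and "c \<noteq> DU \<Longrightarrow> del c (phi_u f l) x = 0"
proof -
  have *: "pd c (phi_u f l) x = of_real (dir_u c) * phi_u f (Suc l) x" for c
    by (rule pd_eqI[OF phi_u_deriv[OF assms]])
  show "del DU (phi_u f l) x = phi_u f (Suc l) x" by (simp add: del.simps *)
  show "c \<noteq> DU \<Longrightarrow> del c (phi_u f l) x = 0"
    by (cases c) (auto simp: del.simps d_z_def d_zbar_def d_u_def d_ubar_def *)
qed

lemma smooth_phi_c: "smooth (phi_c f u l)"
  using smooth_const by (simp add: phi_c_def[abs_def])

lemma del_phi_c: "del c (phi_c f u l) x = 0"
  by (simp add: phi_c_def[abs_def])

lemma smooth_Tu: "smooth_real f \<Longrightarrow> smooth (Tu f j l)"
  by (intro smooth_TT smooth_phi_u)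

lemma smooth_Tc: "smooth (Tc f u j l)"
  by (intro smooth_TT smooth_phi_c)

lemma del_Tu:
  assumes "smooth_real f"
  shows "del DU (Tu f j l) x = Tu f j (Suc l) x"
    and "del (DW i) (Tu f j l) x =
      (if i < j then of_nat (j choose Suc i) * Tu f (j - Suc i) (Suc l) x else 0)"
    and "del DZ (Tu f j l) x = 0" "del DZb (Tu f j l) x = 0" "del (DWb i) (Tu f j l) x = 0"
  by (auto intro!: del_TT_eq_0 del_TT_DU smooth_phi_u assms simp: del_phi_u assms del_TT_DW smooth_phi_u)

lemma del_Tc:
  shows "del DU (Tc f u j l) x = 0"
    and "del (DW i) (Tc f u j l) x =
      (if i < j then of_nat (j choose Suc i) * Tc f u (j - Suc i) (Suc l) x else 0)"
    and "del DZ (Tc f u j l) x = 0" "del DZb (Tc f u j l) x = 0" "del (DWb i) (Tc f u j l) x = 0"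
  by (auto intro!: del_TT_eq_0 simp: del_phi_c smooth_phi_c del_TT_DW)

lemma T_eq_Tu:
  assumes "smooth_real f"
  shows "T f j = Tu f j 0"
proof (induction j rule: less_induct)
  case (less j)
  show ?case
  proof (cases j)
    case 0 then show ?thesis by (auto simp: phi_u_def)
  next
    case (Suc k)
    have "T f j (u, z, w) = Tu f j 0 (u, z, w)" for u z w
      unfolding Suc using less del_Tu(1)[OF assms] by (auto simp: Suc del.simps intro!: sum.cong)
    then show ?thesis by auto
  qed
qed

text \<open>Weighted homogeneous polynomials in which u_j has weight j + 1, matching
  \<open>weighted_degree\<close>. The zero polynomial has every weight
  (\<open>wpoly_zero\<close>).\<close>

inductive wpoly :: "nat \<Rightarrow> ((nat \<Rightarrow> complex) \<Rightarrow> complex) \<Rightarrow> bool" where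
  const: "wpoly 0 (\<lambda>w. a)"
| add: "wpoly n p \<Longrightarrow> wpoly n q \<Longrightarrow> wpoly n (\<lambda>w. p w + q w)"
| coord_mult: "wpoly n p \<Longrightarrow> wpoly (n + Suc j) (\<lambda>w. w j * p w)"

lemma wpoly_zero: "wpoly n (\<lambda>w. 0)"
proof (cases n)
  case (Suc k)
  show ?thesis using wpoly.coord_mult[OF wpoly.const[of 0], of k] by (simp add: Suc)
qed (simp add: wpoly.const)

lemma wpoly_mult: "wpoly m p \<Longrightarrow> wpoly n q \<Longrightarrow> wpoly (m + n) (\<lambda>w. p w * q w)"
proof (induction rule: wpoly.induct)
  case (const a)
  show ?case using const
  proof (induction rule: wpoly.induct)
    case (const b) then show ?case using wpoly.const by simp
  next
    case (add n p q) then show ?case using wpoly.add by (fastforce simp: algebra_simps)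
  next
    case (coord_mult n p j)
    then show ?case using wpoly.coord_mult[of n "\<lambda>w. a * p w" j] by (simp add: mult.left_commute)
  qed
next
  case (add k p q')
  then show ?case using wpoly.add[of "k + n" "\<lambda>w. p w * q w" "\<lambda>w. q' w * q w"] by (simp add: algebra_simps)
next
  case (coord_mult k p j)
  then show ?case using wpoly.coord_mult[of "k + n" "\<lambda>w. p w * q w" j] by (simp add: algebra_simps)
qed

lemma wpoly_cmult: "wpoly n p \<Longrightarrow> wpoly n (\<lambda>w. a * p w)"
  using wpoly_mult[OF wpoly.const] by fastforce

lemma wpoly_sum: "finite A \<Longrightarrow> (\<And>i. i \<in> A \<Longrightarrow> wpoly n (p i)) \<Longrightarrow> wpoly n (\<lambda>w. \<Sum>i\<in>A. p i w)"
proof (induction A rule: finite_induct)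
  case (insert i A)
  then have "wpoly n (\<lambda>w. p i w + (\<Sum>i\<in>A. p i w))" by (intro wpoly.add) auto
  then show ?case using insert.hyps by simp
qed (simp add: wpoly_zero)

lemma wpoly_diff: "wpoly n p \<Longrightarrow> wpoly n q \<Longrightarrow> wpoly n (\<lambda>w. p w - q w)"
  using wpoly.add[OF _ wpoly_cmult[of n q "-1"], of p] by simp

lemma wpoly_smooth: "wpoly n p \<Longrightarrow> smooth (\<lambda>x. p (snd (snd x)))"
  by (induction rule: wpoly.induct) (auto intro: smooth_const smooth_add smooth_mult smooth_coord)

lemma wpoly_del_eq_0:
  assumes "wpoly n p" "\<And>i. c \<noteq> DW i"
  shows "del c (\<lambda>x. p (snd (snd x))) x = 0"
proof -
  have "del c (\<lambda>x. snd (snd x) i) x = 0" for i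
    using assms(2) by (cases c) (auto simp: del_coord)
  with assms(1) show ?thesis
    by (induction rule: wpoly.induct) (simp_all add: del_add del_mult wpoly_smooth smooth_coord)
qed

text \<open>Differentiation by u_j removes weight j + 1, and a polynomial of weight at most j cannot
  contain u_j.\<close>

lemma wpoly_del:
  assumes "wpoly n p"
  shows "\<exists>q. (\<forall>x. del (DW j) (\<lambda>x. p (snd (snd x))) x = q (snd (snd x))) \<and>
     (if j < n then wpoly (n - Suc j) q else q = (\<lambda>_. 0))"
  using assms
proof (induction rule: wpoly.induct)
  case (const a) then show ?case by (intro exI[of _ "\<lambda>_. 0"]) simp
next
  case (add n p p')
  then obtain q q' where *: "\<forall>x. del (DW j) (\<lambda>x. p (snd (snd x))) x = q (snd (snd x))"
     "if j < n then wpoly (n - Suc j) q else q = (\<lambda>_. 0)"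
     "\<forall>x. del (DW j) (\<lambda>x. p' (snd (snd x))) x = q' (snd (snd x))"
     "if j < n then wpoly (n - Suc j) q' else q' = (\<lambda>_. 0)" by blast
  show ?case
    by (rule exI[of _ "\<lambda>w. q w + q' w"])
       (use * add in \<open>auto simp: del_add wpoly_smooth intro: wpoly.add\<close>)
next
  case (coord_mult n p i)
  then obtain q where *: "\<forall>x. del (DW j) (\<lambda>x. p (snd (snd x))) x = q (snd (snd x))"
     "if j < n then wpoly (n - Suc j) q else q = (\<lambda>_. 0)" by blast
  define r where "r w = (if j = i then p w else 0) + w i * q w" for w
  have "del (DW j) (\<lambda>x. snd (snd x) i * p (snd (snd x))) x = r (snd (snd x))" for x
    using coord_mult(1)
    by (simp add: del_mult smooth_coord wpoly_smooth del_coord r_def *(1)[rule_format])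
  moreover have "if j < n + Suc i then wpoly (n + Suc i - Suc j) r else r = (\<lambda>_. 0)"
  proof (cases "j < n + Suc i")
    case True
    have "wpoly (n + Suc i - Suc j) (\<lambda>w. if j = i then p w else 0)"
      using coord_mult(1) wpoly_zero by (cases "j = i") simp_all
    moreover have "wpoly (n + Suc i - Suc j) (\<lambda>w. w i * q w)"
    proof (cases "j < n")
      case True
      then have "n - Suc j + Suc i = n + Suc i - Suc j" by simp
      then show ?thesis using *(2) wpoly.coord_mult[of "n - Suc j" q i] True by simp
    qed (use *(2) wpoly_zero in simp)
    ultimately show ?thesis using True wpoly.add by (simp add: r_def[abs_def])
  next
    case False
    then show ?thesis using *(2) by (auto simp: r_def)
  qed
  ultimately show ?case by blast
qed

lemma wpoly_0D: 
  assumes "wpoly 0 p" shows "\<exists>a. \<forall>w. p w = a"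
proof -
  have "n = 0 \<Longrightarrow> \<exists>a. \<forall>w. p w = a" if "wpoly n p" for n p
    using that by (induction rule: wpoly.induct) fastforce+
  with assms show ?thesis by blast
qed

lemma wpoly_1D:
  assumes "wpoly (Suc 0) p" shows "\<exists>a. \<forall>w. p w = a * w 0"
proof -
  have "\<exists>a. \<forall>w. p w = a * w 0" if "wpoly n p" "n = Suc 0" for n p
    using that
  proof (induction rule: wpoly.induct)
    case (add n p q)
    then obtain a b where "\<forall>w. p w = a * w 0" "\<forall>w. q w = b * w 0" by blast
    then show ?case by (intro exI[of _ "a + b"]) (simp add: algebra_simps)
  next
    case (coord_mult n p j)
    then show ?case using wpoly_0D[of p] by (auto simp: mult.commute)
  qed simp
  with assms show ?thesis by blast
qed

lemma wpoly_Tc: "wpoly j (\<lambda>w. Tc f u j l (0, 0, w))"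
proof (induction j arbitrary: l rule: less_induct)
  case (less j)
  show ?case
  proof (cases j)
    case 0 then show ?thesis by (simp add: phi_c_def wpoly.const)
  next
    case (Suc k)
    have "wpoly (Suc k) (\<lambda>w. of_nat (k choose i) * w (k - i) * Tc f u i (Suc l) (0, 0, w))" if "i \<le> k" for i
      using wpoly.coord_mult[OF less[of i "Suc l"], of "k - i"] that wpoly_cmult by (fastforce simp: Suc mult.assoc)
    then show ?thesis by (auto simp: Suc intro!: wpoly_sum)
  qed
qed

lemma wpoly_subst0:
  assumes "wpoly n p" shows "wpoly n (\<lambda>w. p (w(k := 0)))"
  using assms
proof (induction rule: wpoly.induct)
  case (coord_mult n p j)
  show ?case
  proof (cases "j = k")
    case True then show ?thesis using wpoly_zero by simp
  next
    case False
    then have "(w(k := 0)) j = w j" for w :: "nat \<Rightarrow> complex" by simp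
    then show ?thesis using wpoly.coord_mult[OF coord_mult(2), of j] by (simp only:)
  qed
qed (auto intro: wpoly.intros)

section \<open>The conjugation-symmetric form of the equation\<close>

lemmas smooth_simps [simp] = smooth_add smooth_mult smooth_const smooth_coord smooth_cnj smooth_sum
  smooth_minus smooth_diff smooth_del smooth_Tc smooth_Tu

lemma depends_below_sum:
  assumes "\<And>i. i \<in> A \<Longrightarrow> depends_below n (P i)"
  shows "depends_below n (\<lambda>x. \<Sum>i\<in>A. P i x)"
  using assms unfolding depends_below_def by (intro allI impI sum.cong refl) blast

lemma depends_below_mult: "depends_below n P \<Longrightarrow> depends_below n Q \<Longrightarrow> depends_below n (\<lambda>x. P x * Q x)"
  and depends_below_add: "depends_below n P \<Longrightarrow> depends_below n Q \<Longrightarrow> depends_below n (\<lambda>x. P x + Q x)"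
  and depends_below_diff: "depends_below n P \<Longrightarrow> depends_below n Q \<Longrightarrow> depends_below n (\<lambda>x. P x - Q x)"
  by (auto intro: depends_below_compose2[where m = n and n = n, simplified])

lemma depends_below_cnj: "depends_below n P \<Longrightarrow> depends_below n (\<lambda>x. cnj (P x))"
  using depends_below_compose2[of n P n P "\<lambda>a b. cnj a"] by simp

lemma depends_below_coord: "i < n \<Longrightarrow> depends_below n (\<lambda>x. snd (snd x) i)"
  by (simp add: depends_below_def)

lemma depends_below_Tu: "i \<le> n \<Longrightarrow> depends_below n (Tu f i l)"
proof (induction i arbitrary: l rule: less_induct)
  case (less i)
  show ?case
  proof (cases i)
    case 0 then show ?thesis by (simp add: depends_below_def phi_u_def)
  next
    case (Suc k)
    then show ?thesis using less
      by (auto intro!: depends_below_sum depends_below_mult depends_below_coord simp: depends_below_def[of _ "\<lambda>x. of_nat _"])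
  qed
qed

lemma e_m1_eq:
  assumes f: "smooth_real f" and P: "depends_below N P"
  shows "e_m1 f P x = del DZ P x + snd (snd x) 0 * del DU P x
     + (\<Sum>i<N. snd (snd x) (Suc i) * del (DW i) P x) - (\<Sum>i<N. cnj (Tu f i 0 x) * del (DWb i) P x)"
proof -
  obtain u z w where x: "x = (u, z, w)" by (cases x)
  have 0: "d_u i P x = 0" "d_ubar i P x = 0" if "i \<notin> {..<N}" for i
    using del_eq_0_of_depends_below[OF P, of i x] that by (auto simp: del.simps)
  have "suminf (\<lambda>i. w (Suc i) * d_u i P x) = (\<Sum>i<N. w (Suc i) * d_u i P x)"
    by (rule suminf_finite) (auto simp: 0)
  moreover have "suminf (\<lambda>i. cnj (T f i x) * d_ubar i P x) = (\<Sum>i<N. cnj (T f i x) * d_ubar i P x)"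
    by (rule suminf_finite) (auto simp: 0)
  ultimately show ?thesis
    unfolding x by (simp add: del.simps T_eq_Tu[OF f])
qed

lemma e_m1_bar_eq:
  assumes f: "smooth_real f" and P: "smooth P" "depends_below N P"
  shows "e_m1_bar f P x = del DZb P x + cnj (snd (snd x) 0) * del DU P x
     + (\<Sum>i<N. cnj (snd (snd x) (Suc i)) * del (DWb i) P x) - (\<Sum>i<N. Tu f i 0 x * del (DW i) P x)"
  unfolding e_m1_bar_def e_m1_eq[OF f depends_below_cnj[OF P(2)]]
  by (simp add: del_cnj P(1))

text \<open>
  \<open>GG N P k\<close> is the \<open>u\<^sub>k\<close>-derivative of \<open>e\<^sub>-\<^sub>1 P\<close>, for \<open>P\<close> independent of \<open>u\<close> and without mixed
  derivatives.
\<close>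

definition GG :: "nat \<Rightarrow> (jet \<Rightarrow> complex) \<Rightarrow> nat \<Rightarrow> jet \<Rightarrow> complex" where
  "GG N P k x = del DZ (del (DW k) P) x + (\<Sum>i<N. snd (snd x) (Suc i) * del (DW i) (del (DW k) P) x)
     + (if k = 0 then 0 else del (DW (k - 1)) P x)"

text \<open>The terms of \<open>e_m1_bar f (e_m1 f P)\<close> that involve u_j-derivatives of
  \<open>P\<close>; without mixed derivatives the remaining ones, apart from the zzbar-derivative,
  are the conjugate of the same expression for the conjugate of \<open>P\<close>. The second sum
  includes j = N because \<open>GG N P N\<close> contains the derivative by u_{N-1}.\<close>

definition Hol :: "(real \<Rightarrow> real) \<Rightarrow> nat \<Rightarrow> (jet \<Rightarrow> complex) \<Rightarrow> jet \<Rightarrow> complex" where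
  "Hol f N P x = (\<Sum>i<N. snd (snd x) (Suc i) * del DZb (del (DW i) P) x)
     - (\<Sum>j\<le>N. Tu f j 0 x * GG N P j x)"

text \<open>The weight is left out on purpose: the condition is then stable under conjugation and
  under both z-derivatives, with the same \<open>N\<close>.\<close>

definition sol :: "(real \<Rightarrow> real) \<Rightarrow> nat \<Rightarrow> (jet \<Rightarrow> complex) \<Rightarrow> bool" where
  "sol f N P \<longleftrightarrow> smooth P \<and> depends_below N P \<and> (\<forall>x. del DU P x = 0) \<and>
     (\<forall>i j x. del (DWb j) (del (DW i) P) x = 0) \<and>
     (\<forall>x. del DZb (del DZ P) x + Hol f N P x + cnj (Hol f N (\<lambda>y. cnj (P y)) x)
        + of_real (deriv f (fst x)) * P x = 0)"

lemma del_fun_eq_0: "(\<And>x. P x = 0) \<Longrightarrow> del c P x = 0"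
proof -
  assume "\<And>x. P x = 0"
  then have "P = (\<lambda>x. 0)" by auto
  then show ?thesis by simp
qed

text \<open>The point is the terms in which the barred derivation hits the conjugate of T^i. They
  produce the conjugate of T^{i+1}, which is what the shifted summand
  \<open>del (DW (k - 1)) P\<close> of \<open>GG\<close> accounts for in the conjugate copy of
  \<open>Hol\<close>.\<close>

lemma e_m1_bar_e_m1:
  assumes f: "smooth_real f" and P: "smooth P" "depends_below N P"
    and U: "\<And>x. del DU P x = 0" and mixed: "\<And>i j x. del (DWb j) (del (DW i) P) x = 0"
  shows "e_m1_bar f (e_m1 f P) x = del DZb (del DZ P) x + Hol f N P x + cnj (Hol f N (\<lambda>y. cnj (P y)) x)"
proof -
  let ?w = "\<lambda>i. snd (snd x) i"
  define G where "G = (\<lambda>x. del DZ P x + (\<Sum>i<N. snd (snd x) (Suc i) * del (DW i) P x)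
      - (\<Sum>i<N. cnj (Tu f i 0 x) * del (DWb i) P x))"
  have "e_m1 f P = G" using e_m1_eq[OF f P(2)] by (auto simp: G_def U)
  have sG: "smooth G" unfolding G_def using f P(1) by simp
  \<comment> \<open>One more coordinate than for \<open>P\<close>, since \<open>G\<close> contains
    u_N explicitly.\<close>
  have dG: "depends_below (Suc N) G"
    unfolding G_def using P(2)
    by (intro depends_below_add depends_below_diff depends_below_sum depends_below_mult
         depends_below_cnj depends_below_Tu depends_below_coord depends_below_del)
       (auto intro: depends_below_mono)
  have U': "del DU (del c P) x = 0" for c x
    by (subst del_commute[OF P(1)]) (intro del_fun_eq_0 U)
  have mixed': "del (DW j) (del (DWb i) P) x = 0" for i j x
    using mixed[of i j x] by (subst del_commute[OF P(1)])
  have top: "del (DW i) P x = 0" "del (DWb i) P x = 0" if "N \<le> i" for i x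
    using del_eq_0_of_depends_below[OF P(2) that] by auto
  have GZb: "del DZb G x = del DZb (del DZ P) x + (\<Sum>i<N. ?w (Suc i) * del DZb (del (DW i) P) x)
      - (\<Sum>i<N. cnj (Tu f i 0 x) * del DZb (del (DWb i) P) x)"
    unfolding G_def using f P(1)
    by (simp add: del_add del_diff del_sum del_mult del_cnj del_Tu del_coord)
  have GU: "del DU G x = - (\<Sum>i<N. cnj (Tu f i (Suc 0) x) * del (DWb i) P x)"
    unfolding G_def using f P(1)
    by (simp add: del_add del_diff del_sum del_mult del_cnj del_Tu del_coord U')
  have GWb: "del (DWb j) G x = del (DWb j) (del DZ P) x
      - (\<Sum>i<N. cnj (del (DW j) (Tu f i 0) x) * del (DWb i) P x)
      - (\<Sum>i<N. cnj (Tu f i 0 x) * del (DWb j) (del (DWb i) P) x)" for j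
    unfolding G_def using f P(1)
    by (simp add: del_add del_diff del_sum del_mult del_cnj del_coord mixed sum.distrib)
  have GW: "del (DW j) G x = GG N P j x" if "j \<le> N" for j
  proof -
    have "del (DW j) G x = del (DW j) (del DZ P) x
        + ((\<Sum>i<N. if j = Suc i then del (DW i) P x else 0) + (\<Sum>i<N. ?w (Suc i) * del (DW j) (del (DW i) P) x))"
      unfolding G_def sum.distrib[symmetric] using f P(1)
      by (simp add: del_add del_diff del_sum del_mult del_cnj del_Tu del_coord mixed' if_distrib[of "\<lambda>a. a * _"] cong: if_cong)
    also have "(\<Sum>i<N. if j = Suc i then del (DW i) P x else 0) = (if j = 0 then 0 else del (DW (j - 1)) P x)"
      using that by (cases j) auto
    also have "(\<Sum>i<N. ?w (Suc i) * del (DW j) (del (DW i) P) x) = (\<Sum>i<N. ?w (Suc i) * del (DW i) (del (DW j) P) x)"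
      by (simp add: del_commute[OF P(1), of "DW j"])
    finally show ?thesis
      by (simp add: GG_def del_commute[OF P(1), of "DW j" DZ])
  qed
  have TS: "Tu f (Suc i) 0 x = ?w 0 * Tu f i (Suc 0) x + (\<Sum>j<Suc N. ?w (Suc j) * del (DW j) (Tu f i 0) x)"
    if "i < N" for i
  proof -
    have "(\<Sum>j<Suc N. ?w (Suc j) * del (DW j) (Tu f i 0) x) =
       (\<Sum>j<i. of_nat (i choose Suc j) * ?w (Suc j) * Tu f (i - Suc j) (Suc 0) x)"
      using that by (intro sum.mono_neutral_cong_right) (auto simp: del_Tu[OF f])
    then show ?thesis by (simp only: TT_Suc_rev)
  qed
  have "cnj (Hol f N (\<lambda>y. cnj (P y)) x) =
      (\<Sum>i<N. cnj (?w (Suc i)) * del (DWb i) (del DZ P) x)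
      - (\<Sum>j\<le>N. cnj (Tu f j 0 x) * (del DZb (del (DWb j) P) x
           + (\<Sum>i<N. cnj (?w (Suc i)) * del (DWb i) (del (DWb j) P) x)
           + (if j = 0 then 0 else del (DWb (j - 1)) P x)))"
  proof -
    have c1: "del c (\<lambda>y. cnj (P y)) = (\<lambda>y. cnj (del (conj_coord c) P y))" for c
      using del_cnj[OF P(1)] by blast
    have c2: "del c (del c' (\<lambda>y. cnj (P y))) y = cnj (del (conj_coord c) (del (conj_coord c') P) y)" for c c' y
      unfolding c1 by (rule del_cnj) (simp add: P)
    show ?thesis
      unfolding Hol_def GG_def c2 unfolding c1
      by (simp add: del_commute[OF P(1), of DZ] if_distrib[of cnj] cong: if_cong)
  qed
  also have "(\<Sum>j\<le>N. cnj (Tu f j 0 x) * (del DZb (del (DWb j) P) x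
           + (\<Sum>i<N. cnj (?w (Suc i)) * del (DWb i) (del (DWb j) P) x)
           + (if j = 0 then 0 else del (DWb (j - 1)) P x))) =
      (\<Sum>j<Suc N. cnj (Tu f j 0 x) * (del DZb (del (DWb j) P) x
           + (\<Sum>i<N. cnj (?w (Suc i)) * del (DWb i) (del (DWb j) P) x)))
      + (\<Sum>j<Suc N. cnj (Tu f j 0 x) * (if j = 0 then 0 else del (DWb (j - 1)) P x))"
    by (simp only: lessThan_Suc_atMost sum.distrib[symmetric] distrib_left)
  also have "(\<Sum>j<Suc N. cnj (Tu f j 0 x) * (if j = 0 then 0 else del (DWb (j - 1)) P x)) =
      (\<Sum>i<N. cnj (Tu f (Suc i) 0 x) * del (DWb i) P x)"
    by (simp only: sum.lessThan_Suc_shift) simp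
  also have "\<dots> = (\<Sum>i<N. cnj (?w 0) * cnj (Tu f i (Suc 0) x) * del (DWb i) P x)
      + (\<Sum>i<N. \<Sum>j<Suc N. cnj (?w (Suc j)) * cnj (del (DW j) (Tu f i 0) x) * del (DWb i) P x)"
    unfolding sum.distrib[symmetric]
  proof (rule sum.cong)
    fix i assume "i \<in> {..<N}"
    then show "cnj (Tu f (Suc i) 0 x) * del (DWb i) P x = cnj (?w 0) * cnj (Tu f i (Suc 0) x) * del (DWb i) P x
      + (\<Sum>j<Suc N. cnj (?w (Suc j)) * cnj (del (DW j) (Tu f i 0) x) * del (DWb i) P x)"
      by (simp only: TS lessThan_iff complex_cnj_add complex_cnj_mult cnj_sum distrib_right sum_distrib_right)
  qed simp
  also have "(\<Sum>j<Suc N. cnj (Tu f j 0 x) * (del DZb (del (DWb j) P) x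
           + (\<Sum>i<N. cnj (?w (Suc i)) * del (DWb i) (del (DWb j) P) x))) =
      (\<Sum>j<N. cnj (Tu f j 0 x) * del DZb (del (DWb j) P) x)
       + (\<Sum>j<N. cnj (Tu f j 0 x) * (\<Sum>i<Suc N. cnj (?w (Suc i)) * del (DWb i) (del (DWb j) P) x))"
  proof -
    have "del c (del (DWb N) P) x = 0" for c
      by (rule del_fun_eq_0) (simp add: top)
    moreover have "del (DWb N) (del c P) x = 0" for c
      by (subst del_commute[OF P(1)]) (rule del_fun_eq_0, simp add: top)
    ultimately show ?thesis by (simp add: sum.distrib distrib_left)
  qed
  finally have conj_Hol: "cnj (Hol f N (\<lambda>y. cnj (P y)) x) =
      (\<Sum>i<N. cnj (?w (Suc i)) * del (DWb i) (del DZ P) x) -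
      ((\<Sum>j<N. cnj (Tu f j 0 x) * del DZb (del (DWb j) P) x)
       + (\<Sum>j<N. cnj (Tu f j 0 x) * (\<Sum>i<Suc N. cnj (?w (Suc i)) * del (DWb i) (del (DWb j) P) x))
       + ((\<Sum>i<N. cnj (?w 0) * cnj (Tu f i (Suc 0) x) * del (DWb i) P x)
         + (\<Sum>i<N. \<Sum>j<Suc N. cnj (?w (Suc j)) * cnj (del (DW j) (Tu f i 0) x) * del (DWb i) P x)))" .
  have "(\<Sum>j<Suc N. cnj (?w (Suc j)) * del (DWb j) G x) =
      (\<Sum>j<Suc N. cnj (?w (Suc j)) * del (DWb j) (del DZ P) x)
      - (\<Sum>j<Suc N. \<Sum>i<N. cnj (?w (Suc j)) * cnj (del (DW j) (Tu f i 0) x) * del (DWb i) P x)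
      - (\<Sum>j<Suc N. \<Sum>i<N. cnj (Tu f i 0 x) * (cnj (?w (Suc j)) * del (DWb j) (del (DWb i) P) x))"
    unfolding GWb sum_subtractf[symmetric] sum_distrib_left right_diff_distrib
    by (intro sum.cong arg_cong2[where f = "(-)"]) (simp_all add: ac_simps)
  also have "(\<Sum>j<Suc N. cnj (?w (Suc j)) * del (DWb j) (del DZ P) x) = (\<Sum>j<N. cnj (?w (Suc j)) * del (DWb j) (del DZ P) x)"
  proof -
    have "del (DWb N) (del DZ P) x = 0"
      by (subst del_commute[OF P(1)]) (rule del_fun_eq_0, simp add: top)
    then show ?thesis by simp
  qed
  also have "(\<Sum>j<Suc N. \<Sum>i<N. cnj (?w (Suc j)) * cnj (del (DW j) (Tu f i 0) x) * del (DWb i) P x) =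
     (\<Sum>i<N. \<Sum>j<Suc N. cnj (?w (Suc j)) * cnj (del (DW j) (Tu f i 0) x) * del (DWb i) P x)"
    by (rule sum.swap)
  also have "(\<Sum>j<Suc N. \<Sum>i<N. cnj (Tu f i 0 x) * (cnj (?w (Suc j)) * del (DWb j) (del (DWb i) P) x)) =
     (\<Sum>j<N. cnj (Tu f j 0 x) * (\<Sum>i<Suc N. cnj (?w (Suc i)) * del (DWb i) (del (DWb j) P) x))"
    unfolding sum_distrib_left by (rule sum.swap)
  finally have barsum: "(\<Sum>j<Suc N. cnj (?w (Suc j)) * del (DWb j) G x) =
      (\<Sum>j<N. cnj (?w (Suc j)) * del (DWb j) (del DZ P) x) -
     (\<Sum>i<N. \<Sum>j<Suc N. cnj (?w (Suc j)) * cnj (del (DW j) (Tu f i 0) x) * del (DWb i) P x) -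
     (\<Sum>j<N. cnj (Tu f j 0 x) * (\<Sum>i<Suc N. cnj (?w (Suc i)) * del (DWb i) (del (DWb j) P) x))" .
  have Tsum: "(\<Sum>i<Suc N. Tu f i 0 x * del (DW i) G x) = (\<Sum>j\<le>N. Tu f j 0 x * GG N P j x)"
    unfolding lessThan_Suc_atMost by (rule sum.cong) (auto simp: GW)
  show ?thesis
    unfolding \<open>e_m1 f P = G\<close> e_m1_bar_eq[OF f sG dG] barsum Tsum conj_Hol GZb GU
    unfolding Hol_def
    by (simp add: sum_distrib_left mult.assoc)
qed

lemma V_sol:
  assumes f: "smooth_real f" and P: "P \<in> V f d"
  shows "\<exists>N. sol f N P"
proof -
  have sm: "smooth P" using P by (simp add: V_def)
  then obtain N where N: "depends_below N P" unfolding smooth_def by blast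
  have U: "del DU P x = 0" and mixed: "del (DWb j) (del (DW i) P) x = 0" for x i j
    using P unfolding V_def del.simps by blast+
  have "e_m1_bar f (e_m1 f P) x + of_real (deriv f (fst x)) * P x = 0" for x
    using P unfolding V_def by blast
  then have "del DZb (del DZ P) x + Hol f N P x + cnj (Hol f N (\<lambda>y. cnj (P y)) x)
        + of_real (deriv f (fst x)) * P x = 0" for x
    using e_m1_bar_e_m1[OF f sm N U mixed] by simp
  with sm N U mixed show ?thesis unfolding sol_def by blast
qed

section \<open>The kernel of the barred derivation\<close>

declare split_paired_All [simp del] split_paired_Ex [simp del]

text \<open>Holomorphic in the fibre and independent of \<open>u\<close>. Nothing is asked about z,
  because the zbar-derivative is part of \<open>Dbar\<close>.\<close>

definition hol :: "(jet \<Rightarrow> complex) \<Rightarrow> bool" where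
  "hol Q \<longleftrightarrow> smooth Q \<and> (\<forall>x. del DU Q x = 0) \<and> (\<forall>i x. del (DWb i) Q x = 0)"

lemma hol_smooth: "hol Q \<Longrightarrow> smooth Q"
  and hol_DU: "hol Q \<Longrightarrow> del DU Q x = 0"
  and hol_DWb: "hol Q \<Longrightarrow> del (DWb i) Q x = 0"
  by (auto simp: hol_def)

lemma hol_add: "hol P \<Longrightarrow> hol Q \<Longrightarrow> hol (\<lambda>x. P x + Q x)"
  and hol_mult: "hol P \<Longrightarrow> hol Q \<Longrightarrow> hol (\<lambda>x. P x * Q x)"
  and hol_const: "hol (\<lambda>x. a)"
  and hol_coord: "hol (\<lambda>x. snd (snd x) i)"
  by (simp_all add: hol_def del_add del_mult del_coord)

lemma hol_wpoly: "wpoly n p \<Longrightarrow> hol (\<lambda>x. p (snd (snd x)))"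
  by (simp add: hol_def wpoly_smooth wpoly_del_eq_0)

lemma hol_sum: "finite A \<Longrightarrow> (\<And>i. i \<in> A \<Longrightarrow> hol (P i)) \<Longrightarrow> hol (\<lambda>x. \<Sum>i\<in>A. P i x)"
  by (simp add: hol_def del_sum)

lemma hol_del: "hol Q \<Longrightarrow> hol (del c Q)"
  unfolding hol_def by (auto simp: del_commute[of Q _ c] intro: del_fun_eq_0)

declare hol_smooth [simp] hol_DU [simp] hol_DWb [simp]

lemma hol_u: "hol Q \<Longrightarrow> Q (u, z, w) = Q (u', z, w)"
  by (rule indep_u) auto

text \<open>The barred derivation on holomorphic functions, with the argument of \<open>f\<close> frozen at \<open>u\<close>.\<close>

definition Dbar :: "(real \<Rightarrow> real) \<Rightarrow> real \<Rightarrow> nat \<Rightarrow> (jet \<Rightarrow> complex) \<Rightarrow> jet \<Rightarrow> complex" where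
  "Dbar f u M Q x = del DZb Q x - (\<Sum>j<M. Tc f u j 0 x * del (DW j) Q x)"

lemma Tc_fibre: "Tc f u j l x = Tc f u j l (0, 0, snd (snd x))"
  by (rule TT_cong) (auto simp: phi_c_def)

text \<open>The commutator of the u_i-derivative with \<open>Dbar\<close> involves only
  u_j-derivatives with j > i; up to sign its first coefficient is \<open>deriv f u\<close>.\<close>

lemma del_DW_Dbar:
  assumes Q: "smooth Q"
  shows "del (DW i) (Dbar f u M Q) x = Dbar f u M (del (DW i) Q) x
     - (\<Sum>j<M. (if i < j then of_nat (j choose Suc i) * Tc f u (j - Suc i) (Suc 0) x else 0) * del (DW j) Q x)"
  unfolding Dbar_def[abs_def] using Q
  by (simp add: del_diff del_sum del_mult del_Tc sum.distrib del_commute[of Q "DW i"])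

lemma Dbar_mult:
  assumes "smooth P" "smooth Q"
  shows "Dbar f u M (\<lambda>x. P x * Q x) x = Dbar f u M P x * Q x + P x * Dbar f u M Q x"
  using assms by (simp add: Dbar_def del_mult algebra_simps sum.distrib sum_distrib_left)

lemma Dbar_sum:
  assumes "finite A" "\<And>i. i \<in> A \<Longrightarrow> smooth (P i)"
  shows "Dbar f u M (\<lambda>x. \<Sum>i\<in>A. P i x) x = (\<Sum>i\<in>A. Dbar f u M (P i) x)"
  using assms
  by (simp add: Dbar_def del_sum sum_subtractf sum_distrib_left sum.swap[of _ A])

text \<open>T^j has weight j and the u_j-derivative removes j + 1, so every summand lowers the
  weight by exactly one.\<close>

lemma wpoly_Dbar:
  assumes "wpoly n p"
  shows "\<exists>q. (\<forall>x. Dbar f u M (\<lambda>x. p (snd (snd x))) x = q (snd (snd x))) \<and>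
     (if n = 0 then q = (\<lambda>_. 0) else wpoly (n - 1) q)"
proof -
  obtain r where r: "\<And>j x. del (DW j) (\<lambda>x. p (snd (snd x))) x = r j (snd (snd x))"
    "\<And>j. if j < n then wpoly (n - Suc j) (r j) else r j = (\<lambda>_. 0)"
    using wpoly_del[OF assms] by metis
  define q where "q w = (\<Sum>j<M. (-1) * (Tc f u j 0 (0, 0, w) * r j w))" for w
  have "Dbar f u M (\<lambda>x. p (snd (snd x))) x = q (snd (snd x))" for x
    by (simp add: Dbar_def r(1) wpoly_del_eq_0[OF assms] q_def Tc_fibre[of f u _ 0 x] sum_negf)
  moreover have "q = (\<lambda>_. 0)" if "n = 0"
    using r(2) that by (auto simp: q_def)
  moreover have "wpoly (n - 1) q" if "n \<noteq> 0"
    unfolding q_def[abs_def]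
  proof (intro wpoly_sum wpoly_cmult)
    show "wpoly (n - 1) (\<lambda>w. Tc f u j 0 (0, 0, w) * r j w)" for j
    proof (cases "j < n")
      case True
      then have "n - 1 = j + (n - Suc j)" by simp
      moreover have "wpoly (n - Suc j) (r j)" using r(2)[of j] True by simp
      ultimately show ?thesis by (metis wpoly_mult[OF wpoly_Tc])
    qed (use r(2)[of j] wpoly_zero in simp)
  qed simp
  ultimately show ?thesis by (intro exI[of _ q]) simp
qed

locale potential =
  fixes f :: "real \<Rightarrow> real"
  assumes smooth_f: "smooth_real f"
    and independent: "\<And>a b. (\<And>u. a * f u + b * deriv f u = 0) \<Longrightarrow> a = 0 \<and> b = 0"
    and nonlinear: "\<not> affine_fun f"
begin

lemma deriv_neq_complex_mult: "\<exists>u. of_real (deriv f u) \<noteq> (a :: complex) * of_real (f u)"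
proof (rule ccontr)
  assume "\<nexists>u. of_real (deriv f u) \<noteq> a * of_real (f u)"
  then have "Re (of_real (deriv f u)) = Re (a * of_real (f u))" for u by metis
  then have "(- Re a) * f u + 1 * deriv f u = 0" for u by simp
  from independent[OF this] show False by simp
qed

lemma f_nonconst: "\<exists>u v. f u \<noteq> f v"
proof (rule ccontr)
  assume "\<nexists>u v. f u \<noteq> f v"
  then have "f = (\<lambda>_. f 0)" by (auto simp: fun_eq_iff)
  then have "deriv f u = 0" for u by (metis deriv_const)
  then show False using independent[of 0 1] by simp
qed

text \<open>
  The linear relations between the \<open>u\<^sub>j\<close>-derivatives of \<open>Q\<close> are closed under commutation with \<open>Dbar\<close>.
  If the leading coefficients of such a relation are \<open>1\<close> and \<open>a u\<^sub>0\<close>, its commutator with \<open>Dbar\<close> at \<open>u\<close>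
  starts one place later, with coefficient \<open>f' u - a f u\<close>; linear independence of \<open>f\<close> and \<open>f'\<close>
  provides a \<open>u\<close> where this does not vanish. The weights guarantee that the second coefficient
  is again a multiple of \<open>u\<^sub>0\<close>.
\<close>

lemma relation_chain:
  assumes Q: "hol Q" and M: "M > 0" and D: "\<And>u x. Dbar f u M Q x = 0"
  shows "\<exists>A. (\<forall>j<k. \<forall>w. A j w = 0) \<and> (\<forall>w. A k w = 1) \<and> (\<forall>j\<ge>k. wpoly (j - k) (A j)) \<and>
      (\<forall>x. (\<Sum>j<M. A j (snd (snd x)) * del (DW j) Q x) = 0)"
proof (induction k)
  case 0
  obtain u v where uv: "f u \<noteq> f v" using f_nonconst by blast
  \<comment> \<open>Subtracting \<open>Dbar\<close> at \<open>u\<close> and at \<open>v\<close>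
    removes the zbar-derivative; dividing by f u - f v makes the coefficient of the u_0-derivative
    equal to 1.\<close>
  define A where "A j w = (1 / of_real (f u - f v)) * (Tc f u j 0 (0, 0, w) - Tc f v j 0 (0, 0, w))" for j w
  have "wpoly j (A j)" for j
    unfolding A_def[abs_def] by (intro wpoly_cmult wpoly_diff wpoly_Tc)
  moreover have "A 0 w = 1" for w
    using uv by (simp add: A_def phi_c_def flip: of_real_diff)
  moreover have "(\<Sum>j<M. A j (snd (snd x)) * del (DW j) Q x) = 0" for x
  proof -
    have "(\<Sum>j<M. A j (snd (snd x)) * del (DW j) Q x) =
        (1 / of_real (f u - f v)) * (Dbar f v M Q x - Dbar f u M Q x)"
      unfolding A_def Tc_fibre[of f _ _ 0 x, symmetric] Dbar_def
      by (simp add: left_diff_distrib sum_subtractf sum_divide_distrib[symmetric] diff_divide_distrib[symmetric])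
    then show ?thesis by (simp add: D)
  qed
  ultimately show ?case by (intro exI[of _ A]) auto
next
  case (Suc k)
  then obtain A where A0: "\<And>j w. j < k \<Longrightarrow> A j w = 0" and A1: "\<And>w. A k w = 1"
    and Aw: "\<And>j. j \<ge> k \<Longrightarrow> wpoly (j - k) (A j)"
    and rel: "\<And>x. (\<Sum>j<M. A j (snd (snd x)) * del (DW j) Q x) = 0" by blast
  have Ah: "hol (\<lambda>x. A j (snd (snd x)))" for j
    using Aw[of j] A0 by (cases "k \<le> j") (auto intro: hol_wpoly hol_const)
  obtain a where a: "\<And>w. A (Suc k) w = a * w 0"
    using wpoly_1D[of "A (Suc k)"] Aw[of "Suc k"] by auto
  obtain u where u: "of_real (deriv f u) \<noteq> - a * (- of_real (f u))"
    using deriv_neq_complex_mult[of a] by auto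
  define N where "N j x = Dbar f u M (\<lambda>x. A j (snd (snd x))) x" for j x
  have "\<exists>q. (\<forall>x. N j x = q (snd (snd x))) \<and> (j \<le> k \<longrightarrow> q = (\<lambda>_. 0)) \<and> (j > k \<longrightarrow> wpoly (j - Suc k) q)" for j
  proof (cases "j \<le> k")
    case True
    have "A j = (\<lambda>_. if j = k then 1 else 0)"
      using A0[of j] A1 True by (cases "j = k") (simp_all add: fun_eq_iff)
    then have "N j x = 0" for x
      by (simp only: N_def Dbar_def del_const) simp
    then show ?thesis using True by (intro exI[of _ "\<lambda>_. 0"]) simp
  next
    case False
    then show ?thesis using wpoly_Dbar[OF Aw[of j], of f u M] unfolding N_def by (auto split: if_splits)
  qed
  then obtain q where q: "\<And>j x. N j x = q j (snd (snd x))" "\<And>j. j \<le> k \<Longrightarrow> q j = (\<lambda>_. 0)"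
      "\<And>j. j > k \<Longrightarrow> wpoly (j - Suc k) (q j)" by metis
  \<comment> \<open>The coefficients of the relation after applying \<open>Dbar\<close>:
    \<open>q j\<close> comes from differentiating \<open>A j\<close>, the sum from moving
    \<open>Dbar\<close> past the u_i-derivatives.\<close>
  define B where "B j w = q j w + (\<Sum>i<j. A i w * (of_nat (j choose Suc i) * Tc f u (j - Suc i) (Suc 0) (0, 0, w)))" for j w
  have B0: "B j w = 0" if "j \<le> k" for j w
    using that by (simp add: B_def q A0)
  define b where "b = of_real (deriv f u) - a * of_real (f u)"
  have "b \<noteq> 0" using u by (simp add: b_def)
  have B1: "B (Suc k) w = b" for w
  proof -
    define x :: jet where "x = (0, 0, w)"
    have "N (Suc k) x = - (\<Sum>j<M. Tc f u j 0 x * (if j = 0 then a else 0))"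
      unfolding N_def a Dbar_def
      by (simp add: del_cmult del_coord if_distrib cong: if_cong)
    also have "(\<Sum>j<M. Tc f u j 0 x * (if j = 0 then a else 0)) =
        (\<Sum>j<M. if j = 0 then Tc f u 0 0 x * a else 0)"
      by (rule sum.cong) auto
    also have "\<dots> = a * of_real (f u)" using M by (simp add: phi_c_def mult.commute)
    finally have "q (Suc k) w = - (a * of_real (f u))" using q(1)[of "Suc k" x] by (simp add: x_def)
    then show ?thesis by (simp add: B_def A0 A1 phi_c_def b_def)
  qed
  have Bw: "wpoly (j - Suc k) (B j)" if "j > k" for j
    unfolding B_def[abs_def]
  proof (intro wpoly.add wpoly_sum)
    show "wpoly (j - Suc k) (\<lambda>w. A i w * (of_nat (j choose Suc i) * Tc f u (j - Suc i) (Suc 0) (0, 0, w)))"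
      if "i \<in> {..<j}" for i
    proof (cases "i < k")
      case True then show ?thesis using A0 wpoly_zero by simp
    next
      case False
      then have "j - Suc k = (i - k) + (j - Suc i)" using that by simp
      then show ?thesis using False by (metis wpoly_mult[OF Aw[of i] wpoly_cmult[OF wpoly_Tc]] not_less)
    qed
  qed (use q(3) that in auto)
  have relB: "(\<Sum>j<M. B j (snd (snd x)) * del (DW j) Q x) = 0" for x
  proof -
    have DQ: "Dbar f u M (del (DW i) Q) x =
        (\<Sum>j<M. (if i < j then of_nat (j choose Suc i) * Tc f u (j - Suc i) (Suc 0) x else 0) * del (DW j) Q x)" for i
      using del_DW_Dbar[of Q] Q del_fun_eq_0[of "Dbar f u M Q" "DW i" x, OF D] by simp
    have "Dbar f u M (\<lambda>x. \<Sum>j<M. A j (snd (snd x)) * del (DW j) Q x) x = 0"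
      unfolding rel Dbar_def by simp
    then have "0 = (\<Sum>j<M. N j x * del (DW j) Q x + A j (snd (snd x)) * Dbar f u M (del (DW j) Q) x)"
      using Ah Q by (simp add: Dbar_sum Dbar_mult N_def)
    also have "\<dots> = (\<Sum>j<M. N j x * del (DW j) Q x) + (\<Sum>i<M. \<Sum>j<M. A i (snd (snd x)) *
        ((if i < j then of_nat (j choose Suc i) * Tc f u (j - Suc i) (Suc 0) x else 0) * del (DW j) Q x))"
      by (simp only: sum.distrib DQ sum_distrib_left)
    also have "(\<Sum>i<M. \<Sum>j<M. A i (snd (snd x)) *
        ((if i < j then of_nat (j choose Suc i) * Tc f u (j - Suc i) (Suc 0) x else 0) * del (DW j) Q x)) =
      (\<Sum>j<M. \<Sum>i<M. A i (snd (snd x)) *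
        ((if i < j then of_nat (j choose Suc i) * Tc f u (j - Suc i) (Suc 0) x else 0) * del (DW j) Q x))"
      by (rule sum.swap)
    also have "\<dots> = (\<Sum>j<M. (\<Sum>i<j. A i (snd (snd x)) *
        (of_nat (j choose Suc i) * Tc f u (j - Suc i) (Suc 0) x)) * del (DW j) Q x)"
      unfolding sum_distrib_right
      by (intro sum.cong[OF refl] sum.mono_neutral_cong_right) (auto simp: mult.assoc)
    finally show ?thesis
      unfolding B_def Tc_fibre[of f u _ "Suc 0" x, symmetric] q(1)[symmetric]
      by (simp add: distrib_right sum.distrib)
  qed
  have "(\<Sum>j<M. (1 / b) * B j (snd (snd x)) * del (DW j) Q x) = 0" for x
    using relB[of x] by (simp add: sum_divide_distrib[symmetric])
  then show ?case using \<open>b \<noteq> 0\<close>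
    by (intro exI[of _ "\<lambda>j w. (1 / b) * B j w"] conjI allI impI wpoly_cmult Bw) (auto simp: B0 B1)
qed

text \<open>Descending induction on k: in the relation that starts at k with coefficient 1, all
  later derivatives already vanish. Once every u_k-derivative is zero, \<open>Dbar\<close> reduces
  to the zbar-derivative.\<close>

lemma Dbar_kernel:
  assumes Q: "hol Q" "depends_below M Q" and D: "\<And>u x. Dbar f u M Q x = 0"
  shows "del (DW k) Q x = 0" "del DZb Q x = 0"
proof -
  have *: "del (DW k) Q x = 0" for k
  proof (induction "M - k" arbitrary: k rule: less_induct)
    case less
    show ?case
    proof (cases "k < M")
      case False
      then show ?thesis using del_eq_0_of_depends_below(1)[OF Q(2), of k] by simp
    next
      case True
      obtain A where A: "\<And>j w. j < k \<Longrightarrow> A j w = 0" "\<And>w. A k w = 1"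
        "\<And>x. (\<Sum>j<M. A j (snd (snd x)) * del (DW j) Q x) = 0"
        using relation_chain[OF Q(1) _ D, of k] True gr_implies_not_zero[OF True] by blast
      have "0 = (\<Sum>j<M. A j (snd (snd x)) * del (DW j) Q x)" using A(3) by simp
      also have "\<dots> = (\<Sum>j\<in>{k}. A j (snd (snd x)) * del (DW j) Q x)"
      proof (rule sum.mono_neutral_right)
        show "\<forall>i\<in>{..<M} - {k}. A i (snd (snd x)) * del (DW i) Q x = 0"
        proof
          fix i assume i: "i \<in> {..<M} - {k}"
          show "A i (snd (snd x)) * del (DW i) Q x = 0"
          proof (cases "i < k")
            case True then show ?thesis using A(1) by simp
          next
            case False
            with i True have "M - i < M - k" by auto
            then show ?thesis using less by simp
          qed
        qed
      qed (use True in auto)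
      finally show ?thesis using A(2) by simp
    qed
  qed
  show "del (DW k) Q x = 0" by (rule *)
  show "del DZb Q x = 0" using D[of 0 x] * by (simp add: Dbar_def)
qed

end

section \<open>Solutions of the linearised equation\<close>

lemma del_commute_fun: "smooth P \<Longrightarrow> del c (del c' P) = del c' (del c P)"
  using del_commute by blast

lemma del_cnj_fun: "smooth P \<Longrightarrow> del c (\<lambda>x. cnj (P x)) = (\<lambda>x. cnj (del (conj_coord c) P x))"
  using del_cnj by blast

lemma smooth_GG [simp]: "smooth P \<Longrightarrow> smooth (GG N P k)"
  unfolding GG_def[abs_def] by (cases k) simp_all

lemma smooth_Hol: "smooth_real f \<Longrightarrow> smooth P \<Longrightarrow> smooth (Hol f N P)"
  unfolding Hol_def[abs_def] by simp

lemma del_GG: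
  assumes "smooth P"
  shows "del c (GG N P k) x = del c (del DZ (del (DW k) P)) x
    + (\<Sum>i<N. del c (\<lambda>x. snd (snd x) (Suc i)) x * del (DW i) (del (DW k) P) x
        + snd (snd x) (Suc i) * del c (del (DW i) (del (DW k) P)) x)
    + (if k = 0 then 0 else del c (del (DW (k - 1)) P) x)"
  unfolding GG_def[abs_def] using assms by (cases k) (simp_all add: del_add del_sum del_mult)

lemma GG_del:
  assumes P: "smooth P" and c: "c = DZ \<or> c = DZb"
  shows "del c (GG N P k) x = GG N (del c P) k x"
proof -
  have 0: "del c (\<lambda>x. snd (snd x) i) x = 0" for i using c by (auto simp: del_coord)
  show ?thesis
    unfolding del_GG[OF P] 0 GG_def
    unfolding del_commute_fun[OF P, of "DW _" c] del_commute[OF smooth_del[OF P], of _ c]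
    by simp
qed

lemma Hol_del:
  assumes f: "smooth_real f" and P: "smooth P" and c: "c = DZ \<or> c = DZb"
  shows "del c (Hol f N P) x = Hol f N (del c P) x"
proof -
  have 0: "del c (\<lambda>x. snd (snd x) i) x = 0" "del c (Tu f j l) x = 0" for i j l
    using c f by (auto simp: del_coord del_Tu)
  have "del c (Hol f N P) x = (\<Sum>i<N. snd (snd x) (Suc i) * del c (del DZb (del (DW i) P)) x)
     - (\<Sum>j\<le>N. Tu f j 0 x * del c (GG N P j) x)"
    unfolding Hol_def[abs_def] using f P by (simp add: del_diff del_sum del_mult 0)
  then show ?thesis
    unfolding Hol_def GG_del[OF P c] del_commute_fun[OF P, of "DW _" c] del_commute[OF smooth_del[OF P], of _ c] .
qed

lemma sol_cnj:
  assumes "sol f N P" shows "sol f N (\<lambda>x. cnj (P x))"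
proof -
  have P: "smooth P" and N: "depends_below N P" and U: "\<And>x. del DU P x = 0"
    and mixed: "\<And>i j x. del (DWb j) (del (DW i) P) x = 0"
    and eq: "\<And>x. del DZb (del DZ P) x + Hol f N P x + cnj (Hol f N (\<lambda>y. cnj (P y)) x)
        + of_real (deriv f (fst x)) * P x = 0"
    using assms unfolding sol_def by blast+
  have cc: "del c (del c' (\<lambda>y. cnj (P y))) x = cnj (del (conj_coord c) (del (conj_coord c') P) x)" for c c' x
    unfolding del_cnj_fun[OF P] by (rule del_cnj) (simp add: P)
  have mixed': "del (DWb j) (del (DW i) (\<lambda>y. cnj (P y))) x = 0" for i j x
    using mixed[of i j x] by (simp add: cc del_commute[OF P, of "DW j"])
  have "del DZb (del DZ (\<lambda>y. cnj (P y))) x + Hol f N (\<lambda>y. cnj (P y)) x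
      + cnj (Hol f N (\<lambda>y. cnj (cnj (P y))) x) + of_real (deriv f (fst x)) * cnj (P x) =
      cnj (del DZb (del DZ P) x + Hol f N P x + cnj (Hol f N (\<lambda>y. cnj (P y)) x)
        + of_real (deriv f (fst x)) * P x)" for x
    by (simp add: cc del_commute[OF P, of DZ])
  then show ?thesis
    unfolding sol_def using P depends_below_cnj[OF N] mixed'
    by (simp add: eq del_cnj U)
qed

text \<open>The coefficients of the equation involve \<open>u\<close> and the fibre but not z, so it
  may be differentiated by z and zbar. The two cases are treated together because conjugation
  exchanges them.\<close>

lemma sol_del:
  assumes f: "smooth_real f" and sol: "sol f N P" and c: "c = DZ \<or> c = DZb"
  shows "sol f N (del c P)"
proof -
  have P: "smooth P" and N: "depends_below N P" and U: "\<And>x. del DU P x = 0"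
    and mixed: "\<And>i j x. del (DWb j) (del (DW i) P) x = 0"
    and eq: "\<And>x. del DZb (del DZ P) x + Hol f N P x + cnj (Hol f N (\<lambda>y. cnj (P y)) x)
        + of_real (deriv f (fst x)) * P x = 0"
    using sol unfolding sol_def by blast+
  have c': "conj_coord c = DZ \<or> conj_coord c = DZb" using c by auto
  have "del c (phi_u f (Suc 0)) x = 0" for x using c by (auto simp: del_phi_u f)
  then have F: "del c (\<lambda>x. phi_u f (Suc 0) x * P x) x = phi_u f (Suc 0) x * del c P x" for x
    by (simp add: del_mult P smooth_phi_u f)
  have "0 = del c (\<lambda>x. del DZb (del DZ P) x + Hol f N P x + cnj (Hol f N (\<lambda>y. cnj (P y)) x)
        + phi_u f (Suc 0) x * P x) x" for x
    by (rule del_fun_eq_0[symmetric]) (simp add: phi_u_def eq)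
  also have "\<dots> x = del c (del DZb (del DZ P)) x + del c (Hol f N P) x
      + cnj (del (conj_coord c) (Hol f N (\<lambda>y. cnj (P y))) x) + phi_u f (Suc 0) x * del c P x" for x
    using P f by (simp add: del_add smooth_Hol smooth_phi_u del_cnj F)
  also have "\<dots> x = del DZb (del DZ (del c P)) x + Hol f N (del c P) x
      + cnj (Hol f N (\<lambda>y. cnj (del c P y)) x) + of_real (deriv f (fst x)) * del c P x" for x
    using P f c c'
    by (simp add: Hol_del del_cnj_fun phi_u_def del_commute_fun[of P DZ c] del_commute_fun[of "del DZ P" DZb c])
  finally have "del DZb (del DZ (del c P)) x + Hol f N (del c P) x
      + cnj (Hol f N (\<lambda>y. cnj (del c P y)) x) + of_real (deriv f (fst x)) * del c P x = 0" for x
    by simp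
  moreover have "del DU (del c P) x = 0" for x
    by (subst del_commute[OF P]) (rule del_fun_eq_0, rule U)
  moreover have "del (DWb j) (del (DW i) (del c P)) x = 0" for i j x
    unfolding del_commute_fun[OF P, of "DW i" c] del_commute_fun[OF smooth_del[OF P], of "DWb j" c]
    by (rule del_fun_eq_0, rule mixed)
  ultimately show ?thesis
    unfolding sol_def using P depends_below_del[OF N] by simp
qed

text \<open>A locale, so that every result about \<open>P\<close> can be interpreted for its
  conjugate and for its z- and zbar-derivatives.\<close>

locale solution = potential f for f +
  fixes N :: nat and P :: "jet \<Rightarrow> complex"
  assumes sol: "sol f N P"
begin

lemma P_smooth [simp]: "smooth P" and P_depends: "depends_below N P" and P_DU: "del DU P x = 0"
  and P_mixed: "del (DWb j) (del (DW i) P) x = 0"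
  and P_eq: "del DZb (del DZ P) x + Hol f N P x + cnj (Hol f N (\<lambda>y. cnj (P y)) x)
        + of_real (deriv f (fst x)) * P x = 0"
  using sol unfolding sol_def by blast+

lemma hol_PW: "hol (del (DW k) P)"
proof -
  have "del DU (del (DW k) P) x = 0" for x
    by (subst del_commute) (simp, rule del_fun_eq_0, rule P_DU)
  then show ?thesis unfolding hol_def using P_mixed by simp
qed

lemma PW_top: "N \<le> k \<Longrightarrow> del (DW k) P x = 0" 
  using del_eq_0_of_depends_below(1)[OF P_depends] .

lemma hol_GG: "hol (GG N P k)"
proof -
  have 1: "hol (\<lambda>x. del DZ (del (DW k) P) x + (\<Sum>i<N. snd (snd x) (Suc i) * del (DW i) (del (DW k) P) x))"
    by (rule hol_add[OF hol_del[OF hol_PW] hol_sum[OF finite_lessThan hol_mult[OF hol_coord hol_del[OF hol_PW]]]])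
  show ?thesis
  proof (cases k)
    case 0 then show ?thesis using 1 by (simp add: GG_def[abs_def])
  next
    case (Suc m) then show ?thesis using hol_add[OF 1 hol_PW[of m]] by (simp add: GG_def[abs_def])
  qed
qed

lemma depends_GG: "depends_below (Suc N) (GG N P k)"
  unfolding GG_def[abs_def]
  using depends_below_mono[OF P_depends, of "Suc N"]
  by (cases k) (auto intro!: depends_below_add depends_below_sum depends_below_mult depends_below_coord
      depends_below_del simp: depends_below_def[of _ "\<lambda>x. 0"])

text \<open>For indices up to \<open>N\<close> this is the symmetry of second derivatives of e_{-1}
  P; here it is read off from the formula for \<open>GG\<close>.\<close>

lemma del_DW_GG_commute: "del (DW k) (GG N P j) x = del (DW j) (GG N P k) x"
proof -
  have *: "del (DW k) (GG N P j) x = del (DW k) (del DZ (del (DW j) P)) x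
      + (\<Sum>i<N. snd (snd x) (Suc i) * del (DW k) (del (DW i) (del (DW j) P)) x)
      + ((if k = 0 then 0 else del (DW (k - 1)) (del (DW j) P) x)
         + (if j = 0 then 0 else del (DW k) (del (DW (j - 1)) P) x))" for k j
  proof -
    have "(\<Sum>i<N. (if k = Suc i then 1 else 0) * del (DW i) (del (DW j) P) x) =
        (if k = 0 then 0 else del (DW (k - 1)) (del (DW j) P) x)"
    proof (cases k)
      case 0
      then show ?thesis by simp
    next
      case (Suc m)
      show ?thesis
      proof (cases "m < N")
        case True then show ?thesis by (simp add: Suc if_distrib[of "\<lambda>a. a * _"] cong: if_cong)
      next
        case False
        then have "del (DW m) (del (DW j) P) x = 0"
          by (subst del_commute) (simp, intro del_fun_eq_0 PW_top, simp)
        then show ?thesis using False by (auto simp: Suc intro!: sum.neutral)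
      qed
    qed
    then show ?thesis by (simp add: del_GG del_coord sum.distrib)
  qed
  have comm: "del (DW k) (del DZ (del (DW j) P)) x = del (DW j) (del DZ (del (DW k) P)) x"
    "del (DW k) (del (DW i) (del (DW j) P)) x = del (DW j) (del (DW i) (del (DW k) P)) x" for i
    by (simp_all add: del_commute_fun[of P _ "DW j"] del_commute_fun[of "del (DW j) P" _ "DW i"]
        del_commute_fun[of "del (DW j) P" _ "DZ"] del_commute[of _ _ "DW j"])
      (simp_all add: del_commute_fun[of P "DW j" DZ] del_commute_fun[of P "DW k" DZ]
        del_commute_fun[of P "DW j" "DW i"] del_commute_fun[of P "DW k" "DW i"] del_commute[of "del DZ P"] del_commute[of "del (DW i) P"])
  have "del (DW k) (del (DW (j - 1)) P) x = del (DW (j - 1)) (del (DW k) P) x"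
    "del (DW (k - 1)) (del (DW j) P) x = del (DW j) (del (DW (k - 1)) P) x"
    by (simp_all only: del_commute[OF P_smooth, of "DW k"] del_commute[OF P_smooth, of "DW j"])
  then show ?thesis
    unfolding * comm by (simp only: add.commute)
qed

lemma del_DW_Hol_cnj: "del (DW k) (\<lambda>x. cnj (Hol f N (\<lambda>y. cnj (P y)) x)) x = 0"
proof -
  interpret C: solution f N "\<lambda>y. cnj (P y)"
    by unfold_locales (rule sol_cnj[OF sol])
  have "del (DWb k) (Hol f N (\<lambda>y. cnj (P y))) x = 0"
    unfolding Hol_def[abs_def] using smooth_f C.hol_GG hol_del[OF C.hol_PW, of DZb]
    by (simp add: del_diff del_sum del_mult del_coord del_Tu)
  then show ?thesis using smooth_f by (subst del_cnj) (simp_all add: smooth_Hol)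
qed

text \<open>The u_k-derivative of the equation. The conjugate part disappears, and the symmetry of
  the G_j turns the sum of T^j times the u_k-derivative of G_j into the sum occurring in
  \<open>Dbar\<close> of G_k.\<close>

lemma Dbar_GG:
  "Dbar f u (Suc N) (GG N P k) x =
     (\<Sum>j\<le>N. (if k < j then of_nat (j choose Suc k) * Tc f u (j - Suc k) (Suc 0) x else 0) * GG N P j x)
     - of_real (deriv f u) * del (DW k) P x"
proof -
  obtain v z w where x: "x = (v, z, w)" by (cases x)
  \<comment> \<open>The equation is taken at this point, with the prescribed \<open>u\<close> in the
    coefficients. The functions G_j and the u_k-derivatives of \<open>P\<close> have the same values
    at \<open>x\<close>.\<close>
  define y where "y = (u, z, w)"
  have yx: "Q y = Q x" if "hol Q" for Q using hol_u[OF that] by (simp add: x y_def)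
  have Ty: "Tu f j l y = Tc f u j l x" for j l
    by (rule TT_cong) (auto simp: x y_def phi_u_def phi_c_def)
  have "0 = del (DW k) (\<lambda>x. del DZb (del DZ P) x + Hol f N P x + cnj (Hol f N (\<lambda>y. cnj (P y)) x)
        + phi_u f (Suc 0) x * P x) y"
    by (rule del_fun_eq_0[symmetric]) (simp add: phi_u_def P_eq)
  also have "\<dots> = del (DW k) (del DZb (del DZ P)) y + del (DW k) (Hol f N P) y
      + phi_u f (Suc 0) y * del (DW k) P y"
    using smooth_f by (simp add: del_add del_mult smooth_Hol smooth_phi_u del_DW_Hol_cnj del_phi_u)
  also have "del (DW k) (Hol f N P) y =
      (\<Sum>i<N. (if k = Suc i then 1 else 0) * del DZb (del (DW i) P) y)
      + (\<Sum>i<N. snd (snd y) (Suc i) * del (DW k) (del DZb (del (DW i) P)) y)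
      - ((\<Sum>j\<le>N. del (DW k) (Tu f j 0) y * GG N P j y) + (\<Sum>j\<le>N. Tu f j 0 y * del (DW k) (GG N P j) y))"
    unfolding Hol_def[abs_def] using smooth_f
    by (simp add: del_diff del_sum del_mult del_coord sum.distrib)
  also have "(\<Sum>i<N. (if k = Suc i then 1 else 0) * del DZb (del (DW i) P) y) =
      (if k = 0 then 0 else del DZb (del (DW (k - 1)) P) y)"
  proof (cases k)
    case (Suc m)
    show ?thesis
    proof (cases "m < N")
      case True then show ?thesis by (simp add: Suc if_distrib[of "\<lambda>a. a * _"] cong: if_cong)
    next
      case False
      then have "del DZb (del (DW m) P) y = 0" by (intro del_fun_eq_0 PW_top) simp
      then show ?thesis using False by (auto simp: Suc intro!: sum.neutral)
    qed
  qed simp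
  also have "(\<Sum>i<N. snd (snd y) (Suc i) * del (DW k) (del DZb (del (DW i) P)) y) =
      (\<Sum>i<N. snd (snd y) (Suc i) * del DZb (del (DW i) (del (DW k) P)) y)"
    by (simp add: del_commute[of "del (DW _) P" "DW k" DZb] del_commute_fun[of P "DW k" "DW _"])
  also have "del (DW k) (del DZb (del DZ P)) y = del DZb (del DZ (del (DW k) P)) y"
    by (simp add: del_commute[of "del DZ P" "DW k" DZb] del_commute_fun[of P "DW k" DZ])
  finally have "del DZb (GG N P k) y - (\<Sum>j\<le>N. Tu f j 0 y * del (DW k) (GG N P j) y) =
      (\<Sum>j\<le>N. del (DW k) (Tu f j 0) y * GG N P j y) - phi_u f (Suc 0) y * del (DW k) P y"
    by (simp add: del_GG del_coord algebra_simps)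
  then show ?thesis
    unfolding Dbar_def lessThan_Suc_atMost
    unfolding del_Tu(2)[OF smooth_f] Ty yx[OF hol_GG] yx[OF hol_PW] yx[OF hol_del[OF hol_GG]] del_DW_GG_commute[of k]
    by (simp add: phi_u_def y_def)
qed

lemma GG_above:
  assumes "\<And>j x. j > n \<Longrightarrow> del (DW j) P x = 0" 
  shows "GG N P (Suc n) = del (DW n) P" and "j > Suc n \<Longrightarrow> GG N P j x = 0"
proof -
  have 1: "del c (del (DW j) P) x = 0" if "j > n" for c j x
    by (rule del_fun_eq_0) (rule assms[OF that])
  have 0: "del c (del (DW j) P) x = 0" "del c (del c' (del (DW j) P)) x = 0" if "j > n" for c c' j x
    by (rule 1[OF that], rule del_fun_eq_0, rule 1[OF that])
  show "GG N P (Suc n) = del (DW n) P" by (simp add: GG_def[abs_def] 0)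
  show "j > Suc n \<Longrightarrow> GG N P j x = 0" using assms[of "j - 1"] by (simp add: GG_def 0)
qed

text \<open>Both G_{n+1}, which is the u_n-derivative of \<open>P\<close>, and G_n lie in the kernel
  of \<open>Dbar\<close> for every \<open>u\<close>, so \<open>Dbar_kernel\<close> applies to each
  of them.\<close>

lemma top_order:
  assumes top: "\<And>j x. j > n \<Longrightarrow> del (DW j) P x = 0"
  shows "del (DW j) (del (DW n) P) x = 0" "del DZb (del (DW n) P) x = 0"
    "del (DW j) (GG N P n) x = 0" "del DZb (GG N P n) x = 0"
proof -
  note GG = GG_above[of n, OF top]
  have 1: "Dbar f u (Suc N) (GG N P (Suc n)) x = 0" for u x
  proof -
    have "(\<Sum>j\<le>N. (if Suc n < j then of_nat (j choose Suc (Suc n)) * Tc f u (j - Suc (Suc n)) (Suc 0) x else 0)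
        * GG N P j x) = 0"
      by (rule sum.neutral) (simp add: GG(2))
    then show ?thesis unfolding Dbar_GG by (simp add: top)
  qed
  then have 2: "Dbar f u (Suc N) (del (DW n) P) x = 0" for u x using GG(1) by simp
  from Dbar_kernel[OF hol_PW _ 2] show "del (DW j) (del (DW n) P) x = 0" "del DZb (del (DW n) P) x = 0"
    using depends_below_mono[OF depends_below_del[OF P_depends], of "Suc N"] by auto
  \<comment> \<open>Only j = n + 1 survives in \<open>Dbar_GG\<close>, with coefficient f' u. Since
    G_{n+1} is the u_n-derivative of \<open>P\<close>, this cancels the last term.\<close>
  have "Dbar f u (Suc N) (GG N P n) x = 0" for u x
  proof (cases "n < N")
    case True
    have "(\<Sum>j\<le>N. (if n < j then of_nat (j choose Suc n) * Tc f u (j - Suc n) (Suc 0) x else 0) * GG N P j x) =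
      (\<Sum>j\<in>{Suc n}. (if n < j then of_nat (j choose Suc n) * Tc f u (j - Suc n) (Suc 0) x else 0) * GG N P j x)"
      using True GG(2) by (intro sum.mono_neutral_right) auto
    then show ?thesis unfolding Dbar_GG by (simp add: GG(1) phi_c_def)
  next
    case False
    then show ?thesis unfolding Dbar_GG by (auto simp: PW_top intro!: sum.neutral)
  qed
  from Dbar_kernel[OF hol_GG depends_GG this] show "del (DW j) (GG N P n) x = 0" "del DZb (GG N P n) x = 0"
    by auto
qed

end

section \<open>The part of a solution that is linear in the fibre\<close>

abbreviation zero_fibre :: "complex \<Rightarrow> jet" where
  "zero_fibre z \<equiv> (0, z, \<lambda>_. 0)"

lemma has_derivative_wirtinger_unique:
  fixes h :: "complex \<Rightarrow> complex"
  assumes "(h has_derivative (\<lambda>v. a * v + b * cnj v)) (at z)"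
    and "(h has_derivative (\<lambda>v. a' * v + b' * cnj v)) (at z)"
  shows "a = a'" "b = b'"
proof -
  have "(\<lambda>v. a * v + b * cnj v) = (\<lambda>v. a' * v + b' * cnj v)"
    by (rule has_derivative_unique[OF assms])
  from fun_cong[OF this, of 1] fun_cong[OF this, of \<i>]
  have "a + b = a' + b'" "a - b = a' - b'" by (auto simp: complex_eq_iff)
  then show "a = a'" "b = b'" by (simp_all add: complex_eq_iff)
qed

text \<open>The z-directions are tangent to the locus u_j = 0, so an identity along it may be
  differentiated by z and zbar.\<close>

lemma del_zero_fibre:
  assumes Q: "smooth Q" and 0: "\<And>z. Q (zero_fibre z) = 0" and c: "c = DZ \<or> c = DZb"
  shows "del c Q (zero_fibre z) = 0"
proof -
  have "((\<lambda>\<zeta>. Q (zero_fibre \<zeta>)) has_derivative (\<lambda>v. 0 * v + 0 * cnj v)) (at z)"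
    by (simp add: 0)
  from has_derivative_wirtinger_unique[OF has_derivative_slice_z[OF Q] this] c
  show ?thesis by auto
qed

lemma GG_zero_fibre:
  "snd (snd x) = (\<lambda>_. 0) \<Longrightarrow> GG N P k x = del DZ (del (DW k) P) x + (if k = 0 then 0 else del (DW (k - 1)) P x)"
  by (simp add: GG_def)

lemma TT_scale:
  assumes "\<And>l. \<phi> (l + m) x = a * \<psi> l x"
  shows "TT \<phi> j (l + m) x = a * TT \<psi> j l x"
proof (induction j arbitrary: l rule: less_induct)
  case (less j)
  have "TT \<phi> i (Suc (l + m)) x = a * TT \<psi> i (Suc l) x" if "i < j" for i l
    using less[OF that, of "Suc l"] by simp
  then show ?case
    by (cases j) (auto simp: assms sum_distrib_left mult.left_commute)
qed

context potential
begin

lemma indep_1_f_f':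
  fixes X Y Z :: complex
  assumes indep: "\<nexists>\<kappa> c. \<forall>u. deriv f u = \<kappa> * f u - c"
    and eq: "\<And>u. X + of_real (f u) * Y + of_real (deriv f u) * Z = 0"
  shows "X = 0" "Y = 0" "Z = 0"
proof -
  have *: "x = 0 \<and> y = 0 \<and> z = 0" if "\<And>u. x + f u * y + deriv f u * z = 0" for x y z :: real
  proof -
    have "z = 0"
    proof (rule ccontr)
      assume "z \<noteq> 0"
      have "deriv f u = (- y / z) * f u - x / z" for u
        using that[of u] \<open>z \<noteq> 0\<close> by (simp add: field_simps)
      with indep show False by blast
    qed
    moreover have "y = 0"
    proof -
      obtain u v where "f u \<noteq> f v" using f_nonconst by blast
      moreover have "x + f u * y = 0" "x + f v * y = 0"
        using that[of u] that[of v] \<open>z = 0\<close> by simp_all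
      then have "f u * y = f v * y" by linarith
      ultimately show ?thesis by simp
    qed
    ultimately show ?thesis using that[of 0] by simp
  qed
  have "Re X + f u * Re Y + deriv f u * Re Z = 0" "Im X + f u * Im Y + deriv f u * Im Z = 0" for u
    using eq[of u] by (simp_all add: complex_eq_iff)
  from *[OF this(1)] *[OF this(2)] show "X = 0" "Y = 0" "Z = 0"
    by (simp_all add: complex_eq_iff)
qed

text \<open>The two hypotheses on f act separately: c = 0 would make f' a multiple of f, and
  \<kappa> = 0 would make f affine.\<close>

lemma dependent_consts:
  assumes dep: "\<And>u. deriv f u = \<kappa> * f u - c"
  shows "\<kappa> \<noteq> 0" "c \<noteq> 0"
proof -
  show "c \<noteq> 0"
  proof
    assume "c = 0"
    then have "(- \<kappa>) * f u + 1 * deriv f u = 0" for u using dep by simp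
    from independent[OF this] show False by simp
  qed
  show "\<kappa> \<noteq> 0"
  proof
    assume "\<kappa> = 0"
    have "(f has_real_derivative deriv f u) (at u)" for u
      using smooth_f unfolding smooth_real_def DERIV_deriv_iff_real_differentiable
      by (metis funpow_0)
    then have "((\<lambda>u. f u + c * u) has_real_derivative 0) (at u)" for u
      using dep[of u] \<open>\<kappa> = 0\<close> by (auto intro!: derivative_eq_intros)
    then have "f u + c * u = f 0 + c * 0" for u
      using DERIV_isconst_all[of "\<lambda>u. f u + c * u" u 0] by blast
    then have "f u + c * u = f 0" for u by simp
    then have "f u = (- c) * u + f 0" for u by (metis add.commute add_diff_cancel mult_minus_left uminus_add_conv_diff)
    with nonlinear show False unfolding affine_fun_def by blast
  qed
qed

end

context solution
begin

text \<open>At u_j = 0 only T^0 and its u-derivatives survive. Of f' G_{k+1} the summand f' times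
  the u_k-derivative of \<open>P\<close> cancels, leaving the z-derivative of the
  u_{k+1}-derivative.\<close>

lemma Dbar_GG_zero_fibre:
  "del DZb (GG N P k) (zero_fibre z) - of_real (f u) * del (DW 0) (GG N P k) (zero_fibre z)
     - of_real (deriv f u) * del DZ (del (DW (Suc k)) P) (zero_fibre z) = 0"
proof -
  have T0: "Tc f u j l (zero_fibre z) = (if j = 0 then of_real ((deriv ^^ l) f u) else 0)" for j l
    by (cases j) (auto simp: phi_c_def TT_Suc_at_0 simp del: TT.simps(2))
  have "Dbar f u (Suc N) (GG N P k) (zero_fibre z) =
      del DZb (GG N P k) (zero_fibre z) - of_real (f u) * del (DW 0) (GG N P k) (zero_fibre z)"
  proof -
    have "(\<Sum>j<Suc N. Tc f u j 0 (zero_fibre z) * del (DW j) (GG N P k) (zero_fibre z)) =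
       (\<Sum>j\<in>{0}. Tc f u j 0 (zero_fibre z) * del (DW j) (GG N P k) (zero_fibre z))"
      by (rule sum.mono_neutral_right) (auto simp: T0)
    then show ?thesis by (simp add: Dbar_def phi_c_def)
  qed
  moreover have "(\<Sum>j\<le>N. (if k < j then of_nat (j choose Suc k) * Tc f u (j - Suc k) (Suc 0) (zero_fibre z) else 0)
      * GG N P j (zero_fibre z)) = of_real (deriv f u) * GG N P (Suc k) (zero_fibre z)"
  proof (cases "k < N")
    case True
    have "(\<Sum>j\<le>N. (if k < j then of_nat (j choose Suc k) * Tc f u (j - Suc k) (Suc 0) (zero_fibre z) else 0)
      * GG N P j (zero_fibre z)) =
      (\<Sum>j\<in>{Suc k}. (if k < j then of_nat (j choose Suc k) * Tc f u (j - Suc k) (Suc 0) (zero_fibre z) else 0)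
      * GG N P j (zero_fibre z))"
      by (rule sum.mono_neutral_right) (use True in \<open>auto simp: T0\<close>)
    then show ?thesis by (simp add: phi_c_def)
  next
    case False
    \<comment> \<open>For k \<ge> N the sum no longer reaches the index k + 1, but G_{k+1} vanishes
      anyway.\<close>
    have "del DZ (del (DW (Suc k)) P) (zero_fibre z) = 0"
      by (rule del_fun_eq_0, rule PW_top) (use False in simp)
    moreover have "del (DW k) P (zero_fibre z) = 0" using False by (intro PW_top) simp
    ultimately have "GG N P (Suc k) (zero_fibre z) = 0" by (simp add: GG_zero_fibre)
    then show ?thesis using False by (auto intro!: sum.neutral)
  qed
  ultimately show ?thesis
    using Dbar_GG[of u k "zero_fibre z"] by (simp add: GG_zero_fibre algebra_simps)
qed

lemma independent_case:
  assumes indep: "\<nexists>\<kappa> c. \<forall>u. deriv f u = \<kappa> * f u - c"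
  shows "del DZ (del (DW (Suc k)) P) (zero_fibre z) = 0" "del DZb (del (DW k) P) (zero_fibre z) = 0"
proof -
  have *: "del DZb (GG N P k) (zero_fibre z) = 0" "del DZ (del (DW (Suc k)) P) (zero_fibre z) = 0" for k z
    using indep_1_f_f'[OF indep, of "del DZb (GG N P k) (zero_fibre z)"
        "- del (DW 0) (GG N P k) (zero_fibre z)" "- del DZ (del (DW (Suc k)) P) (zero_fibre z)"]
      Dbar_GG_zero_fibre[of k z] by simp_all
  show "del DZ (del (DW (Suc k)) P) (zero_fibre z) = 0" by (rule *)
  \<comment> \<open>This is the first summand in the zbar-derivative of G_{k+1}; as the total
    vanishes, the zbar-derivative of the u_k-derivative of \<open>P\<close> remains.\<close>
  have "del DZb (del DZ (del (DW (Suc k)) P)) (zero_fibre z) = 0"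
    by (rule del_zero_fibre) (simp_all add: *)
  then show "del DZb (del (DW k) P) (zero_fibre z) = 0"
    using *(1)[of "Suc k" z] by (simp add: del_GG del_coord)
qed

text \<open>
  If \<open>f' = \<kappa> f - c\<close>, the derivation \<open>Dbar\<close> splits into a constant part \<open>L / \<kappa>\<close> and a multiple of \<open>f'\<close>.
  \<open>L\<close> lowers the index of the coefficients \<open>B\<close>, so that the weighted sums \<open>\<Psi> k\<close> form a chain
  under \<open>L\<close>. Since \<open>c \<noteq> 0\<close>, the chain can be followed up to the order of \<open>P\<close>, where it contradicts
  \<open>Dbar_kernel\<close> unless this order is at most \<open>0\<close>.
\<close>

lemma dependent_case:
  assumes dep: "\<And>u. deriv f u = \<kappa> * f u - c"
  shows "del (DW (Suc k)) P x = 0" "del DZb (del (DW 0) P) x = 0"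
proof -
  note nz = dependent_consts[OF dep]
  \<comment> \<open>T^j for an exponential: the l-th derivative of the potential is replaced by
    \<kappa>^l. For j \<ge> 1 the true T^j is f' / \<kappa> times \<open>B j\<close>.\<close>
  define B where "B j = TT (\<lambda>l x. of_real \<kappa> ^ l) j 0" for j
  have B_shift: "TT (\<lambda>l x. of_real \<kappa> ^ l) j (Suc l) x = of_real \<kappa> * TT (\<lambda>l x. of_real \<kappa> ^ l) j l x" for j l x
    using TT_scale[of "\<lambda>l x. of_real \<kappa> ^ l" 1 x "of_real \<kappa>" "\<lambda>l x. of_real \<kappa> ^ l" j l] by simp
  have hol_B: "hol (B j)" for j
    unfolding hol_def B_def by (auto intro!: smooth_TT del_TT_eq_0)
  have B_DW: "del (DW i) (B j) x = (if i < j then of_nat (j choose Suc i) * of_real \<kappa> * B (j - Suc i) x else 0)" for i j x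
    unfolding B_def by (simp add: del_TT_DW B_shift)
  have B_DZb: "del DZb (B j) x = 0" for j x
    unfolding B_def by (auto intro!: del_TT_eq_0)
  have B0: "B 0 x = 1" and B1: "B (Suc 0) x = of_real \<kappa> * snd (snd x) 0" for x
    by (simp_all add: B_def)
  have df: "(deriv ^^ Suc l) f u = \<kappa> ^ l * deriv f u" for l u
  proof (induction l arbitrary: u)
    case (Suc l)
    have d: "(f has_real_derivative deriv f v) (at v)" for v
      using smooth_f unfolding smooth_real_def DERIV_deriv_iff_real_differentiable
      by (metis funpow_0)
    have "deriv f = (\<lambda>u. \<kappa> * f u - c)" using dep by blast
    moreover have "((\<lambda>u. \<kappa> * f u - c) has_real_derivative \<kappa> * deriv f u) (at u)"
      by (auto intro!: derivative_eq_intros d)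
    ultimately have "(deriv f has_real_derivative \<kappa> * deriv f u) (at u)" by simp
    then have "((\<lambda>u. \<kappa> ^ l * deriv f u) has_real_derivative \<kappa> ^ l * (\<kappa> * deriv f u)) (at u)"
      by (rule DERIV_cmult)
    then have "deriv (\<lambda>u. \<kappa> ^ l * deriv f u) u = \<kappa> ^ l * (\<kappa> * deriv f u)"
      by (rule DERIV_imp_deriv)
    moreover have "(deriv ^^ Suc l) f = (\<lambda>u. \<kappa> ^ l * deriv f u)" using Suc by blast
    moreover have "(deriv ^^ Suc (Suc l)) f u = deriv ((deriv ^^ Suc l) f) u" by simp
    ultimately show ?case by (simp only: power_Suc ac_simps)
  qed simp
  have T1: "Tc f u j (Suc l) x = of_real (deriv f u) * TT (\<lambda>l x. of_real \<kappa> ^ l) j l x" for u j l x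
    using TT_scale[of "phi_c f u" 1 x "of_real (deriv f u)" "\<lambda>l x. of_real \<kappa> ^ l" j l]
    by (simp add: phi_c_def df del: funpow.simps)
  have T0: "of_real \<kappa> * Tc f u j 0 x = of_real (deriv f u) * B j x + (if j = 0 then of_real c else 0)" for u j x
  proof (cases j)
    case 0
    then show ?thesis by (simp add: B_def phi_c_def dep)
  next
    case (Suc i)
    have "of_real \<kappa> * Tc f u (Suc i) 0 x = of_real (deriv f u) *
        (\<Sum>j\<le>i. of_nat (i choose j) * snd (snd x) (i - j) * (of_real \<kappa> * TT (\<lambda>l x. of_real \<kappa> ^ l) j 0 x))"
      by (simp add: T1 sum_distrib_left ac_simps)
    then show ?thesis by (simp add: Suc B_def B_shift)
  qed
  \<comment> \<open>By \<open>T0\<close>, \<kappa> times \<open>Dbar\<close> is \<open>L\<close>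
    minus f' u times the sum of \<open>B j\<close> with the u_j-derivatives. \<open>S k\<close>
    gathers everything in \<open>Dbar_GG\<close> that carries the factor f' u.\<close>
  define L where "L Q x = of_real \<kappa> * del DZb Q x - of_real c * del (DW 0) Q x" for Q x
  define S where "S k x = (\<Sum>j\<le>N. B j x * del (DW j) (GG N P k) x)
     + of_real \<kappa> * ((\<Sum>j\<le>N. (if k < j then of_nat (j choose Suc k) * B (j - Suc k) x else 0) * GG N P j x)
        - del (DW k) P x)" for k x
  have 1: "L (GG N P k) x - of_real (deriv f u) * S k x = 0" for k x u
  proof -
    have "of_real \<kappa> * Dbar f u (Suc N) (GG N P k) x = of_real \<kappa> * del DZb (GG N P k) x
       - (\<Sum>j\<le>N. of_real \<kappa> * Tc f u j 0 x * del (DW j) (GG N P k) x)"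
      unfolding Dbar_def lessThan_Suc_atMost by (simp add: right_diff_distrib sum_distrib_left mult.assoc)
    also have "(\<Sum>j\<le>N. of_real \<kappa> * Tc f u j 0 x * del (DW j) (GG N P k) x) =
       of_real (deriv f u) * (\<Sum>j\<le>N. B j x * del (DW j) (GG N P k) x)
       + (\<Sum>j\<le>N. if j = 0 then of_real c * del (DW 0) (GG N P k) x else 0)"
      unfolding T0 sum_distrib_left sum.distrib[symmetric] by (intro sum.cong) (auto simp: algebra_simps)
    also have "(\<Sum>j\<le>N. if j = 0 then of_real c * del (DW 0) (GG N P k) x else 0) = of_real c * del (DW 0) (GG N P k) x"
      by simp
    finally have "of_real \<kappa> * Dbar f u (Suc N) (GG N P k) x =
        L (GG N P k) x - of_real (deriv f u) * (\<Sum>j\<le>N. B j x * del (DW j) (GG N P k) x)"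
      by (simp add: L_def)
    moreover have "(\<Sum>j\<le>N. (if k < j then of_nat (j choose Suc k) * Tc f u (j - Suc k) (Suc 0) x else 0) * GG N P j x) =
       of_real (deriv f u) * (\<Sum>j\<le>N. (if k < j then of_nat (j choose Suc k) * B (j - Suc k) x else 0) * GG N P j x)"
      unfolding T1 B_def[symmetric] sum_distrib_left by (intro sum.cong) auto
    ultimately show ?thesis
      using Dbar_GG[of u k x] unfolding S_def by (simp add: algebra_simps)
  qed
  have LG: "L (GG N P k) x = 0" and S: "S k x = 0" for k x
  proof -
    \<comment> \<open>f' takes two different values, so the part with factor f' u and the part free
      of \<open>u\<close> vanish separately.\<close>
    obtain u v where "f u \<noteq> f v" using f_nonconst by blast
    then have "deriv f u \<noteq> deriv f v" using nz by (simp add: dep)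
    moreover have "of_real (deriv f u - deriv f v) * S k x = 0"
      using 1[of k x u] 1[of k x v] by (simp add: algebra_simps)
    ultimately show "S k x = 0" by simp
    with 1[of k x u] show "L (GG N P k) x = 0" by simp
  qed
  have L_add: "L (\<lambda>x. Q x + R x) x = L Q x + L R x" if "smooth Q" "smooth R" for Q R x
    using that by (simp add: L_def del_add algebra_simps)
  have L_mult: "L (\<lambda>x. Q x * R x) x = L Q x * R x + Q x * L R x" if "smooth Q" "smooth R" for Q R x
    using that by (simp add: L_def del_mult algebra_simps)
  have L_sum: "L (\<lambda>x. \<Sum>i\<in>A. Q i x) x = (\<Sum>i\<in>A. L (Q i) x)" if "finite A" "\<And>i. smooth (Q i)" for A Q x
    using that by (simp add: L_def del_sum sum_subtractf sum_distrib_left)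
  have L_const: "L (\<lambda>x. a) x = 0" for a x by (simp add: L_def)
  have L_del: "L (del d Q) x = del d (L Q) x" if "smooth Q" for d Q x
    unfolding L_def[abs_def] using that
    by (simp add: del_diff del_mult del_commute[of Q d])
  have L_zero: "L Q x = 0" if "\<And>x. Q x = 0" for Q x
    using that by (simp add: L_def del_fun_eq_0)
  \<comment> \<open>Descending induction through L G_{k+1} = 0: \<open>L\<close> kills the
    coordinates u_{i+1} and commutes with derivatives, so only its value on the last summand of
    G_{k+1} is left.\<close>
  have LP: "L (del (DW k) P) x = 0" for k x
  proof (induction "N - k" arbitrary: k x rule: less_induct)
    case less
    show ?case
    proof (cases "k < N")
      case False
      then show ?thesis by (intro L_zero PW_top) simp
    next
      case True
      have IH: "L (del (DW (Suc k)) P) x = 0" for x using less True by simp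
      have "L (snd_coord) x = 0" if "snd_coord = (\<lambda>x. snd (snd x) (Suc i))" for snd_coord i x
        unfolding L_def that by (simp add: del_coord)
      then have "L (GG N P (Suc k)) x = L (del DZ (del (DW (Suc k)) P)) x
          + (\<Sum>i<N. snd (snd x) (Suc i) * L (del (DW i) (del (DW (Suc k)) P)) x) + L (del (DW k) P) x"
        unfolding GG_def[abs_def] by (simp add: L_add L_sum L_mult)
      then show ?thesis
        using LG by (simp add: L_del del_fun_eq_0[of "L (del (DW (Suc k)) P)", OF IH])
    qed
  qed
  \<comment> \<open>\<open>\<Psi> 0\<close> is the sum of \<open>B j\<close> times G_j; the others
    are, up to nonzero factors, its images under powers of \<open>L\<close> (see
    \<open>L_Psi\<close>), since \<open>L\<close> kills every G_j.\<close>
  define \<Psi> where "\<Psi> k x = (\<Sum>j\<le>N. of_nat (j choose k) * B (j - k) x * GG N P j x)" for k x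
  have smooth_Psi: "smooth (\<Psi> k)" for k
    unfolding \<Psi>_def[abs_def] using hol_B by simp
  have smooth_L: "smooth (L Q)" if "smooth Q" for Q
    unfolding L_def[abs_def] using that by simp
  have Psi0: "del (DW i) (\<Psi> 0) x = of_real \<kappa> * del (DW i) P x" for i x
  proof -
    have "del (DW i) (\<Psi> 0) x = (\<Sum>j\<le>N. del (DW i) (B j) x * GG N P j x)
        + (\<Sum>j\<le>N. B j x * del (DW j) (GG N P i) x)"
      unfolding \<Psi>_def[abs_def] using hol_B
      by (simp add: del_sum del_mult sum.distrib del_DW_GG_commute[of i])
    also have "(\<Sum>j\<le>N. del (DW i) (B j) x * GG N P j x) =
       of_real \<kappa> * (\<Sum>j\<le>N. (if i < j then of_nat (j choose Suc i) * B (j - Suc i) x else 0) * GG N P j x)"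
      unfolding sum_distrib_left by (rule sum.cong) (auto simp: B_DW)
    finally show ?thesis using S[of i x] by (simp add: S_def algebra_simps)
  qed
  have L_Psi: "L (\<Psi> k) x = - of_real c * of_real \<kappa> * of_nat (Suc k) * \<Psi> (Suc k) x" for k x
  proof -
    have LB: "L (B j) x = (if j = 0 then 0 else - of_real c * of_real \<kappa> * of_nat j * B (j - 1) x)" for j
      by (simp add: L_def B_DW B_DZb)
    have "L (\<Psi> k) x = (\<Sum>j\<le>N. of_nat (j choose k) * L (B (j - k)) x * GG N P j x)"
      unfolding \<Psi>_def[abs_def] using hol_B
      by (simp add: L_sum L_mult L_const LG)
    also have "\<dots> = (\<Sum>j\<le>N. - of_real c * of_real \<kappa> * of_nat (Suc k) * (of_nat (j choose Suc k) * B (j - Suc k) x * GG N P j x))"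
    proof (rule sum.cong)
      fix j
      show "of_nat (j choose k) * L (B (j - k)) x * GG N P j x =
        - of_real c * of_real \<kappa> * of_nat (Suc k) * (of_nat (j choose Suc k) * B (j - Suc k) x * GG N P j x)"
      proof (cases "k < j")
        case True
        have "(j - k) * (j choose k) = Suc k * (j choose Suc k)"
          using binomial_absorb_comp[of j k] binomial_absorption[of k j] True
          by (metis binomial_absorb_comp Suc_diff_Suc)
        then have eq: "(of_nat (j choose k) * of_nat (j - k) :: complex) = of_nat (Suc k) * of_nat (j choose Suc k)"
          by (metis mult.commute of_nat_mult)
        have "of_nat (j choose k) * L (B (j - k)) x * GG N P j x =
          - of_real c * of_real \<kappa> * ((of_nat (j choose k) * of_nat (j - k)) * B (j - Suc k) x * GG N P j x)"
          using True unfolding LB by (simp del: of_nat_Suc of_nat_diff)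
        then show ?thesis unfolding eq by (simp only: mult.assoc)
      qed (simp add: LB)
    qed simp
    also have "\<dots> = - of_real c * of_real \<kappa> * of_nat (Suc k) * \<Psi> (Suc k) x"
      unfolding \<Psi>_def sum_distrib_left ..
    finally show ?thesis .
  qed
  have Psi_step: "del (DW i) (\<Psi> (Suc k)) x = 0" if 0: "\<And>x. L (del (DW i) (\<Psi> k)) x = 0" for i k x
  proof -
    have "del (DW i) (L (\<Psi> k)) x = 0" using 0 by (simp add: L_del[OF smooth_Psi, symmetric])
    then have "- of_real c * of_real \<kappa> * of_nat (Suc k) * del (DW i) (\<Psi> (Suc k)) x = 0"
      unfolding L_Psi[abs_def] by (simp only: del_cmult smooth_Psi)
    then show ?thesis using nz by (simp del: of_nat_Suc)
  qed
  have Psi: "del (DW i) (\<Psi> (Suc k)) x = 0" for i k x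
  proof (induction k arbitrary: x)
    case 0
    have "L (del (DW i) (\<Psi> 0)) x = 0" for x
      unfolding Psi0[abs_def] by (simp add: L_mult L_const LP)
    then show ?case by (rule Psi_step)
  next
    case (Suc k)
    have "L (del (DW i) (\<Psi> (Suc k))) x = 0" for x by (rule L_zero) (rule Suc)
    then show ?case by (rule Psi_step)
  qed
  \<comment> \<open>If the order is n + 1, only j = n + 1 and j = n + 2 contribute to
    \<open>\<Psi> (Suc n)\<close>. By \<open>top_order\<close> its sole dependence on u_0 is the
    explicit factor in \<open>B 1\<close>, which forces the leading coefficient to vanish. The index
    is a successor because the fibre derivatives of \<open>\<Psi> k\<close> are known to vanish only
    for k \<ge> 1.\<close>
  have step: "del (DW (Suc n)) P x = 0" if top: "\<And>j x. j > Suc n \<Longrightarrow> del (DW j) P x = 0" for n x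
  proof (cases "Suc n < N")
    case False
    then show ?thesis by (intro PW_top) simp
  next
    case True
    note GG = GG_above[of "Suc n", OF top]
    note Gtop = top_order[of "Suc n", OF top]
    have "\<Psi> (Suc n) x = GG N P (Suc n) x + of_nat (Suc (Suc n)) * of_real \<kappa> * (snd (snd x) 0 * del (DW (Suc n)) P x)" for x
    proof -
      have "\<Psi> (Suc n) x = (\<Sum>j\<in>{Suc n, Suc (Suc n)}. of_nat (j choose Suc n) * B (j - Suc n) x * GG N P j x)"
        unfolding \<Psi>_def
      proof (rule sum.mono_neutral_right)
        show "\<forall>i\<in>{..N} - {Suc n, Suc (Suc n)}. of_nat (i choose Suc n) * B (i - Suc n) x * GG N P i x = 0"
        proof
          fix i assume "i \<in> {..N} - {Suc n, Suc (Suc n)}"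
          then have "i < Suc n \<or> i > Suc (Suc n)" by auto
          then show "of_nat (i choose Suc n) * B (i - Suc n) x * GG N P i x = 0"
            by (elim disjE) (simp_all add: GG(2))
        qed
      qed (use True in auto)
      then show ?thesis by (simp add: B0 B1 GG(1) Suc_diff_le del: of_nat_Suc)
    qed
    then have "\<Psi> (Suc n) = (\<lambda>x. GG N P (Suc n) x + of_nat (Suc (Suc n)) * of_real \<kappa> * (snd (snd x) 0 * del (DW (Suc n)) P x))"
      by blast
    then have "0 = del (DW 0) (\<lambda>x. GG N P (Suc n) x + of_nat (Suc (Suc n)) * of_real \<kappa> * (snd (snd x) 0 * del (DW (Suc n)) P x)) x"
      using Psi[of 0 n x] by simp
    also have "\<dots> = of_nat (Suc (Suc n)) * of_real \<kappa> * del (DW (Suc n)) P x"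
      by (simp add: del_add del_mult del_coord Gtop del: of_nat_Suc)
    finally show ?thesis using nz by (simp del: of_nat_Suc)
  qed
  have PW: "del (DW (Suc k)) P x = 0" for k x
  proof (induction "N - k" arbitrary: k x rule: less_induct)
    case less
    show ?case
    proof (rule step)
      fix j x assume j: "j > Suc k"
      then obtain m where m: "j = Suc m" "m > k" by (cases j) auto
      show "del (DW j) P x = 0"
      proof (cases "m < N")
        case True then show ?thesis using less[of m x] m by simp
      next
        case False then show ?thesis using m by (intro PW_top) simp
      qed
    qed
  qed
  show "del (DW (Suc k)) P x = 0" by (rule PW)
  have "del (DW j) P x = 0" if "j > 0" for j x using PW that by (cases j) auto
  from top_order(2)[of 0, OF this] show "del DZb (del (DW 0) P) x = 0" .
qed

text \<open>The z-derivative of the u_0-coefficient is absent here; it is tied to its conjugate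
  counterpart in \<open>constant_part\<close> and settled by weight later.\<close>

proposition linear_part:
  "del DZb (del (DW k) P) (zero_fibre z) = 0"
  "del DZ (del (DW (Suc k)) P) (zero_fibre z) = 0"
proof -
  have "del DZb (del (DW k) P) (zero_fibre z) = 0 \<and> del DZ (del (DW (Suc k)) P) (zero_fibre z) = 0"
  proof (cases "\<exists>\<kappa> c. \<forall>u. deriv f u = \<kappa> * f u - c")
    case False
    then show ?thesis using independent_case by blast
  next
    case True
    then obtain \<kappa> c where dep: "\<And>u. deriv f u = \<kappa> * f u - c" by blast
    note D = dependent_case[OF dep]
    have "del c (del (DW (Suc k)) P) x = 0" for c k x by (rule del_fun_eq_0) (rule D)
    then show ?thesis using D(2) by (cases k) auto
  qed
  then show "del DZb (del (DW k) P) (zero_fibre z) = 0"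
    "del DZ (del (DW (Suc k)) P) (zero_fibre z) = 0" by auto
qed

end

section \<open>Weights and polynomials\<close>

lemma norm_1_cnj: "cmod l = 1 \<Longrightarrow> cnj l = inverse l"
  by (metis complex_div_cnj complex_norm_square div_by_1 inverse_eq_divide mult.left_neutral nonzero_eq_divide_eq
      norm_one of_real_1 one_power2 zero_neq_one complex_cnj_divide complex_cnj_one)

lemma power_int_sub_nat:
  fixes l :: complex
  assumes "l \<noteq> 0" "l ^ n * a = l powi d * b"
  shows "a = l powi (d - int n) * b"
  using assms by (simp add: power_int_diff field_simps)

lemma power_int_add_nat:
  fixes l :: complex
  assumes "l \<noteq> 0" "inverse l ^ n * a = l powi d * b"
  shows "a = l powi (d + int n) * b"
  using assms by (simp add: power_int_add field_simps)

text \<open>Both sides of the weight identity are differentiated as functions of the single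
  coordinate u_i, and their Wirtinger coefficients are compared. For |l| = 1 the conjugate of l is
  its inverse, hence the opposite shift for the conjugate coordinate.\<close>

lemma weighted_del_w:
  assumes P: "smooth P" and d: "weighted_degree d P"
  shows "weighted_degree (d - int (Suc i)) (del (DW i) P)"
    and "weighted_degree (d + int (Suc i)) (del (DWb i) P)"
proof -
  have "del (DW i) P (u, inverse l * z, \<lambda>j. l ^ (j + 1) * w j) = l powi (d - int (Suc i)) * del (DW i) P (u, z, w) \<and>
     del (DWb i) P (u, inverse l * z, \<lambda>j. l ^ (j + 1) * w j) = l powi (d + int (Suc i)) * del (DWb i) P (u, z, w)"
    if l: "cmod l = 1" for l u z w
  proof -
    have l0: "l \<noteq> 0" using l by auto
    define w' where "w' = (\<lambda>j. l ^ (j + 1) * w j)"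
    let ?A = "del (DW i) P (u, inverse l * z, w')" and ?B = "del (DWb i) P (u, inverse l * z, w')"
    have eq: "P (u, inverse l * z, w'(i := l ^ Suc i * \<zeta>)) = l powi d * P (u, z, w(i := \<zeta>))" for \<zeta>
    proof -
      have "w'(i := l ^ Suc i * \<zeta>) = (\<lambda>j. l ^ (j + 1) * (w(i := \<zeta>)) j)"
        by (auto simp: w'_def)
      then show ?thesis using d l unfolding weighted_degree_def by metis
    qed
    have w'i: "w'(i := l ^ Suc i * w i) = w'" by (auto simp: w'_def)
    have "((\<lambda>\<zeta>. P (u, inverse l * z, w'(i := \<zeta>))) has_derivative (\<lambda>v. ?A * v + ?B * cnj v)) (at (l ^ Suc i * w i))"
      using has_derivative_slice_w[OF P, of u "inverse l * z" w' i "l ^ Suc i * w i"] w'i by simp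
    moreover have "((\<lambda>\<zeta>. l ^ Suc i * \<zeta>) has_derivative (\<lambda>v. l ^ Suc i * v)) (at (w i))"
      by (auto intro!: derivative_eq_intros)
    ultimately have "((\<lambda>\<zeta>. P (u, inverse l * z, w'(i := l ^ Suc i * \<zeta>))) has_derivative
        (\<lambda>v. ?A * (l ^ Suc i * v) + ?B * cnj (l ^ Suc i * v))) (at (w i))"
      by (rule has_derivative_compose[rotated])
    then have 1: "((\<lambda>\<zeta>. l powi d * P (u, z, w(i := \<zeta>))) has_derivative
        (\<lambda>v. (l ^ Suc i * ?A) * v + (inverse l ^ Suc i * ?B) * cnj v)) (at (w i))"
      unfolding eq by (simp add: norm_1_cnj[OF l] ac_simps)
    have "((\<lambda>\<zeta>. P (u, z, w(i := \<zeta>))) has_derivative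
        (\<lambda>v. del (DW i) P (u, z, w) * v + del (DWb i) P (u, z, w) * cnj v)) (at (w i))"
      using has_derivative_slice_w[OF P, of u z w i "w i"] by simp
    then have "((\<lambda>\<zeta>. l powi d * P (u, z, w(i := \<zeta>))) has_derivative
        (\<lambda>v. l powi d * (del (DW i) P (u, z, w) * v + del (DWb i) P (u, z, w) * cnj v))) (at (w i))"
      by (rule has_derivative_mult_right)
    then have 2: "((\<lambda>\<zeta>. l powi d * P (u, z, w(i := \<zeta>))) has_derivative
        (\<lambda>v. (l powi d * del (DW i) P (u, z, w)) * v + (l powi d * del (DWb i) P (u, z, w)) * cnj v)) (at (w i))"
      by (simp add: algebra_simps)
    have "?A = l powi (d - int (Suc i)) * del (DW i) P (u, z, w)"
      by (rule power_int_sub_nat[OF l0 has_derivative_wirtinger_unique(1)[OF 1 2]])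
    moreover have "?B = l powi (d + int (Suc i)) * del (DWb i) P (u, z, w)"
      by (rule power_int_add_nat[OF l0 has_derivative_wirtinger_unique(2)[OF 1 2]])
    ultimately show ?thesis by (simp add: w'_def)
  qed
  then show "weighted_degree (d - int (Suc i)) (del (DW i) P)"
    "weighted_degree (d + int (Suc i)) (del (DWb i) P)"
    unfolding weighted_degree_def by blast+
qed

lemma weighted_del_z:
  assumes P: "smooth P" and d: "weighted_degree d P"
  shows "weighted_degree (d + 1) (del DZ P)"
  unfolding weighted_degree_def
proof (intro allI impI)
  fix l u z w
  assume l: "cmod l = 1"
  then have l0: "l \<noteq> 0" by auto
  define w' where "w' = (\<lambda>j. l ^ (j + 1) * w j)"
  let ?A = "del DZ P (u, inverse l * z, w')" and ?B = "del DZb P (u, inverse l * z, w')"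
  have eq: "P (u, inverse l * \<zeta>, w') = l powi d * P (u, \<zeta>, w)" for \<zeta>
    using d l unfolding weighted_degree_def w'_def by metis
  have "((\<lambda>\<zeta>. inverse l * \<zeta>) has_derivative (\<lambda>v. inverse l * v)) (at z)"
    by (auto intro!: derivative_eq_intros)
  from has_derivative_compose[OF this has_derivative_slice_z[OF P, of u w' "inverse l * z"]]
  have 1: "((\<lambda>\<zeta>. l powi d * P (u, \<zeta>, w)) has_derivative
        (\<lambda>v. (inverse l ^ 1 * ?A) * v + (l * ?B) * cnj v)) (at z)"
    unfolding eq using l0 by (simp add: norm_1_cnj[OF l] ac_simps)
  have "((\<lambda>\<zeta>. l powi d * P (u, \<zeta>, w)) has_derivative
        (\<lambda>v. l powi d * (del DZ P (u, z, w) * v + del DZb P (u, z, w) * cnj v))) (at z)"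
    by (rule has_derivative_mult_right[OF has_derivative_slice_z[OF P]])
  then have 2: "((\<lambda>\<zeta>. l powi d * P (u, \<zeta>, w)) has_derivative
        (\<lambda>v. (l powi d * del DZ P (u, z, w)) * v + (l powi d * del DZb P (u, z, w)) * cnj v)) (at z)"
    by (simp add: algebra_simps)
  have "?A = l powi (d + int 1) * del DZ P (u, z, w)"
    by (rule power_int_add_nat[OF l0 has_derivative_wirtinger_unique(1)[OF 1 2]])
  then show "del DZ P (u, inverse l * z, \<lambda>j. l ^ (j + 1) * w j) = l powi (d + 1) * del DZ P (u, z, w)"
    by (simp add: w'_def)
qed

lemma weight_origin:
  assumes "weighted_degree e Q" "e \<noteq> 0"
  shows "Q (zero_fibre 0) = 0"
proof -
  \<comment> \<open>The rotations fix the origin; this one satisfies l^e = -1, so the value there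
    equals its negative.\<close>
  define l where "l = cis (pi / of_int e)"
  have "l powi e = - 1" using assms(2) by (simp add: l_def cis_power_int)
  moreover have "cmod l = 1" by (simp add: l_def)
  moreover have "Q (0, inverse l * 0, \<lambda>j. l ^ (j + 1) * 0) = l powi e * Q (0, 0, \<lambda>_. 0)" if "cmod l = 1" for l
    using assms(1)[unfolded weighted_degree_def, rule_format, OF that, of 0 0 "\<lambda>_. 0"] by simp
  ultimately show ?thesis by force
qed

lemma zero_fibre_const:
  assumes Q: "smooth Q" "\<And>z. del DZ Q (zero_fibre z) = 0" "\<And>z. del DZb Q (zero_fibre z) = 0"
  shows "Q (zero_fibre z) = Q (zero_fibre z')"
  by (rule const_of_has_derivative_0[of "\<lambda>z. Q (zero_fibre z)"])
     (use has_derivative_slice_z[OF Q(1), of 0 "\<lambda>_. 0"] Q(2,3) in simp)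

lemma zero_fibre_weight:
  assumes "smooth Q" "\<And>z. del DZ Q (zero_fibre z) = 0" "\<And>z. del DZb Q (zero_fibre z) = 0"
    and "weighted_degree e Q" "e \<noteq> 0"
  shows "Q (zero_fibre z) = 0"
  using zero_fibre_const[OF assms(1-3), of z 0] weight_origin[OF assms(4,5)] by simp

lemma wpoly_power: "wpoly (l * Suc k) (\<lambda>w. w k ^ l)"
proof (induction l)
  case (Suc l)
  then show ?case using wpoly.coord_mult[OF Suc, of k] by (simp add: ac_simps)
qed (simp add: wpoly.const)

lemma wpoly_cnj: "wpoly n p \<Longrightarrow> wpoly n (\<lambda>w. cnj (p (\<lambda>j. cnj (w j))))"
proof (induction rule: wpoly.induct)
  case (coord_mult n p j)
  show ?case using wpoly.coord_mult[OF coord_mult.IH, of j] by simp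
qed (simp_all add: wpoly.const wpoly.add)

section \<open>Passage from \<open>wpoly\<close> to the polynomials \<open>cpoly\<close>\<close>

definition monom_eval :: "(nat \<Rightarrow>\<^sub>0 nat) \<Rightarrow> (nat \<Rightarrow> complex) \<Rightarrow> complex" where
  "monom_eval \<alpha> v = (\<Prod>j \<in> Poly_Mapping.keys \<alpha>. v j ^ Poly_Mapping.lookup \<alpha> j)"

lemma monom_eval_superset:
  assumes "finite S" "Poly_Mapping.keys \<alpha> \<subseteq> S"
  shows "monom_eval \<alpha> v = (\<Prod>j\<in>S. v j ^ Poly_Mapping.lookup \<alpha> j)"
  unfolding monom_eval_def using assms
  by (intro prod.mono_neutral_left) (auto simp: in_keys_iff)

lemma monom_eval_add: "monom_eval (\<alpha> + \<beta>) v = monom_eval \<alpha> v * monom_eval \<beta> v"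
proof -
  define S where "S = Poly_Mapping.keys \<alpha> \<union> Poly_Mapping.keys \<beta>"
  have "finite S" "Poly_Mapping.keys \<alpha> \<subseteq> S" "Poly_Mapping.keys \<beta> \<subseteq> S" "Poly_Mapping.keys (\<alpha> + \<beta>) \<subseteq> S"
    using Poly_Mapping.keys_add[of \<alpha> \<beta>] by (auto simp: S_def)
  then show ?thesis
    by (simp add: monom_eval_superset[of S] lookup_add power_add prod.distrib)
qed

lemma monom_eval_single: "monom_eval (Poly_Mapping.single j 1) v = v j"
  by (simp add: monom_eval_def)

lemma poly_eval_superset:
  assumes "finite S" "Poly_Mapping.keys q \<subseteq> S"
  shows "poly_eval q v = (\<Sum>\<alpha>\<in>S. Poly_Mapping.lookup q \<alpha> * monom_eval \<alpha> v)"
  unfolding poly_eval_def monom_eval_def[symmetric] using assms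
  by (intro sum.mono_neutral_left) (auto simp: in_keys_iff)

lemma poly_eval_add: "poly_eval (p + q) v = poly_eval p v + poly_eval q v"
proof -
  define S where "S = Poly_Mapping.keys p \<union> Poly_Mapping.keys q"
  have "finite S" "Poly_Mapping.keys p \<subseteq> S" "Poly_Mapping.keys q \<subseteq> S" "Poly_Mapping.keys (p + q) \<subseteq> S"
    using Poly_Mapping.keys_add[of p q] by (auto simp: S_def)
  then show ?thesis
    by (simp add: poly_eval_superset[of S] lookup_add distrib_right sum.distrib)
qed

lemma poly_eval_single: "poly_eval (Poly_Mapping.single \<alpha> c) v = c * monom_eval \<alpha> v"
  by (simp add: poly_eval_def monom_eval_def)

lemma poly_vars_add: "poly_vars (p + q) \<subseteq> poly_vars p \<union> poly_vars q"
  unfolding poly_vars_def using Poly_Mapping.keys_add[of p q] by blast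

lemma poly_eval_cong:
  assumes "\<And>j. j \<in> poly_vars q \<Longrightarrow> v j = v' j"
  shows "poly_eval q v = poly_eval q v'"
  unfolding poly_eval_def
  by (intro sum.cong prod.cong arg_cong2[where f = "(*)"] arg_cong2[where f = "(^)"] refl assms)
     (auto simp: poly_vars_def)

lemma poly_eval_coord_mult:
  "\<exists>q'. poly_vars q' \<subseteq> insert j (poly_vars q) \<and> (\<forall>v. poly_eval q' v = v j * poly_eval q v)"
proof -
  have "\<exists>q'. poly_vars q' \<subseteq> insert j (poly_vars q) \<and>
      (\<forall>v. poly_eval q' v = v j * (\<Sum>\<alpha>\<in>S. Poly_Mapping.lookup q \<alpha> * monom_eval \<alpha> v))"
    if "finite S" "S \<subseteq> Poly_Mapping.keys q" for S
    using that
  proof (induction S rule: finite_induct)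
    case empty
    show ?case by (rule exI[of _ 0]) (simp add: poly_vars_def poly_eval_def)
  next
    case (insert \<alpha> S)
    then obtain q' where q': "poly_vars q' \<subseteq> insert j (poly_vars q)"
      "\<And>v. poly_eval q' v = v j * (\<Sum>\<alpha>\<in>S. Poly_Mapping.lookup q \<alpha> * monom_eval \<alpha> v)" by auto
    define r where "r = Poly_Mapping.single (\<alpha> + Poly_Mapping.single j 1) (Poly_Mapping.lookup q \<alpha>)"
    have "Poly_Mapping.keys (\<alpha> + Poly_Mapping.single j (1::nat)) \<subseteq> insert j (Poly_Mapping.keys \<alpha>)"
      using Poly_Mapping.keys_add[of \<alpha> "Poly_Mapping.single j (1::nat)"] by auto
    then have "poly_vars r \<subseteq> insert j (poly_vars q)"
      using insert.prems unfolding poly_vars_def r_def by (auto split: if_splits)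
    then have "poly_vars (r + q') \<subseteq> insert j (poly_vars q)"
      using q'(1) poly_vars_add[of r q'] by blast
    moreover have "poly_eval (r + q') v = v j * (\<Sum>\<alpha>\<in>insert \<alpha> S. Poly_Mapping.lookup q \<alpha> * monom_eval \<alpha> v)" for v
      using insert.hyps
      by (simp add: poly_eval_add q'(2) r_def poly_eval_single monom_eval_add monom_eval_single algebra_simps
          del: One_nat_def)
    ultimately show ?case by blast
  qed
  from this[of "Poly_Mapping.keys q"] show ?thesis by (simp add: poly_eval_def monom_eval_def)
qed

text \<open>A variable u_j with j \<ge> n would by itself exceed the total weight n.\<close>

lemma wpoly_poly_eval:
  assumes "wpoly n p"
  shows "\<exists>q. poly_vars q \<subseteq> {..<n} \<and> (\<forall>v. p v = poly_eval q v)"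
  using assms
proof (induction rule: wpoly.induct)
  case (const a)
  show ?case
    by (rule exI[of _ "Poly_Mapping.single 0 a"]) (auto simp: poly_vars_def poly_eval_single monom_eval_def split: if_splits)
next
  case (add n p p')
  then obtain q q' where "poly_vars q \<subseteq> {..<n}" "\<And>v. p v = poly_eval q v"
    "poly_vars q' \<subseteq> {..<n}" "\<And>v. p' v = poly_eval q' v" by auto
  then show ?case
    using poly_vars_add[of q q'] by (intro exI[of _ "q + q'"]) (auto simp: poly_eval_add)
next
  case (coord_mult n p j)
  then obtain q where q: "poly_vars q \<subseteq> {..<n}" "\<And>v. p v = poly_eval q v" by auto
  obtain q' where "poly_vars q' \<subseteq> insert j (poly_vars q)" "\<And>v. poly_eval q' v = v j * poly_eval q v"
    using poly_eval_coord_mult by metis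
  then show ?case using q by (intro exI[of _ q']) fastforce
qed

text \<open>u_m alone already has weight m + 1, so in this weight it occurs only linearly with a
  constant coefficient. In the product case this is n = 0.\<close>

lemma wpoly_lead:
  assumes "wpoly (Suc m) p"
  shows "\<exists>b q. poly_vars q \<subseteq> {..<m} \<and> (\<forall>v. p v = b * v m + poly_eval q v)"
proof -
  have "\<exists>b q. poly_vars q \<subseteq> {..<m} \<and> (\<forall>v. p v = b * v m + poly_eval q v)" if "wpoly n p" "n = Suc m" for n
    using that
  proof (induction rule: wpoly.induct)
    case (add n p p')
    then obtain b b' q q' where "poly_vars q \<subseteq> {..<m}" "\<And>v. p v = b * v m + poly_eval q v"
      "poly_vars q' \<subseteq> {..<m}" "\<And>v. p' v = b' * v m + poly_eval q' v" by metis
    then show ?case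
      using poly_vars_add[of q q']
      by (intro exI[of _ "b + b'"] exI[of _ "q + q'"]) (auto simp: poly_eval_add algebra_simps)
  next
    case (coord_mult n p j)
    show ?case
    proof (cases "n = 0")
      case True
      then obtain a where "\<forall>w. p w = a" using coord_mult(1) wpoly_0D by blast
      then show ?thesis using True coord_mult(3)
        by (intro exI[of _ a] exI[of _ 0]) (simp add: poly_vars_def poly_eval_def mult.commute)
    next
      case False
      obtain q where q: "poly_vars q \<subseteq> {..<n}" "\<And>v. p v = poly_eval q v"
        using wpoly_poly_eval[OF coord_mult(1)] by auto
      obtain q' where "poly_vars q' \<subseteq> insert j (poly_vars q)" "\<And>v. poly_eval q' v = v j * poly_eval q v"
        using poly_eval_coord_mult by metis
      then show ?thesis using q False coord_mult(3)
        by (intro exI[of _ 0] exI[of _ q']) fastforce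
    qed
  qed simp
  with assms show ?thesis by blast
qed

text \<open>Functions about to be shown polynomial. The weight is an integer, since differentiation
  can push it below 0, where only the zero function is left.\<close>

definition homogeneous :: "int \<Rightarrow> (jet \<Rightarrow> complex) \<Rightarrow> bool" where
  "homogeneous e P \<longleftrightarrow> hol P \<and> (\<forall>x. del DZ P x = 0) \<and> (\<forall>x. del DZb P x = 0) \<and> weighted_degree e P"

lemma homogeneous_del:
  assumes "homogeneous e P"
  shows "homogeneous (e - int (Suc i)) (del (DW i) P)"
proof -
  have P: "hol P" "\<And>x. del DZ P x = 0" "\<And>x. del DZb P x = 0" "weighted_degree e P"
    using assms unfolding homogeneous_def by auto
  have "del DZ (del (DW i) P) x = 0" for x
    unfolding del_commute[OF hol_smooth[OF P(1)], of DZ] by (rule del_fun_eq_0) (rule P)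
  moreover have "del DZb (del (DW i) P) x = 0" for x
    unfolding del_commute[OF hol_smooth[OF P(1)], of DZb] by (rule del_fun_eq_0) (rule P)
  ultimately show ?thesis
    unfolding homogeneous_def using P hol_del weighted_del_w(1) by auto
qed

lemma homogeneous_funpow:
  "homogeneous e P \<Longrightarrow> homogeneous (e - int l * int (Suc k)) ((del (DW k) ^^ l) P)"
proof (induction l)
  case (Suc l)
  from homogeneous_del[OF Suc.IH[OF Suc.prems], of k] show ?case by (simp add: algebra_simps)
qed simp

text \<open>
  Taylor expansion in one coordinate at a time: the weight bounds the degree in that coordinate,
  and the Taylor coefficients are homogeneous functions on the subspace where it vanishes.
\<close>

lemma homogeneous_wpoly_below:
  assumes "homogeneous e P"
  shows "\<exists>p. (if e \<ge> 0 then wpoly (nat e) p else p = (\<lambda>_. 0)) \<and> (\<forall>w. (\<forall>j\<ge>k. w j = 0) \<longrightarrow> P (0, 0, w) = p w)"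
  using assms
proof (induction k arbitrary: e P)
  case 0
  have *: "w = (\<lambda>_. 0)" if "\<forall>j\<ge>0. w j = 0" for w :: "nat \<Rightarrow> complex" using that by auto
  show ?case
  proof (cases "e = 0")
    case True
    then show ?thesis
      by (intro exI[of _ "\<lambda>_. P (zero_fibre 0)"]) (auto simp: wpoly.const dest!: *)
  next
    case False
    then have "P (zero_fibre 0) = 0" using 0 weight_origin unfolding homogeneous_def by blast
    then show ?thesis
      by (intro exI[of _ "\<lambda>_. 0"]) (auto simp: wpoly_zero dest!: *)
  qed
next
  case (Suc k)
  define D where "D l = (del (DW k) ^^ l) P" for l
  have hD: "homogeneous (e - int l * int (Suc k)) (D l)" for l
    unfolding D_def by (rule homogeneous_funpow[OF Suc.prems])
  have holD: "hol (D l)" for l using hD unfolding homogeneous_def by blast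
  obtain p where p: "\<And>l. if e - int l * int (Suc k) \<ge> 0 then wpoly (nat (e - int l * int (Suc k))) (p l) else p l = (\<lambda>_. 0)"
      "\<And>l w. (\<forall>j\<ge>k. w j = 0) \<Longrightarrow> D l (0, 0, w) = p l w"
    using Suc.IH[OF hD] by metis
  \<comment> \<open>For l > e the weight e - l(k+1) is negative, so the Taylor coefficient vanishes
    and the series stops before L.\<close>
  define L where "L = Suc (nat e)"
  have neg: "p l = (\<lambda>_. 0)" if "l \<ge> L" for l
  proof -
    have "int l * 1 \<le> int l * int (Suc k)" by (rule mult_left_mono) simp_all
    moreover have "e < int l" using that unfolding L_def by linarith
    ultimately have "e - int l * int (Suc k) < 0" by linarith
    then show ?thesis using p(1)[of l] by simp
  qed
  define q where "q w = (\<Sum>l<L. (1 / fact l) * (p l (w(k := 0)) * w k ^ l))" for w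
  have "P (0, 0, w) = q w" if w: "\<forall>j\<ge>Suc k. w j = 0" for w
  proof -
    define h where "h l \<zeta> = D l (0, 0, w(k := \<zeta>))" for l \<zeta>
    have deriv_h: "(h l has_field_derivative h (Suc l) \<zeta>) (at \<zeta>)" for l \<zeta>
      using has_derivative_slice_w[of "D l" 0 0 w k \<zeta>] holD[of l]
      by (simp add: has_field_derivative_def h_def[abs_def] D_def)
    then have "deriv (h l) = h (Suc l)" for l using DERIV_imp_deriv by blast
    then have iter: "(deriv ^^ l) (h 0) = h l" for l by (induction l) auto
    have "h 0 holomorphic_on ball 0 (norm (w k) + 1)"
      unfolding holomorphic_on_def field_differentiable_def
      using deriv_h has_field_derivative_at_within by blast
    from holomorphic_power_series[OF this, of "w k"]
    have "(\<lambda>l. h l 0 / fact l * w k ^ l) sums h 0 (w k)" by (simp add: iter)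
    moreover have hl: "h l 0 = p l (w(k := 0))" for l
      unfolding h_def using w by (intro p(2)) (auto simp: le_Suc_eq Suc_le_eq)
    have "(\<lambda>l. h l 0 / fact l * w k ^ l) sums (\<Sum>l<L. h l 0 / fact l * w k ^ l)"
      by (rule sums_finite) (auto simp: hl neg)
    ultimately have "h 0 (w k) = (\<Sum>l<L. h l 0 / fact l * w k ^ l)" using sums_unique2 by blast
    then show ?thesis by (simp add: hl q_def) (simp add: h_def D_def)
  qed
  moreover have "if e \<ge> 0 then wpoly (nat e) q else q = (\<lambda>_. 0)"
  proof (cases "e \<ge> 0")
    case True
    have summand: "wpoly (nat e) (\<lambda>w. p l (w(k := 0)) * w k ^ l)" for l
    proof (cases "e - int l * int (Suc k) \<ge> 0")
      case True
      have "nat e = nat (e - int m) + m" if "int m \<le> e" for m using that by linarith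
      from this[of "l * Suc k"] True have "nat e = nat (e - int l * int (Suc k)) + l * Suc k"
        by (simp only: of_nat_mult)
      then show ?thesis
        using wpoly_mult[OF wpoly_subst0[of "nat (e - int l * int (Suc k))" "p l" k] wpoly_power[of l k]] p(1)[of l] True by simp
    next
      case False
      then show ?thesis using p(1)[of l] wpoly_zero by simp
    qed
    have "wpoly (nat e) q"
      unfolding q_def[abs_def] by (rule wpoly_sum[OF finite_lessThan wpoly_cmult[OF summand]])
    then show ?thesis using True by simp
  next
    case False
    have "e - int l * int (Suc k) < 0" for l
    proof -
      have "0 \<le> int l * int (Suc k)" by simp
      then show ?thesis using False by linarith
    qed
    then have "p l = (\<lambda>_. 0)" for l using p(1)[of l] by (simp add: not_le)
    then show ?thesis using False by (simp add: q_def[abs_def])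
  qed
  ultimately show ?case by blast
qed

lemma homogeneous_wpoly:
  assumes P: "homogeneous (int n) P"
  shows "\<exists>p. wpoly n p \<and> (\<forall>u z w. P (u, z, w) = p w)"
proof -
  have hP: "hol P" and z: "\<And>x. del DZ P x = 0" "\<And>x. del DZb P x = 0"
    using P unfolding homogeneous_def by auto
  obtain m where m: "depends_below m P" using hol_smooth[OF hP] unfolding smooth_def by blast
  \<comment> \<open>Cutting off the coordinates from k on changes neither \<open>P\<close>, which
    depends on those below m, nor p, whose variables lie below n.\<close>
  define k where "k = max m n"
  obtain p where p: "wpoly n p" "\<And>w. (\<forall>j\<ge>k. w j = 0) \<Longrightarrow> P (0, 0, w) = p w"
    using homogeneous_wpoly_below[OF P, of k] by auto
  obtain q where q: "poly_vars q \<subseteq> {..<n}" "\<And>v. p v = poly_eval q v"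
    using wpoly_poly_eval[OF p(1)] by auto
  have "P (u, z, w) = p w" for u z w
  proof -
    define w' where "w' j = (if j < k then w j else 0)" for j
    have "P (u, z, w) = P (0, z, w)" by (rule hol_u[OF hP])
    also have "\<dots> = P (0, 0, w)" using indep_z[of P] hP z by simp
    also have "\<dots> = P (0, 0, w')"
    proof -
      have "\<forall>i<m. w i = w' i" by (simp add: w'_def k_def less_max_iff_disj)
      then show ?thesis using m unfolding depends_below_def by blast
    qed
    also have "\<dots> = p w'" by (rule p(2)) (simp add: w'_def)
    also have "\<dots> = p w" unfolding q(2) using q(1) by (intro poly_eval_cong) (auto simp: w'_def k_def)
    finally show ?thesis .
  qed
  with p(1) show ?thesis by blast
qed

section \<open>Structure of the solutions\<close>

context solution
begin

lemma conj_solution: "solution f N (\<lambda>x. cnj (P x))"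
  by unfold_locales (rule sol_cnj[OF sol])

lemma del_solution: "c = DZ \<or> c = DZb \<Longrightarrow> solution f N (del c P)"
  by unfold_locales (rule sol_del[OF smooth_f sol])

lemma linear_part_conj:
  "del DZ (del (DWb k) P) (zero_fibre z) = 0"
  "del DZb (del (DWb (Suc k)) P) (zero_fibre z) = 0"
proof -
  interpret C: solution f N "\<lambda>x. cnj (P x)" by (rule conj_solution)
  show "del DZ (del (DWb k) P) (zero_fibre z) = 0" "del DZb (del (DWb (Suc k)) P) (zero_fibre z) = 0"
    using C.linear_part[of _ z] by (simp_all add: del_cnj_fun)
qed

text \<open>At u_j = 0 the equation is P_zzbar - f (s + t) + f' P = 0. If 1, f, f' are independent
  this suffices; otherwise it gives \<kappa> P = s + t and P_zzbar = c P, and a second argument is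
  required.\<close>

lemma constant_part:
  "P (zero_fibre z) = 0"
  "del DZ (del (DW 0) P) (zero_fibre z) + del DZb (del (DWb 0) P) (zero_fibre z) = 0"
proof -
  define s where "s = del DZ (del (DW 0) P)"
  define t where "t = del DZb (del (DWb 0) P)"
  have indep: "Q (u, z, w) = Q (0, z, w)" if "Q = P \<or> Q = del c (del c' P)" for Q c c' u z w
  proof (rule indep_u)
    have U: "del DU (del c P) x = 0" for c x
      unfolding del_commute[OF P_smooth, of DU] by (rule del_fun_eq_0) (rule P_DU)
    have "del DU (del c (del c' P)) x = 0" for x
      unfolding del_commute[OF smooth_del[OF P_smooth], of DU] by (rule del_fun_eq_0) (rule U)
    then show "del DU Q x = 0" for x using that P_DU by blast
  qed (use that in auto)
  have eq: "del DZb (del DZ P) (zero_fibre z) - of_real (f u) * (s (zero_fibre z) + t (zero_fibre z))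
      + of_real (deriv f u) * P (zero_fibre z) = 0" for u z
  proof -
    define y :: jet where "y = (u, z, \<lambda>_. 0)"
    have T: "Tu f j 0 y = (if j = 0 then of_real (f u) else 0)" for j
      by (cases j) (auto simp: y_def phi_u_def TT_Suc_at_0 simp del: TT.simps(2))
    have H: "Hol f N Q y = - of_real (f u) * del DZ (del (DW 0) Q) y" for Q
    proof -
      have "(\<Sum>j\<le>N. Tu f j 0 y * GG N Q j y) = (\<Sum>j\<in>{0}. Tu f j 0 y * GG N Q j y)"
        by (rule sum.mono_neutral_right) (auto simp: T)
      then show ?thesis by (simp add: Hol_def T GG_zero_fibre y_def del: TT.simps) (simp add: phi_u_def)
    qed
    have "del DZ (del (DW 0) (\<lambda>x. cnj (P x))) y = cnj (t y)"
      by (simp add: del_cnj_fun t_def)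
    then have "del DZb (del DZ P) y - of_real (f u) * (s y + t y) + of_real (deriv f u) * P y = 0"
      using P_eq[of y] by (simp add: H s_def algebra_simps) (simp add: y_def)
    moreover have "del DZb (del DZ P) y = del DZb (del DZ P) (zero_fibre z)"
      unfolding y_def by (rule indep) blast
    moreover have "s y = s (zero_fibre z)" unfolding y_def s_def by (rule indep) blast
    moreover have "t y = t (zero_fibre z)" unfolding y_def t_def by (rule indep) blast
    moreover have "P y = P (zero_fibre z)" unfolding y_def by (rule indep) blast
    ultimately show ?thesis by simp
  qed
  have "P (zero_fibre z) = 0 \<and> s (zero_fibre z) + t (zero_fibre z) = 0"
  proof (cases "\<exists>\<kappa> c. \<forall>u. deriv f u = \<kappa> * f u - c")
    case False
    have "del DZb (del DZ P) (zero_fibre z) + of_real (f u) * (- (s (zero_fibre z) + t (zero_fibre z)))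
        + of_real (deriv f u) * P (zero_fibre z) = 0" for u
      using eq[of z u] by (simp add: algebra_simps)
    from indep_1_f_f'(2,3)[OF False this]
    have "- (s (zero_fibre z) + t (zero_fibre z)) = 0" "P (zero_fibre z) = 0" .
    then show ?thesis by (simp only: neg_equal_0_iff_equal simp_thms)
  next
    case True
    then obtain \<kappa> c where dep: "\<And>u. deriv f u = \<kappa> * f u - c" by blast
    note nz = dependent_consts[OF dep]
    have 1: "of_real \<kappa> * P (zero_fibre z) = s (zero_fibre z) + t (zero_fibre z)"
      "del DZb (del DZ P) (zero_fibre z) = of_real c * P (zero_fibre z)" for z
    proof -
      define X where "X = del DZb (del DZ P) (zero_fibre z) - of_real c * P (zero_fibre z)"
      define Y where "Y = of_real \<kappa> * P (zero_fibre z) - (s (zero_fibre z) + t (zero_fibre z))"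
      have XY: "X + of_real (f u) * Y = 0" for u
        using eq[of z u] unfolding X_def Y_def dep by (simp add: algebra_simps)
      obtain u v where "f u \<noteq> f v" using f_nonconst by blast
      moreover have "X + of_real (f u) * Y = X + of_real (f v) * Y"
        by (simp only: XY)
      ultimately have "Y = 0" by simp
      with XY[of 0] have "X = 0" by simp
      with \<open>Y = 0\<close> show "of_real \<kappa> * P (zero_fibre z) = s (zero_fibre z) + t (zero_fibre z)"
        "del DZb (del DZ P) (zero_fibre z) = of_real c * P (zero_fibre z)"
        by (simp_all add: X_def Y_def)
    qed
    \<comment> \<open>Along u_j = 0, \<open>linear_part\<close> makes s holomorphic and t
      antiholomorphic in z. Hence the zzbar-derivative of \<kappa> P = s + t is 0, while it also
      equals \<kappa> c P.\<close>
    define Q where "Q x = of_real \<kappa> * P x - s x - t x" for x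
    have ss: "smooth s" and st: "smooth t" by (simp_all add: s_def t_def)
    have sQ: "smooth Q" unfolding Q_def[abs_def] using ss st by simp
    have Q0: "Q (zero_fibre z) = 0" for z using 1(1)[of z] by (simp add: Q_def)
    have "del DZ Q (zero_fibre z) = 0" for z by (rule del_zero_fibre[OF sQ Q0]) simp
    then have "del DZb (del DZ Q) (zero_fibre z) = 0"
      using del_zero_fibre[OF smooth_del[OF sQ]] by blast
    moreover have "del DZ Q = (\<lambda>x. of_real \<kappa> * del DZ P x - del DZ s x - del DZ t x)"
      unfolding Q_def[abs_def] using ss st by (auto simp: del_diff del_cmult)
    then have "del DZb (del DZ Q) (zero_fibre z) =
        of_real \<kappa> * del DZb (del DZ P) (zero_fibre z) - del DZb (del DZ s) (zero_fibre z) - del DZb (del DZ t) (zero_fibre z)"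
      using ss st by (simp add: del_diff del_cmult)
    moreover have "del DZb (del DZ s) (zero_fibre z) = 0"
    proof -
      have "del DZ (del DZb (del (DW 0) P)) (zero_fibre z) = 0" for z
        by (rule del_zero_fibre) (simp_all add: linear_part)
      then have "del DZb s (zero_fibre z) = 0" for z
        unfolding s_def by (simp add: del_commute[of "del (DW 0) P" DZb])
      then have "del DZ (del DZb s) (zero_fibre z) = 0"
        using del_zero_fibre[OF smooth_del[OF ss]] by blast
      then show ?thesis by (simp add: del_commute[OF ss, of DZb])
    qed
    moreover have "del DZb (del DZ t) (zero_fibre z) = 0"
    proof -
      have "del DZb (del DZ (del (DWb 0) P)) (zero_fibre z) = 0" for z
        by (rule del_zero_fibre) (simp_all add: linear_part_conj)
      then have "del DZ t (zero_fibre z) = 0" for z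
        unfolding t_def by (simp add: del_commute[of "del (DWb 0) P" DZ])
      then show ?thesis
        using del_zero_fibre[OF smooth_del[OF st]] by blast
    qed
    ultimately have "P (zero_fibre z) = 0" using nz 1(2)[of z] by simp
    then show ?thesis using 1(1)[of z] by simp
  qed
  then show "P (zero_fibre z) = 0"
    "del DZ (del (DW 0) P) (zero_fibre z) + del DZb (del (DWb 0) P) (zero_fibre z) = 0"
    by (simp_all add: s_def t_def)
qed

text \<open>Along u_j = 0 the holomorphic function s equals minus the antiholomorphic t, so it is
  constant.\<close>

lemma constant_part_deriv:
  "del DZ (del DZ (del (DW 0) P)) (zero_fibre z) = 0"
  "del DZb (del DZ (del (DW 0) P)) (zero_fibre z) = 0"
proof -
  have "del DZ (del DZb (del (DW 0) P)) (zero_fibre z) = 0"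
    by (rule del_zero_fibre) (simp_all add: linear_part)
  then show "del DZb (del DZ (del (DW 0) P)) (zero_fibre z) = 0"
    by (simp add: del_commute[of "del (DW 0) P" DZb])
  have "del DZb (del DZ (del (DWb 0) P)) (zero_fibre z) = 0"
    by (rule del_zero_fibre) (simp_all add: linear_part_conj)
  then have "del DZ (del DZb (del (DWb 0) P)) (zero_fibre z) = 0"
    by (simp add: del_commute[of "del (DWb 0) P" DZ])
  moreover have "del DZ (\<lambda>x. del DZ (del (DW 0) P) x + del DZb (del (DWb 0) P) x) (zero_fibre z) = 0"
    by (rule del_zero_fibre) (simp_all add: constant_part)
  ultimately show "del DZ (del DZ (del (DW 0) P)) (zero_fibre z) = 0"
    by (simp add: del_add)
qed

text \<open>Descending induction: once all higher derivatives vanish, \<open>top_order\<close> makes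
  the u_k-derivative constant in the fibre, so its values at u_j = 0 are all its values.\<close>

lemma PW_zero_of_fibre:
  assumes 0: "\<And>k z. k \<ge> m \<Longrightarrow> del (DW k) P (zero_fibre z) = 0" and k: "k \<ge> m"
  shows "del (DW k) P x = 0"
  using k
proof (induction "N - k" arbitrary: k x rule: less_induct)
  case less
  show ?case
  proof (cases "k < N")
    case False then show ?thesis by (intro PW_top) simp
  next
    case True
    have top: "del (DW j) P x = 0" if "j > k" for j x
      using less(1)[of j x] that True less(2) PW_top[of j x] by (cases "j < N") auto
    obtain u z w where x: "x = (u, z, w)" by (cases x)
    have "del (DW k) P (u, z, w) = del (DW k) P (u, z, \<lambda>_. 0)"
      by (rule indep_all_w) (simp_all add: top_order(1)[of k, OF top] P_mixed)
    also have "\<dots> = del (DW k) P (zero_fibre z)" by (rule hol_u[OF hol_PW])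
    finally show ?thesis using 0 less(2) by (simp add: x)
  qed
qed

lemma PWb_zero_of_fibre:
  assumes 0: "\<And>k z. del (DWb k) P (zero_fibre z) = 0"
  shows "del (DWb k) P x = 0"
proof -
  interpret C: solution f N "\<lambda>x. cnj (P x)" by (rule conj_solution)
  have "del (DW k) (\<lambda>x. cnj (P x)) x = 0"
    by (rule C.PW_zero_of_fibre[of 0]) (simp_all add: del_cnj 0)
  then show ?thesis by (simp add: del_cnj)
qed

text \<open>The uniqueness statement behind the conclusion: it is applied to the z-derivatives of
  \<open>P\<close> and, for the nonvanishing of the leading coefficient, to \<open>P\<close>
  itself.\<close>

lemma zero_of_linear_part:
  assumes "\<And>k z. del (DW k) P (zero_fibre z) = 0" "\<And>k z. del (DWb k) P (zero_fibre z) = 0"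
  shows "P x = 0"
proof -
  obtain u z w where x: "x = (u, z, w)" by (cases x)
  have "P (u, z, w) = P (u, z, \<lambda>_. 0)"
    using PW_zero_of_fibre[of 0] PWb_zero_of_fibre assms by (intro indep_all_w) auto
  also have "\<dots> = P (zero_fibre z)" by (rule indep_u) (simp_all add: P_DU)
  finally show ?thesis by (simp add: x constant_part)
qed

section \<open>Solutions of positive weight\<close>

context
  fixes d :: int
  assumes weight: "weighted_degree d P" and d_pos: "d > 0"
begin

text \<open>Along u_j = 0 the function is constant by \<open>constant_part_deriv\<close>. Its weight
  is d, as the u_0-derivative lowers the weight by one and the z-derivative raises it again, so it
  vanishes at the origin.\<close>

lemma PW0_DZ: "del DZ (del (DW 0) P) (zero_fibre z) = 0"
proof (rule zero_fibre_weight)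
  have "weighted_degree (d - int (Suc 0) + 1) (del DZ (del (DW 0) P))"
    by (intro weighted_del_z weighted_del_w weight) simp_all
  then show "weighted_degree d (del DZ (del (DW 0) P))" by simp
qed (use d_pos in \<open>simp_all add: constant_part_deriv\<close>)

lemma PW_DZ_fibre: "del DZ (del (DW k) P) (zero_fibre z) = 0"
  using PW0_DZ linear_part(2) by (cases k) auto

lemma PWb_DZb_fibre: "del DZb (del (DWb k) P) (zero_fibre z) = 0"
  using constant_part(2)[of z] PW0_DZ[of z] linear_part_conj(2) by (cases k) auto

text \<open>The u_k-coefficient is constant of weight d - k - 1, which is 0 only for k = d -
  1.\<close>

lemma PW_fibre: "int k \<noteq> d - 1 \<Longrightarrow> del (DW k) P (zero_fibre z) = 0"
  by (rule zero_fibre_weight[OF _ PW_DZ_fibre linear_part(1) weighted_del_w(1)[OF _ weight]]) simp_all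

text \<open>The conjugate coefficients have weight d + k + 1 > 0, so none of them survives.\<close>

lemma PWb: "del (DWb k) P x = 0"
proof (rule PWb_zero_of_fibre)
  show "del (DWb k) P (zero_fibre z) = 0" for k z
    by (rule zero_fibre_weight[OF _ linear_part_conj(1) PWb_DZb_fibre weighted_del_w(2)[OF _ weight]])
       (use d_pos in simp_all)
qed

text \<open>The derivative is again a solution, and its linear part consists of derivatives of
  coefficients already known to be constant along u_j = 0.\<close>

lemma P_DZ: "c = DZ \<or> c = DZb \<Longrightarrow> del c P x = 0"
proof -
  assume c: "c = DZ \<or> c = DZb"
  interpret C: solution f N "del c P" by (rule del_solution[OF c])
  show ?thesis
  proof (rule C.zero_of_linear_part)
    show "del (DW k) (del c P) (zero_fibre z) = 0" for k z
      using c PW_DZ_fibre linear_part(1) by (auto simp: del_commute[OF P_smooth, of "DW k"])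
    show "del (DWb k) (del c P) (zero_fibre z) = 0" for k z
      unfolding del_commute[OF P_smooth, of "DWb k"] by (rule del_fun_eq_0) (rule PWb)
  qed
qed

lemma P_homogeneous: "homogeneous d P"
  unfolding homogeneous_def hol_def using weight P_DZ PWb P_DU by simp

lemma P_wpoly: "\<exists>p. wpoly (nat d) p \<and> (\<forall>u z w. P (u, z, w) = p w)"
  using homogeneous_wpoly[of "nat d" P] P_homogeneous d_pos by simp

text \<open>The only linear coefficient that could be nonzero is that of u_{d-1}; a solution free of
  this variable therefore vanishes.\<close>

lemma P_lead:
  assumes "depends_below (nat (d - 1)) P"
  shows "P x = 0"
proof (rule zero_of_linear_part)
  show "del (DW k) P (zero_fibre z) = 0" for k z
    using PW_fibre del_eq_0_of_depends_below(1)[OF assms, of k] by (cases "int k = d - 1") auto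
  show "del (DWb k) P (zero_fibre z) = 0" for k z by (rule PWb)
qed

end

end

lemma weighted_degree_cnj:
  assumes "weighted_degree d P" shows "weighted_degree (- d) (\<lambda>x. cnj (P x))"
  unfolding weighted_degree_def
proof (intro allI impI)
  fix l u z w
  assume l: "cmod l = 1"
  then have "P (u, inverse l * z, \<lambda>j. l ^ (j + 1) * w j) = l powi d * P (u, z, w)"
    using assms unfolding weighted_degree_def by blast
  then show "cnj (P (u, inverse l * z, \<lambda>j. l ^ (j + 1) * w j)) = l powi (- d) * cnj (P (u, z, w))"
    by (simp add: norm_1_cnj[OF l] power_int_minus power_int_inverse)
qed

theorem lemma8p12:
  fixes f :: "real \<Rightarrow> real" and d :: int and P :: "jet \<Rightarrow> complex"
  assumes smooth: "smooth_real f"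
    and independent: "\<forall>a b. (\<forall>u. a * f u + b * deriv f u = 0) \<longrightarrow> a = 0 \<and> b = 0"
    and nonlinear: "\<not> affine_fun f"
    and P: "P \<in> V f d" "P \<noteq> (\<lambda>_. 0)"
  shows "(d > 0 \<longrightarrow>
           (\<forall>x. d_z P x = 0) \<and>
           (\<exists>b q. b \<noteq> 0 \<and> poly_vars q \<subseteq> {j. int j < \<bar>d\<bar> - 1} \<and>
              (\<forall>u z w. P (u, z, w) = b * w (nat (d - 1)) + poly_eval q w))) \<and>
         (d < 0 \<longrightarrow>
           (\<forall>x. d_zbar P x = 0) \<and>
           (\<exists>c q. c \<noteq> 0 \<and> poly_vars q \<subseteq> {j. int j < \<bar>d\<bar> - 1} \<and>
              (\<forall>u z w. P (u, z, w) = c * cnj (w (nat (- d - 1))) + poly_eval q (\<lambda>j. cnj (w j)))))"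
proof -
  obtain N where N: "sol f N P" using V_sol[OF smooth P(1)] by blast
  have weight: "weighted_degree d P" using P(1) unfolding V_def by blast
  interpret solution f N P
    using smooth independent nonlinear N by unfold_locales blast+
  \<comment> \<open>Stated for an arbitrary e and polynomial, so that it serves d > 0 with p and d <
    0 with the polynomial p' obtained from the conjugate solution.\<close>
  have lead: "\<exists>b q. b \<noteq> 0 \<and> poly_vars q \<subseteq> {j. int j < e - 1} \<and> (\<forall>v. p v = b * v (nat (e - 1)) + poly_eval q v)"
    if e: "e > 0" and p: "wpoly (nat e) p" and dep: "\<not> depends_below (nat (e - 1)) (\<lambda>(u, z, w). p w)" for e p
  proof -
    have "nat e = Suc (nat (e - 1))" using e by simp
    then obtain b q where q: "poly_vars q \<subseteq> {..<nat (e - 1)}" "\<And>v. p v = b * v (nat (e - 1)) + poly_eval q v"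
      using wpoly_lead[of "nat (e - 1)" p] p by auto
    have "b \<noteq> 0"
    proof
      assume "b = 0"
      then have "depends_below (nat (e - 1)) (\<lambda>(u, z, w). p w)"
        unfolding depends_below_def using q(1)
        by (auto simp: q(2) intro!: poly_eval_cong)
      with dep show False ..
    qed
    moreover have "{..<nat (e - 1)} = {j. int j < e - 1}" by auto
    ultimately show ?thesis using q by auto
  qed
  show ?thesis
  proof (intro conjI impI)
    assume d: "d > 0"
    show "\<forall>x. d_z P x = 0" using P_DZ[OF weight d, of DZ] by (simp add: del.simps)
    obtain p where p: "wpoly (nat d) p" "\<And>u z w. P (u, z, w) = p w" using P_wpoly[OF weight d] by blast
    then have "P = (\<lambda>(u, z, w). p w)" by auto
    then have "\<not> depends_below (nat (d - 1)) (\<lambda>(u, z, w). p w)"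
      using P_lead[OF weight d] P(2) by blast
    from lead[OF d p(1) this]
    show "\<exists>b q. b \<noteq> 0 \<and> poly_vars q \<subseteq> {j. int j < \<bar>d\<bar> - 1} \<and>
              (\<forall>u z w. P (u, z, w) = b * w (nat (d - 1)) + poly_eval q w)"
      using d by (simp add: p(2))
  next
    assume d: "d < 0"
    interpret C: solution f N "\<lambda>x. cnj (P x)" by (rule conj_solution)
    note weight' = weighted_degree_cnj[OF weight]
    have d': "- d > 0" using d by simp
    show "\<forall>x. d_zbar P x = 0" 
      using C.P_DZ[OF weight' d', of DZ] by (simp add: del_cnj) (simp add: del.simps)
    obtain p where p: "wpoly (nat (- d)) p" "\<And>u z w. cnj (P (u, z, w)) = p w" using C.P_wpoly[OF weight' d'] by blast
    \<comment> \<open>Conjugates the coefficients only: the conjugate of \<open>P\<close> is p in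
      the u_j, so \<open>P\<close> is p' in their conjugates.\<close>
    define p' where "p' = (\<lambda>v. cnj (p (\<lambda>j. cnj (v j))))"
    have P_p': "P (u, z, w) = p' (\<lambda>j. cnj (w j))" for u z w
      using arg_cong[OF p(2)[of u z w], of cnj] by (simp add: p'_def)
    have "\<not> depends_below (nat (- d - 1)) (\<lambda>(u, z, w). p' w)"
    proof
      assume *: "depends_below (nat (- d - 1)) (\<lambda>(u, z, w). p' w)"
      have "depends_below (nat (- d - 1)) (\<lambda>x. cnj (P x))"
        unfolding depends_below_def
      proof (intro allI impI)
        fix u z and w w' :: "nat \<Rightarrow> complex"
        assume "\<forall>i<nat (- d - 1). w i = w' i"
        then have "p' (\<lambda>j. cnj (w j)) = p' (\<lambda>j. cnj (w' j))"
          using * unfolding depends_below_def by simp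
        then show "cnj (P (u, z, w)) = cnj (P (u, z, w'))" by (simp add: P_p')
      qed
      from C.P_lead[OF weight' d' this] P(2) show False by auto
    qed
    moreover have "wpoly (nat (- d)) p'" unfolding p'_def by (rule wpoly_cnj[OF p(1)])
    ultimately show "\<exists>c q. c \<noteq> 0 \<and> poly_vars q \<subseteq> {j. int j < \<bar>d\<bar> - 1} \<and>
              (\<forall>u z w. P (u, z, w) = c * cnj (w (nat (- d - 1))) + poly_eval q (\<lambda>j. cnj (w j)))"
      using lead[OF d', of p'] d by (auto simp: P_p')
  qed
qed

end
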